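(* Suppose that the finite-dimensional (resp. locally finite-dimensional, resp. essentially finite-dimensional) locally unital algebra $A=\bigoplus_{i,j\in I}e_iAe_j$ has a triangular decomposition given by $(\Lambda,\le)$, $\partial:I\to\Lambda$, $A^\flat$, $A^\sharp$, with Cartan subalgebra $A^\circ=A^\flat\cap A^\sharp$. Let $A^\circ=\bigoplus_{i,j\in\hat I}\hat e_iA^\circ\hat e_j$ be an idempotent expansion of $A^\circ=\bigoplus_{i,j\in I}e_iA^\circ e_j$ such that (i) $\hat I\cap\Lambda=\varnothing$; (ii) $\hat I$ contains a subset $\mathbf B$ indexing a full set $\{\hat e_b\mid b\in\mathbf B\}$ of pairwise non-conjugate primitive idempotents in $A^\circ$; (iii) there is a function $q:\hat I\to I$ with $|q^{-1}(i)|<\infty$ and $e_i=\sum_{j\in q^{-1}(i)}\hat e_j$ for all $i\in I$. Then $A=\bigoplus_{i,j\in\hat I}\hat e_iA\hat e_j$ has a triangular decomposition with the given Borel subalgebras $A^\flat,A^\sharp$ and poset $\Lambda$, taking the function in (TD2) to be $\rho:=\partial\circ q:\hat I\to\Lambda$. Moreover, for all $i,j\in\hat I$, $\hat e_iA^\flat$ and $A^\sharp\hat e_j$ are $\mathbf B$-free as right and left $A^\circ$-modules, respectively. Hence, for $i,j\in\hat I$ and $a,b\in\mathbf B$, one can choose subsets $Y(i,a)\subset\hat e_iA^\flat\hat e_a$ and $X(b,j)\subset\hat e_bA^\sharp\hat e_j$ so that (a) $\hat e_iA^\flat=\bigoplus_{a\in\mathbf B}\bigoplus_{y\in Y(i,a)}yA^\circ$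 with $yA^\circ\cong\hat e_aA^\circ$ for $y\in Y(i,a)$; (b) $A^\sharp\hat e_j=\bigoplus_{b\in\mathbf B}\bigoplus_{x\in X(b,j)}A^\circ x$ with $A^\circ x\cong A^\circ\hat e_b$ for $x\in X(b,j)$; (c) $Y(b,b)=X(b,b)=\{\hat e_b\}$ for all $b\in\mathbf B$; and, letting $H(a,b)$ be a basis of $\hat e_aA^\circ\hat e_b$, this data makes $A=\bigoplus_{i,j\in\hat I}\hat e_iA\hat e_j$ into a finite (resp. upper finite, resp. essentially finite) based stratified algebra, with stratification function the restriction $\rho:\mathbf B\to\Lambda$.
   Context: $\Bbbk$ is an algebraically closed field; everything is $\Bbbk$-linear. A locally unital algebra $A=\bigoplus_{i,j\in I}e_iAe_j$ is an associative algebra with a given system of mutually orthogonal idempotents $e_i$ giving this decomposition; it is locally finite-dimensional if all $e_iAe_j$ are finite-dimensional, essentially finite-dimensional if all $e_iA$ and $Ae_j$ are. A locally unital subalgebra is a subspace closed under multiplication containing all the $e_i$. $A=\bigoplus_{i,j\in\hat I}\hat e_iA\hat e_j$ is an idempotent expansion of $A=\bigoplus_{i,j\in I}e_iAe_j$ if each $e_i$ is a finite sum of idempotents $\hat e_j$. Triangular decomposition of a finite-dimensional (resp. locally finite-dimensional, resp. essentially finite-dimensional) locally unital algebra $A=\bigoplus_{i,j\in I}e_iAe_j$: (TD1) a poset $(\Lambda,\le)$, upper finite (all $[\lambda,\infty)$ finite) in the locally finite-dimensional case, interval finite in the essentially finite-dimensional case; (TD2) a function $\partial:I\to\Lambda$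 with finite fibres; (TD3) locally unital subalgebras $A^\flat$, $A^\sharp$ (negative and positive Borel subalgebras), with Cartan subalgebra $A^\circ:=A^\flat\cap A^\sharp$; such that (TD4) $A^\flat$ is a projective right $A^\circ$-module and $A^\sharp$ is a projective left $A^\circ$-module; (TD5) multiplication $A^\flat\otimes_{A^\circ}A^\sharp\to A$ is a linear isomorphism; (TD6) for $i,j\in I$, $e_jA^\flat e_i$ and $e_iA^\sharp e_j$ are zero unless $\partial(j)\le\partial(i)$, and $e_iA^\flat e_j=e_iA^\sharp e_j$ when $\partial(i)=\partial(j)$. $\mathbf B$-free: for a locally unital algebra $D$ with distinguished idempotents $\{\hat e_i\}_{i\in\hat I}$ and $\mathbf B\subseteq\hat I$, a left $D$-module $V$ is $\mathbf B$-free if there is a subset $X=\bigsqcup_{b\in\mathbf B}X(b)$ of $V$, with $X(b)\subset\hat e_bV$, such that $V=\bigoplus_{x\in X}Dx$ and, for $x\in X(b)$, the homomorphism $D\hat e_b\to Dx$, $a\mapsto ax$, is an isomorphism. Similarly for right modules. Based stratified algebra: a finite (resp. upper finite, resp. essentially finite) based stratified algebra is a finite-dimensional (resp. locally finite-dimensional, resp. essentially finite-dimensional) locally unital algebra $A=\bigoplus_{i,j\in I}e_iAe_j$ with: (S1) a subset $\mathbf B\subseteq I$ indexing special idempotents $e_b$; (S2) a poset $(\Lambda,\le)$, upper finite in the upper finite case, interval finite in the essentially finite case, with $\Lambda\cap I=\varnothing$; (S3) a function $\rho:\mathbf B\to\Lambda$ with finite fibres $\mathbf B_\lambda$; (S4)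 sets $Y(i,a)\subset e_iAe_a$, $H(a,b)\subset e_aAe_b$, $X(b,j)\subset e_bAe_j$ for $i,j\in I$, $a,b\in\mathbf B$; such that, with $Y(a):=\bigcup_iY(i,a)$, $X(b):=\bigcup_jX(b,j)$: (S5) the products $yhx$ for $(y,h,x)\in\bigcup_{a,b\in\mathbf B}Y(a)\times H(a,b)\times X(b)$ are a basis of $A$; (S6) for $a\ne b$ in $\mathbf B$, $H(a,b)=\varnothing$ unless $\rho(a)=\rho(b)$, $Y(b,a)$ and $X(a,b)$ are empty unless $\rho(b)<\rho(a)$, and $Y(a,a)=X(a,a)=\{e_a\}$ for all $a$; (S7) with $e_\lambda:=\sum_{b\in\mathbf B_\lambda}e_b$, $A_{\le\lambda}$ the quotient of $A$ by the two-sided ideal generated by $\{e_\mu\mid\mu\not\le\lambda\}$ and $A_\lambda:=\bar e_\lambda A_{\le\lambda}\bar e_\lambda$ (bars denoting images in $A_{\le\lambda}$), each $A_\lambda$ is basic and $\bar e_\lambda=\sum_{b\in\mathbf B_\lambda}\bar e_b$ is a decomposition of its identity into mutually orthogonal primitive idempotents. *)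

theory Defs
  imports
    "HOL-Computational_Algebra.Polynomial"
    "HOL-Algebra.QuotRing"
    "HOL-Library.Function_Algebras"
    "HOL-Library.Poly_Mapping"
    "HOL-Library.Disjoint_Sets"
begin

section \<open>Locally unital algebras\<close>

text \<open>
  The ambient algebra is the whole of a type \<open>'a\<close> of class \<^class>\<open>ring\<close> (associative, no unit
  assumed), with scalar multiplication \<open>s\<close>; subalgebras, ideals and modules inside it are sets.
\<close>

locale k_algebra = vector_space s for s :: "'k::field \<Rightarrow> 'a::ring \<Rightarrow> 'a" +
  assumes scale_mult_left: "s c (x * y) = s c x * y"
    and scale_mult_right: "s c (x * y) = x * s c y"

text \<open>
  Internal direct sum \<open>W = \<Oplus>\<^sub>t\<^sub>\<in>\<^sub>T V t\<close>: summation is a bijection from the finitely supported families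
  \<open>f\<close> with \<open>f t \<in> V t\<close> (extended by zero outside \<open>T\<close>) onto \<open>W\<close>.
\<close>

definition is_direct_sum :: "'m::ab_group_add set \<Rightarrow> 't set \<Rightarrow> ('t \<Rightarrow> 'm set) \<Rightarrow> bool" where
  "is_direct_sum W T V \<longleftrightarrow>
     bij_betw (\<lambda>f. \<Sum>t | f t \<noteq> 0. f t)
       {f. (\<forall>t\<in>T. f t \<in> V t) \<and> (\<forall>t. t \<notin> T \<longrightarrow> f t = 0) \<and> finite {t. f t \<noteq> 0}} W"

definition is_basis :: "('k::field \<Rightarrow> 'a::ab_group_add \<Rightarrow> 'a) \<Rightarrow> 'a set \<Rightarrow> 'a set \<Rightarrow> bool" where
  "is_basis s W S \<longleftrightarrow> \<not> module.dependent s S \<and> module.span s S = W"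

definition fin_dim :: "('k::field \<Rightarrow> 'a::ab_group_add \<Rightarrow> 'a) \<Rightarrow> 'a set \<Rightarrow> bool" where
  "fin_dim s W \<longleftrightarrow> (\<exists>F. finite F \<and> W \<subseteq> module.span s F)"

definition peirce :: "'a::ring \<Rightarrow> 'a set \<Rightarrow> 'a \<Rightarrow> 'a set" where
  "peirce e D f = {e * x * f | x. x \<in> D}"

definition lmul :: "'a::ring \<Rightarrow> 'a set \<Rightarrow> 'a set" where
  "lmul e D = {e * x | x. x \<in> D}"

definition rmul :: "'a::ring set \<Rightarrow> 'a \<Rightarrow> 'a set" where
  "rmul D e = {x * e | x. x \<in> D}"

text \<open>\<open>D = \<Oplus>\<^sub>i\<^sub>,\<^sub>j\<^sub>\<in>\<^sub>I e\<^sub>i D e\<^sub>j\<close> for mutually orthogonal idempotents \<open>e\<^sub>i \<in> D\<close>.\<close>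

definition idem_decomp :: "'a::ring set \<Rightarrow> 'i set \<Rightarrow> ('i \<Rightarrow> 'a) \<Rightarrow> bool" where
  "idem_decomp D I e \<longleftrightarrow>
     (\<forall>i\<in>I. e i \<in> D \<and> e i * e i = e i) \<and>
     (\<forall>i\<in>I. \<forall>j\<in>I. i \<noteq> j \<longrightarrow> e i * e j = 0) \<and>
     is_direct_sum D (I \<times> I) (\<lambda>(i, j). peirce (e i) D (e j))"

definition idem_expansion ::
    "'a::ring set \<Rightarrow> 'i set \<Rightarrow> ('i \<Rightarrow> 'a) \<Rightarrow> 'j set \<Rightarrow> ('j \<Rightarrow> 'a) \<Rightarrow> bool" where
  "idem_expansion D I e J f \<longleftrightarrow>
     idem_decomp D I e \<and> idem_decomp D J f \<and>
     (\<forall>i\<in>I. \<exists>S. finite S \<and> S \<subseteq> J \<and> e i = (\<Sum>j\<in>S. f j))"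

definition lu_subalgebra ::
    "('k::field \<Rightarrow> 'a::ring \<Rightarrow> 'a) \<Rightarrow> 'i set \<Rightarrow> ('i \<Rightarrow> 'a) \<Rightarrow> 'a set \<Rightarrow> bool" where
  "lu_subalgebra s I e D \<longleftrightarrow>
     module.subspace s D \<and> (\<forall>x\<in>D. \<forall>y\<in>D. x * y \<in> D) \<and> (\<forall>i\<in>I. e i \<in> D)"

locale locally_unital_algebra = k_algebra s
  for s :: "'k::field \<Rightarrow> 'a::ring \<Rightarrow> 'a" +
  fixes I :: "'i set" and e :: "'i \<Rightarrow> 'a"
  assumes decomp: "idem_decomp UNIV I e"

text \<open>The three parallel cases treated uniformly below.\<close>

datatype fin_kind = Finite | Upper_Finite | Essentially_Finite

fun dim_condition ::
    "fin_kind \<Rightarrow> ('k::field \<Rightarrow> 'a::ring \<Rightarrow> 'a) \<Rightarrow> 'i set \<Rightarrow> ('i \<Rightarrow> 'a) \<Rightarrow> bool" where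
  "dim_condition Finite s I e = fin_dim s UNIV"
| "dim_condition Upper_Finite s I e = (\<forall>i\<in>I. \<forall>j\<in>I. fin_dim s (peirce (e i) UNIV (e j)))"
| "dim_condition Essentially_Finite s I e =
     (\<forall>i\<in>I. fin_dim s (lmul (e i) UNIV) \<and> fin_dim s (rmul UNIV (e i)))"

text \<open>The order on \<open>\<Lambda>\<close> is a relation \<open>ord\<close>, with \<open>(x, y) \<in> ord\<close> for \<open>x \<le> y\<close>.\<close>

fun poset_condition :: "fin_kind \<Rightarrow> 'l set \<Rightarrow> ('l \<times> 'l) set \<Rightarrow> bool" where
  "poset_condition Finite \<Lambda> ord = True"
| "poset_condition Upper_Finite \<Lambda> ord = (\<forall>x\<in>\<Lambda>. finite {z \<in> \<Lambda>. (x, z) \<in> ord})"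
| "poset_condition Essentially_Finite \<Lambda> ord =
     (\<forall>x\<in>\<Lambda>. \<forall>y\<in>\<Lambda>. finite {z \<in> \<Lambda>. (x, z) \<in> ord \<and> (z, y) \<in> ord})"

definition finite_fibres :: "'i set \<Rightarrow> 'l set \<Rightarrow> ('i \<Rightarrow> 'l) \<Rightarrow> bool" where
  "finite_fibres I \<Lambda> f \<longleftrightarrow> f \<in> I \<rightarrow> \<Lambda> \<and> (\<forall>x\<in>\<Lambda>. finite {i \<in> I. f i = x})"

section \<open>Modules\<close>

text \<open>
  Left and right modules over a locally unital algebra \<open>D\<close> are treated together: \<open>mul\<close> is \<open>(*)\<close>
  for left modules, and the opposite multiplication for right modules. The last clause is local
  unitality: if \<open>D = \<Oplus> e\<^sub>i D e\<^sub>j\<close>, it says \<open>M = \<Oplus> e\<^sub>i M\<close>. Such a module has a unique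
  compatible \<open>\<k>\<close>-linear structure (\<open>c m = (c d) m\<close> whenever \<open>d m = m\<close>), and additive maps
  commuting with \<open>D\<close> are automatically \<open>\<k>\<close>-linear; hence scalars do not appear.
\<close>

definition is_module ::
    "('a \<Rightarrow> 'a \<Rightarrow> 'a) \<Rightarrow> 'a::ring set \<Rightarrow> ('a \<Rightarrow> 'm \<Rightarrow> 'm) \<Rightarrow> 'm::ab_group_add set \<Rightarrow> bool" where
  "is_module mul D act M \<longleftrightarrow>
     0 \<in> M \<and> (\<forall>m\<in>M. \<forall>n\<in>M. m - n \<in> M) \<and>
     (\<forall>d\<in>D. \<forall>m\<in>M. act d m \<in> M) \<and>
     (\<forall>d\<in>D. \<forall>m\<in>M. \<forall>n\<in>M. act d (m + n) = act d m + act d n) \<and>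
     (\<forall>c\<in>D. \<forall>d\<in>D. \<forall>m\<in>M. act (c + d) m = act c m + act d m) \<and>
     (\<forall>c\<in>D. \<forall>d\<in>D. \<forall>m\<in>M. act (mul c d) m = act c (act d m)) \<and>
     (\<forall>m\<in>M. \<exists>d\<in>D. act d m = m)"

definition is_module_hom ::
    "'a set \<Rightarrow> ('a \<Rightarrow> 'm::ab_group_add \<Rightarrow> 'm) \<Rightarrow> 'm set \<Rightarrow>
     ('a \<Rightarrow> 'n::ab_group_add \<Rightarrow> 'n) \<Rightarrow> 'n set \<Rightarrow> ('m \<Rightarrow> 'n) \<Rightarrow> bool" where
  "is_module_hom D act M act' N f \<longleftrightarrow>
     f \<in> M \<rightarrow> N \<and> (\<forall>m\<in>M. \<forall>n\<in>M. f (m + n) = f m + f n) \<and>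
     (\<forall>d\<in>D. \<forall>m\<in>M. f (act d m) = act' d (f m))"

definition module_isomorphic ::
    "'a set \<Rightarrow> ('a \<Rightarrow> 'm::ab_group_add \<Rightarrow> 'm) \<Rightarrow> 'm set \<Rightarrow>
     ('a \<Rightarrow> 'n::ab_group_add \<Rightarrow> 'n) \<Rightarrow> 'n set \<Rightarrow> bool" where
  "module_isomorphic D act M act' N \<longleftrightarrow>
     (\<exists>f. is_module_hom D act M act' N f \<and> bij_betw f M N)"

text \<open>
  Projectivity as the lifting property. A definition cannot quantify over types, so the test
  modules have their elements in the additive group \<open>'a \<Rightarrow> 'a\<close>. This loses nothing: that group
  contains a copy of \<open>P \<subseteq> 'a\<close> and the canonical cover \<open>\<Oplus>\<^sub>p D e\<^bsub>i(p)\<^esub> \<rightarrow> P\<close>, indexed by the homogeneous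
  elements \<open>p\<close> of \<open>P\<close>, and \<open>P\<close> is projective as soon as this cover splits.
\<close>

definition projective ::
    "('a \<Rightarrow> 'a \<Rightarrow> 'a) \<Rightarrow> 'a::ring set \<Rightarrow> ('a \<Rightarrow> 'a \<Rightarrow> 'a) \<Rightarrow> 'a set \<Rightarrow> bool" where
  "projective mul D act P \<longleftrightarrow>
     is_module mul D act P \<and>
     (\<forall>(M :: ('a \<Rightarrow> 'a) set) (N :: ('a \<Rightarrow> 'a) set) actM actN f g.
        is_module mul D actM M \<and> is_module mul D actN N \<and>
        is_module_hom D actM M actN N f \<and> f ` M = N \<and> is_module_hom D act P actN N g \<longrightarrow>
        (\<exists>h. is_module_hom D act P actM M h \<and> (\<forall>p\<in>P. f (h p) = g p)))"

abbreviation opp :: "'a::ring \<Rightarrow> 'a \<Rightarrow> 'a" where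
  "opp \<equiv> \<lambda>x y. y * x"

abbreviation left_projective :: "'a::ring set \<Rightarrow> 'a set \<Rightarrow> bool" where
  "left_projective D P \<equiv> projective (*) D (*) P"

abbreviation right_projective :: "'a::ring set \<Rightarrow> 'a set \<Rightarrow> bool" where
  "right_projective D P \<equiv> projective opp D opp P"

text \<open>\<open>\<^bold>B\<close>-freeness of the \<open>D\<close>-module \<open>V\<close>.\<close>

definition B_free ::
    "('a \<Rightarrow> 'a \<Rightarrow> 'a) \<Rightarrow> 'a::ring set \<Rightarrow> ('b \<Rightarrow> 'a) \<Rightarrow> 'b set \<Rightarrow>
     ('a \<Rightarrow> 'm \<Rightarrow> 'm) \<Rightarrow> 'm::ab_group_add set \<Rightarrow> bool" where
  "B_free mul D e B act V \<longleftrightarrow>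
     is_module mul D act V \<and>
     (\<exists>X :: 'b \<Rightarrow> 'm set.
        (\<forall>b\<in>B. X b \<subseteq> act (e b) ` V) \<and> disjoint_family_on X B \<and>
        is_direct_sum V (\<Union>b\<in>B. X b) (\<lambda>x. (\<lambda>d. act d x) ` D) \<and>
        (\<forall>b\<in>B. \<forall>x\<in>X b.
           bij_betw (\<lambda>a. act a x) ((\<lambda>d. mul d (e b)) ` D) ((\<lambda>d. act d x) ` D)))"

abbreviation left_B_free ::
    "'a::ring set \<Rightarrow> ('b \<Rightarrow> 'a) \<Rightarrow> 'b set \<Rightarrow> 'a set \<Rightarrow> bool" where
  "left_B_free D e B V \<equiv> B_free (*) D e B (*) V"

abbreviation right_B_free ::
    "'a::ring set \<Rightarrow> ('b \<Rightarrow> 'a) \<Rightarrow> 'b set \<Rightarrow> 'a set \<Rightarrow> bool" where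
  "right_B_free D e B V \<equiv> B_free opp D e B opp V"

section \<open>The tensor product over a subalgebra\<close>

text \<open>
  \<open>P \<otimes>\<^sub>D Q\<close> is the free vector space on \<open>P \<times> Q\<close> modulo the subspace spanned by the bilinearity
  and balancing relations; its elements are cosets.
\<close>

definition free_scale :: "'k::field \<Rightarrow> ('b \<Rightarrow>\<^sub>0 'k) \<Rightarrow> ('b \<Rightarrow>\<^sub>0 'k)" where
  "free_scale c f = Poly_Mapping.map ((*) c) f"

definition tensor_relations ::
    "('k::field \<Rightarrow> 'a::ring \<Rightarrow> 'a) \<Rightarrow> 'a set \<Rightarrow> 'a set \<Rightarrow> 'a set \<Rightarrow> ('a \<times> 'a \<Rightarrow>\<^sub>0 'k) set" where
  "tensor_relations s D P Q =
     (let u = (\<lambda>x y. Poly_Mapping.single (x, y) (1::'k)) in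
       {u (x + x') y - u x y - u x' y | x x' y. x \<in> P \<and> x' \<in> P \<and> y \<in> Q} \<union>
       {u x (y + y') - u x y - u x y' | x y y'. x \<in> P \<and> y \<in> Q \<and> y' \<in> Q} \<union>
       {u (s c x) y - free_scale c (u x y) | c x y. x \<in> P \<and> y \<in> Q} \<union>
       {u x (s c y) - free_scale c (u x y) | c x y. x \<in> P \<and> y \<in> Q} \<union>
       {u (x * d) y - u x (d * y) | x d y. x \<in> P \<and> d \<in> D \<and> y \<in> Q})"

definition tensor_product ::
    "('k::field \<Rightarrow> 'a::ring \<Rightarrow> 'a) \<Rightarrow> 'a set \<Rightarrow> 'a set \<Rightarrow> 'a set \<Rightarrow> ('a \<times> 'a \<Rightarrow>\<^sub>0 'k) set set" where
  "tensor_product s D P Q =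
     {t. Poly_Mapping.keys t \<subseteq> P \<times> Q} //
     {(t, t'). Poly_Mapping.keys t \<subseteq> P \<times> Q \<and> Poly_Mapping.keys t' \<subseteq> P \<times> Q \<and>
               t' - t \<in> module.span free_scale (tensor_relations s D P Q)}"

definition mult_free ::
    "('k::field \<Rightarrow> 'a::ring \<Rightarrow> 'a) \<Rightarrow> ('a \<times> 'a \<Rightarrow>\<^sub>0 'k) \<Rightarrow> 'a" where
  "mult_free s t = (\<Sum>(x, y) \<in> Poly_Mapping.keys t. s (Poly_Mapping.lookup t (x, y)) (x * y))"

text \<open>
  The map \<open>P \<otimes>\<^sub>D Q \<rightarrow> A\<close>, \<open>x \<otimes> y \<mapsto> x y\<close>. The linear map \<^const>\<open>mult_free\<close> is constant on each coset,
  as it kills the relations; so the induced map is linear, and is a linear isomorphism iff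
  it is bijective.
\<close>

definition mult_tensor ::
    "('k::field \<Rightarrow> 'a::ring \<Rightarrow> 'a) \<Rightarrow> ('a \<times> 'a \<Rightarrow>\<^sub>0 'k) set \<Rightarrow> 'a" where
  "mult_tensor s T = the_elem (mult_free s ` T)"

section \<open>Triangular decompositions\<close>

locale triangular_decomposition = locally_unital_algebra s I e
  for kind :: fin_kind
    and s :: "'k::field \<Rightarrow> 'a::ring \<Rightarrow> 'a" and I :: "'i set" and e :: "'i \<Rightarrow> 'a"
    and \<Lambda> :: "'l set" and ord :: "('l \<times> 'l) set" and \<delta> :: "'i \<Rightarrow> 'l"
    and Aflat :: "'a set" and Asharp :: "'a set" +
  assumes dim: "dim_condition kind s I e"
    and TD1: "partial_order_on \<Lambda> ord" "poset_condition kind \<Lambda> ord"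
    and TD2: "finite_fibres I \<Lambda> \<delta>"
    and TD3: "lu_subalgebra s I e Aflat" "lu_subalgebra s I e Asharp"
    and TD4: "right_projective (Aflat \<inter> Asharp) Aflat" "left_projective (Aflat \<inter> Asharp) Asharp"
    and TD5: "bij_betw (mult_tensor s) (tensor_product s (Aflat \<inter> Asharp) Aflat Asharp) UNIV"
    and TD6: "\<And>i j. i \<in> I \<Longrightarrow> j \<in> I \<Longrightarrow> (\<delta> j, \<delta> i) \<notin> ord \<Longrightarrow>
                peirce (e j) Aflat (e i) = {0} \<and> peirce (e i) Asharp (e j) = {0}"
             "\<And>i j. i \<in> I \<Longrightarrow> j \<in> I \<Longrightarrow> \<delta> i = \<delta> j \<Longrightarrow>
                peirce (e i) Aflat (e j) = peirce (e i) Asharp (e j)"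

section \<open>Idempotents and basic algebras\<close>

text \<open>
  Notions about rings are stated for ring records, so that they apply both to subalgebras of \<open>'a\<close>
  and to subquotients. A subalgebra has no unit in general: the field \<open>one\<close> of \<open>subalgebra_ring\<close>
  is a dummy, never used below (in \<^const>\<open>FactRing\<close> it only affects the unit, which
  \<open>corner_ring\<close> overrides).
\<close>

definition subalgebra_ring :: "'a::ring set \<Rightarrow> 'a ring" where
  "subalgebra_ring D = \<lparr>carrier = D, mult = (*), one = 0, zero = 0, add = (+)\<rparr>"

definition corner_ring :: "('a, 'm) ring_scheme \<Rightarrow> 'a \<Rightarrow> ('a, 'm) ring_scheme" where
  "corner_ring R e =
     R\<lparr>carrier := {e \<otimes>\<^bsub>R\<^esub> x \<otimes>\<^bsub>R\<^esub> e | x. x \<in> carrier R}, one := e\<rparr>"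

definition idempotent :: "('a, 'm) ring_scheme \<Rightarrow> 'a \<Rightarrow> bool" where
  "idempotent R e \<longleftrightarrow> e \<in> carrier R \<and> e \<otimes>\<^bsub>R\<^esub> e = e"

definition primitive_idempotent :: "('a, 'm) ring_scheme \<Rightarrow> 'a \<Rightarrow> bool" where
  "primitive_idempotent R e \<longleftrightarrow>
     idempotent R e \<and> e \<noteq> \<zero>\<^bsub>R\<^esub> \<and>
     \<not> (\<exists>f g. idempotent R f \<and> idempotent R g \<and> f \<noteq> \<zero>\<^bsub>R\<^esub> \<and> g \<noteq> \<zero>\<^bsub>R\<^esub> \<and>
             f \<otimes>\<^bsub>R\<^esub> g = \<zero>\<^bsub>R\<^esub> \<and> g \<otimes>\<^bsub>R\<^esub> f = \<zero>\<^bsub>R\<^esub> \<and> e = f \<oplus>\<^bsub>R\<^esub> g)"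

text \<open>Without a unit, conjugacy means conjugacy under the units of some unital corner \<open>g R g\<close>.\<close>

definition conjugate_idempotents :: "('a, 'm) ring_scheme \<Rightarrow> 'a \<Rightarrow> 'a \<Rightarrow> bool" where
  "conjugate_idempotents R e f \<longleftrightarrow>
     (\<exists>g u v. idempotent R g \<and>
        {e, f, u, v} \<subseteq> carrier (corner_ring R g) \<and>
        u \<otimes>\<^bsub>R\<^esub> v = g \<and> v \<otimes>\<^bsub>R\<^esub> u = g \<and> u \<otimes>\<^bsub>R\<^esub> e \<otimes>\<^bsub>R\<^esub> v = f)"

definition full_set_of_primitive_idempotents ::
    "('a, 'm) ring_scheme \<Rightarrow> 'b set \<Rightarrow> ('b \<Rightarrow> 'a) \<Rightarrow> bool" where
  "full_set_of_primitive_idempotents R B e \<longleftrightarrow>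
     (\<forall>b\<in>B. primitive_idempotent R (e b)) \<and>
     (\<forall>b\<in>B. \<forall>c\<in>B. b \<noteq> c \<longrightarrow> \<not> conjugate_idempotents R (e b) (e c)) \<and>
     (\<forall>f. primitive_idempotent R f \<longrightarrow> (\<exists>b\<in>B. conjugate_idempotents R f (e b)))"

definition primitive_decomposition ::
    "('a, 'm) ring_scheme \<Rightarrow> 'b set \<Rightarrow> ('b \<Rightarrow> 'a) \<Rightarrow> bool" where
  "primitive_decomposition R B e \<longleftrightarrow>
     finite B \<and> (\<forall>b\<in>B. primitive_idempotent R (e b)) \<and>
     (\<forall>b\<in>B. \<forall>c\<in>B. b \<noteq> c \<longrightarrow> e b \<otimes>\<^bsub>R\<^esub> e c = \<zero>\<^bsub>R\<^esub>) \<and>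
     \<one>\<^bsub>R\<^esub> = finsum R e B"

definition isomorphic_left_ideals :: "('a, 'm) ring_scheme \<Rightarrow> 'a \<Rightarrow> 'a \<Rightarrow> bool" where
  "isomorphic_left_ideals R e f \<longleftrightarrow>
     (let M = {x \<otimes>\<^bsub>R\<^esub> e | x. x \<in> carrier R}; N = {x \<otimes>\<^bsub>R\<^esub> f | x. x \<in> carrier R} in
       \<exists>\<phi>. bij_betw \<phi> M N \<and>
           (\<forall>x\<in>M. \<forall>y\<in>M. \<phi> (x \<oplus>\<^bsub>R\<^esub> y) = \<phi> x \<oplus>\<^bsub>R\<^esub> \<phi> y) \<and>
           (\<forall>r\<in>carrier R. \<forall>x\<in>M. \<phi> (r \<otimes>\<^bsub>R\<^esub> x) = r \<otimes>\<^bsub>R\<^esub> \<phi> x))"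

text \<open>
  A finite-dimensional algebra is basic if its regular module is a direct sum of pairwise
  non-isomorphic indecomposable projectives.
\<close>

definition basic_ring :: "('a, 'm) ring_scheme \<Rightarrow> bool" where
  "basic_ring R \<longleftrightarrow>
     (\<exists>E. primitive_decomposition R E (\<lambda>x. x) \<and>
          (\<forall>e\<in>E. \<forall>f\<in>E. e \<noteq> f \<longrightarrow> \<not> isomorphic_left_ideals R e f))"

section \<open>Based stratified algebras\<close>

definition ideal_generated ::
    "('k::field \<Rightarrow> 'a::ring \<Rightarrow> 'a) \<Rightarrow> 'a set \<Rightarrow> 'a set" where
  "ideal_generated s S =
     \<Inter>{J. S \<subseteq> J \<and> module.subspace s J \<and> (\<forall>x. \<forall>y\<in>J. x * y \<in> J \<and> y * x \<in> J)}"

definition fibre_idem :: "'b set \<Rightarrow> ('b \<Rightarrow> 'l) \<Rightarrow> ('b \<Rightarrow> 'a::ring) \<Rightarrow> 'l \<Rightarrow> 'a" where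
  "fibre_idem B \<rho> e l = (\<Sum>b | b \<in> B \<and> \<rho> b = l. e b)"

definition strat_ideal ::
    "('k::field \<Rightarrow> 'a::ring \<Rightarrow> 'a) \<Rightarrow> 'b set \<Rightarrow> ('b \<Rightarrow> 'a) \<Rightarrow> 'l set \<Rightarrow> ('l \<times> 'l) set \<Rightarrow>
     ('b \<Rightarrow> 'l) \<Rightarrow> 'l \<Rightarrow> 'a set" where
  "strat_ideal s B e \<Lambda> ord \<rho> l =
     ideal_generated s {fibre_idem B \<rho> e m | m. m \<in> \<Lambda> \<and> (m, l) \<notin> ord}"

definition strat_bar ::
    "('k::field \<Rightarrow> 'a::ring \<Rightarrow> 'a) \<Rightarrow> 'b set \<Rightarrow> ('b \<Rightarrow> 'a) \<Rightarrow> 'l set \<Rightarrow> ('l \<times> 'l) set \<Rightarrow>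
     ('b \<Rightarrow> 'l) \<Rightarrow> 'l \<Rightarrow> 'a \<Rightarrow> 'a set" where
  "strat_bar s B e \<Lambda> ord \<rho> l x =
     strat_ideal s B e \<Lambda> ord \<rho> l +>\<^bsub>subalgebra_ring UNIV\<^esub> x"

text \<open>The algebra \<open>A\<^sub>\<lambda>\<close>, a corner of the quotient \<open>A\<^bsub>\<le>\<lambda>\<^esub>\<close>.\<close>

definition strat_algebra ::
    "('k::field \<Rightarrow> 'a::ring \<Rightarrow> 'a) \<Rightarrow> 'b set \<Rightarrow> ('b \<Rightarrow> 'a) \<Rightarrow> 'l set \<Rightarrow> ('l \<times> 'l) set \<Rightarrow>
     ('b \<Rightarrow> 'l) \<Rightarrow> 'l \<Rightarrow> 'a set ring" where
  "strat_algebra s B e \<Lambda> ord \<rho> l =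
     corner_ring (subalgebra_ring UNIV Quot strat_ideal s B e \<Lambda> ord \<rho> l)
       (strat_bar s B e \<Lambda> ord \<rho> l (fibre_idem B \<rho> e l))"

text \<open>
  \<open>I\<close> and \<open>\<Lambda>\<close> are subsets of one type, so that their disjointness is expressible.
\<close>

locale based_stratified_algebra = locally_unital_algebra s I e
  for kind :: fin_kind
    and s :: "'k::field \<Rightarrow> 'a::ring \<Rightarrow> 'a" and I :: "'i set" and e :: "'i \<Rightarrow> 'a"
    and B :: "'i set" and \<Lambda> :: "'i set" and ord :: "('i \<times> 'i) set" and \<rho> :: "'i \<Rightarrow> 'i"
    and Y :: "'i \<Rightarrow> 'i \<Rightarrow> 'a set" and H :: "'i \<Rightarrow> 'i \<Rightarrow> 'a set" and X :: "'i \<Rightarrow> 'i \<Rightarrow> 'a set" +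
  assumes dim: "dim_condition kind s I e"
    and S1: "B \<subseteq> I"
    and S2: "partial_order_on \<Lambda> ord" "poset_condition kind \<Lambda> ord" "\<Lambda> \<inter> I = {}"
    and S3: "finite_fibres B \<Lambda> \<rho>"
    and S4: "\<And>i a. i \<in> I \<Longrightarrow> a \<in> B \<Longrightarrow> Y i a \<subseteq> peirce (e i) UNIV (e a)"
            "\<And>a b. a \<in> B \<Longrightarrow> b \<in> B \<Longrightarrow> H a b \<subseteq> peirce (e a) UNIV (e b)"
            "\<And>b j. b \<in> B \<Longrightarrow> j \<in> I \<Longrightarrow> X b j \<subseteq> peirce (e b) UNIV (e j)"
    and S5: "let T = (\<Union>a\<in>B. \<Union>b\<in>B. (\<Union>i\<in>I. Y i a) \<times> H a b \<times> (\<Union>j\<in>I. X b j));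
                 p = (\<lambda>(y, h, x). y * h * x)
             in inj_on p T \<and> is_basis s UNIV (p ` T)"
    and S6: "\<And>a b. a \<in> B \<Longrightarrow> b \<in> B \<Longrightarrow> a \<noteq> b \<Longrightarrow> \<rho> a \<noteq> \<rho> b \<Longrightarrow> H a b = {}"
            "\<And>a b. a \<in> B \<Longrightarrow> b \<in> B \<Longrightarrow> a \<noteq> b \<Longrightarrow> \<not> ((\<rho> b, \<rho> a) \<in> ord \<and> \<rho> b \<noteq> \<rho> a) \<Longrightarrow>
               Y b a = {} \<and> X a b = {}"
            "\<And>a. a \<in> B \<Longrightarrow> Y a a = {e a} \<and> X a a = {e a}"
    and S7: "\<And>l. l \<in> \<Lambda> \<Longrightarrow>
               basic_ring (strat_algebra s B e \<Lambda> ord \<rho> l) \<and>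
               primitive_decomposition (strat_algebra s B e \<Lambda> ord \<rho> l)
                 {b \<in> B. \<rho> b = l} (\<lambda>b. strat_bar s B e \<Lambda> ord \<rho> l (e b))"

section \<open>The generating sets extracted from a triangular decomposition\<close>

definition admissible_generators ::
    "'a::ring set \<Rightarrow> 'a set \<Rightarrow> 'j set \<Rightarrow> ('j \<Rightarrow> 'a) \<Rightarrow> 'j set \<Rightarrow>
     ('j \<Rightarrow> 'j \<Rightarrow> 'a set) \<Rightarrow> ('j \<Rightarrow> 'j \<Rightarrow> 'a set) \<Rightarrow> bool" where
  "admissible_generators Aflat Asharp J e B Y X \<longleftrightarrow>
     (let C = Aflat \<inter> Asharp in
      (\<forall>i\<in>J. \<forall>a\<in>B. Y i a \<subseteq> peirce (e i) Aflat (e a)) \<and>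
      (\<forall>b\<in>B. \<forall>j\<in>J. X b j \<subseteq> peirce (e b) Asharp (e j)) \<and>
      (\<forall>i\<in>J. is_direct_sum (lmul (e i) Aflat) (SIGMA a:B. Y i a) (\<lambda>(a, y). lmul y C) \<and>
             (\<forall>a\<in>B. \<forall>y\<in>Y i a. module_isomorphic C opp (lmul y C) opp (lmul (e a) C))) \<and>
      (\<forall>j\<in>J. is_direct_sum (rmul Asharp (e j)) (SIGMA b:B. X b j) (\<lambda>(b, x). rmul C x) \<and>
             (\<forall>b\<in>B. \<forall>x\<in>X b j. module_isomorphic C (*) (rmul C x) (*) (rmul C (e b)))) \<and>
      (\<forall>b\<in>B. Y b b = {e b} \<and> X b b = {e b}))"

end

theory Submission
  imports Defs
begin

text \<open>
  The Cartan subalgebra \<open>A\<^sup>\<circ>\<close> is a direct sum of finite-dimensional unital algebras, one block for each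
  weight \<open>l \<in> \<Lambda>\<close>: by triangularity \<open>e\<^sub>i A\<^sup>\<circ> e\<^sub>j\<close> vanishes unless \<open>\<delta> i = \<delta> j\<close>. The proof consists of an
  analysis of projective modules over such an algebra, followed by two applications of the isomorphism
  \<open>A\<^sup>\<flat> \<otimes> A\<^sup>\<sharp> \<cong> A\<close> over \<open>A\<^sup>\<circ>\<close>. Passing to finer idempotents preserves the axioms of a triangular
  decomposition (\<open>triangular_decomposition_refine\<close>), so that afterwards one system of idempotents is in use.

  Freeness. The modules \<open>e\<^sub>i A\<^sup>\<flat>\<close> and \<open>A\<^sup>\<sharp> e\<^sub>j\<close> are finite-dimensional, because only finitely many
  weights occur in them or because \<open>e\<^sub>i A\<close> and \<open>A e\<^sub>j\<close> are. Being projective, they have a finite dual basis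
  with respect to generators in \<open>e\<^sub>b V\<close>, where \<open>b\<close> runs through \<open>\<^bold>B\<close>. The corners \<open>e\<^sub>b A\<^sup>\<circ> e\<^sub>b\<close> are
  local rings (\<open>primitive_corner_local\<close>), and an elimination in the manner of Gauss turns the dual basis into
  an orthonormal one, that is, exhibits \<open>V\<close> as a direct sum of copies of the \<open>A\<^sup>\<circ> e\<^sub>b\<close>
  (\<open>orthonormal_dual_basis_exists\<close>). This avoids the theorem of Krull and Schmidt. For \<open>b \<in> \<^bold>B\<close> the part of
  \<open>e\<^sub>b A\<^sup>\<flat>\<close> of the weight of \<open>b\<close> is \<open>e\<^sub>b A\<^sup>\<circ>\<close>; splitting it off first gives \<open>Y(b,b) = {e\<^sub>b}\<close>.

  The basis. Admissible generators have coordinate functions \<open>\<psi>\<^sub>y\<close> and \<open>\<chi>\<^sub>x\<close> on \<open>A\<^sup>\<flat>\<close> and \<open>A\<^sup>\<sharp>\<close> with values in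
  \<open>A\<^sup>\<circ>\<close>. The map \<open>(u, v) \<mapsto> \<psi>\<^sub>y(u) \<chi>\<^sub>x(v)\<close> is balanced over \<open>A\<^sup>\<circ>\<close> and so extends to a linear map on \<open>A\<close>,
  which sends \<open>y h x\<close> to \<open>h\<close> and all products with other outer factors to \<open>0\<close> (\<open>middle_coordinate\<close>). Hence
  the products \<open>y h x\<close> are linearly independent; they span because \<open>A = A\<^sup>\<flat> A\<^sup>\<sharp>\<close>.

  The strata. Let \<open>f\<^sub>l\<close> be the sum of the \<open>e\<^sub>b\<close> of weight \<open>l\<close>. Then \<open>A\<^sub>l\<close> is isomorphic to \<open>f\<^sub>l A\<^sup>\<circ> f\<^sub>l\<close>, which is
  basic with primitive idempotents \<open>e\<^sub>b\<close> by the choice of \<open>\<^bold>B\<close>. Surjectivity of \<open>f\<^sub>l A\<^sup>\<circ> f\<^sub>l \<rightarrow> A\<^sub>l\<close> is triangularity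
  (\<open>corner_covers\<close>). For injectivity, the balanced map \<open>(u, v) \<mapsto> (\<epsilon>\<^sub>l u \<epsilon>\<^sub>l) (\<epsilon>\<^sub>l v \<epsilon>\<^sub>l)\<close>, with \<open>\<epsilon>\<^sub>l\<close> the
  identity of the block of weight \<open>l\<close>, induces a linear map on \<open>A\<close> that is the identity on \<open>f\<^sub>l A\<^sup>\<circ> f\<^sub>l\<close> and
  kills the ideal defining \<open>A\<^bsub>\<le>l\<^esub>\<close> (\<open>corner_meets_J\<close>).
\<close>

section \<open>Orthogonal idempotents and local units\<close>

locale orthogonal_idempotents =
  fixes I :: "'i set" and e :: "'i \<Rightarrow> 'a::ring"
  assumes idem: "i \<in> I \<Longrightarrow> e i * e i = e i"
    and orth: "i \<in> I \<Longrightarrow> j \<in> I \<Longrightarrow> i \<noteq> j \<Longrightarrow> e i * e j = 0"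
begin

lemma mult_sum_left:
  assumes "finite F" "F \<subseteq> I" "i \<in> I"
  shows "(\<Sum>j\<in>F. e j) * e i = (if i \<in> F then e i else 0)"
proof -
  have "(\<Sum>j\<in>F. e j) * e i = (\<Sum>j\<in>F. if j = i then e i else 0)"
    unfolding sum_distrib_right
    using assms by (intro sum.cong refl) (auto simp: idem orth)
  then show ?thesis using assms by simp
qed

lemma mult_sum_right:
  assumes "finite F" "F \<subseteq> I" "i \<in> I"
  shows "e i * (\<Sum>j\<in>F. e j) = (if i \<in> F then e i else 0)"
proof -
  have "e i * (\<Sum>j\<in>F. e j) = (\<Sum>j\<in>F. if j = i then e i else 0)"
    unfolding sum_distrib_left
    using assms by (intro sum.cong refl) (auto simp: idem orth)
  then show ?thesis using assms by simp
qed

lemma mult_sum_sum: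
  assumes "finite F" "F \<subseteq> I" "finite G" "G \<subseteq> F"
  shows "(\<Sum>j\<in>F. e j) * (\<Sum>j\<in>G. e j) = (\<Sum>j\<in>G. e j)"
    and "(\<Sum>j\<in>G. e j) * (\<Sum>j\<in>F. e j) = (\<Sum>j\<in>G. e j)"
proof -
  have *: "i \<in> I" "i \<in> F" if "i \<in> G" for i using that assms by auto
  show "(\<Sum>j\<in>F. e j) * (\<Sum>j\<in>G. e j) = (\<Sum>j\<in>G. e j)"
    unfolding sum_distrib_left[of "sum e F"]
    by (rule sum.cong) (use assms * in \<open>simp_all add: mult_sum_left\<close>)
  show "(\<Sum>j\<in>G. e j) * (\<Sum>j\<in>F. e j) = (\<Sum>j\<in>G. e j)"
    unfolding sum_distrib_right[of e]
    by (rule sum.cong) (use assms * in \<open>simp_all add: mult_sum_right\<close>)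
qed

lemma local_unit_mono:
  assumes "finite F" "F \<subseteq> I" "G \<subseteq> F"
  shows "(\<Sum>j\<in>G. e j) * x = x \<Longrightarrow> (\<Sum>j\<in>F. e j) * x = x"
    and "x * (\<Sum>j\<in>G. e j) = x \<Longrightarrow> x * (\<Sum>j\<in>F. e j) = x"
  using mult_sum_sum[OF assms(1,2) finite_subset[OF assms(3,1)] assms(3)]
  by (metis mult.assoc)+

text \<open>Local units suffice for the Peirce decomposition of the whole ring.\<close>

lemma idem_decompI:
  assumes units: "\<And>x. \<exists>F. finite F \<and> F \<subseteq> I \<and> (\<Sum>i\<in>F. e i) * x = x \<and> x * (\<Sum>i\<in>F. e i) = x"
  shows "idem_decomp UNIV I e"
proof -
  let ?P = "{f. (\<forall>t\<in>I \<times> I. f t \<in> (case t of (i, j) \<Rightarrow> peirce (e i) UNIV (e j))) \<and>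
                (\<forall>t. t \<notin> I \<times> I \<longrightarrow> f t = 0) \<and> finite {t. f t \<noteq> 0}}"
  let ?S = "\<lambda>f::'i \<times> 'i \<Rightarrow> 'a. \<Sum>t | f t \<noteq> 0. f t"
  have comp: "e i * ?S f * e j = f (i, j)" if f: "f \<in> ?P" and ij: "i \<in> I" "j \<in> I" for f i j
  proof -
    have fin: "finite {t. f t \<noteq> 0}" using f by auto
    have val: "e i * f t * e j = (if t = (i, j) then f t else 0)" if "f t \<noteq> 0" for t
    proof -
      have t: "t \<in> I \<times> I" using f that by blast
      then obtain k l where kl: "t = (k, l)" "k \<in> I" "l \<in> I" by auto
      then obtain y where y: "f t = e k * y * e l" using f by (fastforce simp: peirce_def)
      have "e i * f t * e j = (e i * e k) * y * (e l * e j)" by (simp add: y mult.assoc)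
      then show ?thesis using kl ij y by (auto simp: idem orth)
    qed
    have "e i * ?S f * e j = (\<Sum>t | f t \<noteq> 0. if t = (i, j) then f t else 0)"
      unfolding sum_distrib_left sum_distrib_right by (rule sum.cong) (auto simp: val)
    then show ?thesis using fin by simp
  qed
  have "inj_on ?S ?P"
  proof (rule inj_onI)
    fix f g assume f: "f \<in> ?P" and g: "g \<in> ?P" and eq: "?S f = ?S g"
    show "f = g"
    proof
      fix t
      show "f t = g t"
      proof (cases "t \<in> I \<times> I")
        case True
        then obtain i j where t: "t = (i, j)" "i \<in> I" "j \<in> I" by auto
        have "f t = e i * ?S f * e j" using comp[OF f t(2,3)] t(1) by simp
        also have "\<dots> = e i * ?S g * e j" by (simp only: eq)
        also have "\<dots> = g t" using comp[OF g t(2,3)] t(1) by simp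
        finally show ?thesis .
      next
        case False
        then have "f t = 0" "g t = 0" using f g by blast+
        then show ?thesis by simp
      qed
    qed
  qed
  moreover have "x \<in> ?S ` ?P" for x
  proof -
    obtain F where F: "finite F" "F \<subseteq> I" "(\<Sum>i\<in>F. e i) * x = x" "x * (\<Sum>i\<in>F. e i) = x"
      using units by blast
    define f where "f = (\<lambda>(i, j). if i \<in> I \<and> j \<in> I then e i * x * e j else 0)"
    have l: "e i * x = 0" if "i \<in> I" "i \<notin> F" for i
      using mult_sum_right[OF F(1,2) that(1)] that F(3) by (metis mult.assoc mult_zero_left)
    have r: "x * e i = 0" if "i \<in> I" "i \<notin> F" for i
      using mult_sum_left[OF F(1,2) that(1)] that F(4) by (metis mult.assoc mult_zero_right)
    have supp: "{t. f t \<noteq> 0} \<subseteq> F \<times> F"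
    proof
      fix t assume "t \<in> {t. f t \<noteq> 0}"
      then obtain i j where t: "t = (i, j)" "i \<in> I" "j \<in> I" "e i * x * e j \<noteq> 0"
        by (cases t) (auto simp: f_def split: if_splits)
      have "i \<in> F" using l[of i] t by force
      moreover have "j \<in> F" using r[of j] t by (force simp: mult.assoc)
      ultimately show "t \<in> F \<times> F" using t by simp
    qed
    have fin: "finite {t. f t \<noteq> 0}" using supp F(1) by (meson finite_SigmaI finite_subset)
    have "?S f = (\<Sum>t\<in>F \<times> F. f t)"
      using supp F(1) by (intro sum.mono_neutral_left) auto
    also have "\<dots> = (\<Sum>i\<in>F. \<Sum>j\<in>F. e i * x * e j)"
      unfolding sum.cartesian_product using F(2) by (intro sum.cong) (auto simp: f_def)
    also have "\<dots> = (\<Sum>i\<in>F. e i) * x * (\<Sum>i\<in>F. e i)"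
      by (simp add: sum_distrib_left sum_distrib_right) (rule sum.swap)
    also have "\<dots> = x" using F by simp
    finally have "?S f = x" .
    moreover have "f \<in> ?P"
      using fin by (auto simp: f_def peirce_def)
    ultimately show ?thesis by (metis (no_types, lifting) imageI)
  qed
  ultimately have "bij_betw ?S ?P UNIV" by (auto simp: bij_betw_def)
  then show ?thesis by (simp add: idem_decomp_def is_direct_sum_def idem orth)
qed

end

lemma idem_decomp_orthogonal_idempotents:
  "idem_decomp D I e \<Longrightarrow> orthogonal_idempotents I e"
  by (auto simp: idem_decomp_def orthogonal_idempotents_def)

lemma idem_decomp_local_unit:
  assumes dec: "idem_decomp UNIV I e" and S: "finite S"
  obtains F where "finite F" "F \<subseteq> I"
    "\<And>x. x \<in> S \<Longrightarrow> (\<Sum>i\<in>F. e i) * x = x" "\<And>x. x \<in> S \<Longrightarrow> x * (\<Sum>i\<in>F. e i) = x"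
proof -
  interpret orthogonal_idempotents I e by (rule idem_decomp_orthogonal_idempotents[OF dec])
  have one: "\<exists>F. finite F \<and> F \<subseteq> I \<and> (\<Sum>i\<in>F. e i) * x = x \<and> x * (\<Sum>i\<in>F. e i) = x" for x
  proof -
    have "x \<in> (\<lambda>f. \<Sum>t | f t \<noteq> 0. f t) `
       {f. (\<forall>t\<in>I \<times> I. f t \<in> (case t of (i, j) \<Rightarrow> peirce (e i) UNIV (e j))) \<and>
                (\<forall>t. t \<notin> I \<times> I \<longrightarrow> f t = 0) \<and> finite {t. f t \<noteq> 0}}"
      using dec by (auto simp: idem_decomp_def is_direct_sum_def bij_betw_def)
    then obtain f where x: "x = (\<Sum>t | f t \<noteq> 0. f t)"
      and f: "\<forall>t\<in>I \<times> I. f t \<in> (case t of (i, j) \<Rightarrow> peirce (e i) UNIV (e j))"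
        "\<forall>t. t \<notin> I \<times> I \<longrightarrow> f t = 0" "finite {t. f t \<noteq> 0}"
      by auto
    define F where "F = fst ` {t. f t \<noteq> 0} \<union> snd ` {t. f t \<noteq> 0}"
    have "{t. f t \<noteq> 0} \<subseteq> I \<times> I" using f(2) by blast
    then have F: "finite F" "F \<subseteq> I" using f(3) by (auto simp: F_def)
    have "(\<Sum>i\<in>F. e i) * f t = f t \<and> f t * (\<Sum>i\<in>F. e i) = f t" if ft: "f t \<noteq> 0" for t
    proof -
      have t: "t \<in> I \<times> I" using f ft by blast
      then obtain k l where kl: "t = (k, l)" "k \<in> I" "l \<in> I" by auto
      then obtain y where y: "f t = e k * y * e l" using f by (fastforce simp: peirce_def)
      have "k \<in> F" "l \<in> F" using kl ft by (force simp: F_def)+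
      then show ?thesis
        using mult_sum_left[OF F kl(2)] mult_sum_right[OF F kl(3)] by (metis y mult.assoc)
    qed
    then have "(\<Sum>i\<in>F. e i) * x = x" "x * (\<Sum>i\<in>F. e i) = x"
      unfolding x sum_distrib_left[of "sum e F"] sum_distrib_right[of f]
      by (auto intro: sum.cong)
    then show ?thesis using F by blast
  qed
  then obtain F where F: "\<And>x. finite (F x) \<and> F x \<subseteq> I \<and> (\<Sum>i\<in>F x. e i) * x = x \<and>
      x * (\<Sum>i\<in>F x. e i) = x"
    by metis
  have U: "finite (\<Union>x\<in>S. F x)" "(\<Union>x\<in>S. F x) \<subseteq> I" using F S by auto
  show thesis
  proof (rule that[OF U])
    fix x assume "x \<in> S"
    then have "F x \<subseteq> (\<Union>x\<in>S. F x)" by auto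
    from local_unit_mono[OF U this] F
    show "(\<Sum>i\<in>(\<Union>x\<in>S. F x). e i) * x = x" "x * (\<Sum>i\<in>(\<Union>x\<in>S. F x). e i) = x" by auto
  qed
qed

section \<open>Primitive idempotents\<close>

lemma primitive_idempotent_subalgebra_iff:
  "primitive_idempotent (subalgebra_ring C) f \<longleftrightarrow>
     f \<in> C \<and> f * f = f \<and> f \<noteq> 0 \<and>
     (\<forall>g\<in>C. \<forall>h\<in>C. g * g = g \<longrightarrow> h * h = h \<longrightarrow> g * h = 0 \<longrightarrow> h * g = 0 \<longrightarrow> f = g + h \<longrightarrow>
        g = 0 \<or> h = 0)"
  by (auto simp: primitive_idempotent_def idempotent_def subalgebra_ring_def)

lemma conjugate_idempotents_subalgebra_iff:
  "conjugate_idempotents (subalgebra_ring C) f f' \<longleftrightarrow>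
     (\<exists>g u v. g \<in> C \<and> g * g = g \<and> {f, f', u, v} \<subseteq> {g * x * g | x. x \<in> C} \<and>
        u * v = g \<and> v * u = g \<and> u * f * v = f')"
  by (simp add: conjugate_idempotents_def subalgebra_ring_def corner_ring_def idempotent_def)

context k_algebra
begin

lemma scale_mult: "s c x * y = s c (x * y)" "x * s c y = s c (x * y)"
  by (simp_all add: scale_mult_left scale_mult_right[symmetric])

lemma primitive_idempotent_trivial:
  assumes prim: "primitive_idempotent (subalgebra_ring C) f" and C: "subspace C"
    and g: "g \<in> C" "g * g = g" "f * g = g" "g * f = g"
  shows "g = 0 \<or> g = f"
proof -
  have "f - g \<in> C" "f * f = f"
    using prim g C by (auto simp: primitive_idempotent_subalgebra_iff intro: subspace_diff)
  moreover have "(f - g) * (f - g) = f - g" "g * (f - g) = 0" "(f - g) * g = 0" "f = g + (f - g)"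
    using g \<open>f * f = f\<close> by (simp_all add: algebra_simps)
  ultimately show ?thesis
    using prim g(1,2) unfolding primitive_idempotent_subalgebra_iff by (metis eq_iff_diff_eq_0)
qed

lemma span_mult_left: "x \<in> span S \<Longrightarrow> a * x \<in> span ((*) a ` S)"
proof (induction rule: span_induct_alt)
  case (step c x y)
  then show ?case by (auto simp: distrib_left scale_mult intro!: span_add span_scale intro: span_base)
qed (simp add: span_zero)

lemma span_mult_right: "x \<in> span S \<Longrightarrow> x * a \<in> span ((\<lambda>y. y * a) ` S)"
proof (induction rule: span_induct_alt)
  case (step c x y)
  then show ?case by (auto simp: distrib_right scale_mult intro!: span_add span_scale intro: span_base)
qed (simp add: span_zero)

lemma fin_dim_mono: "fin_dim s W \<Longrightarrow> V \<subseteq> W \<Longrightarrow> fin_dim s V"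
  unfolding fin_dim_def by blast

text \<open>
  Fitting's lemma in the form needed here: in a finite-dimensional corner \<open>f C f\<close> some power \<open>c\<^sup>n\<close>
  satisfies \<open>c\<^sup>n = c\<^sup>2\<^sup>n w\<close> with \<open>w\<close> in the span of the positive powers of \<open>c\<close>, so that \<open>c\<^sup>n w\<close> is
  idempotent. If \<open>f\<close> is primitive, then this idempotent is \<open>f\<close> and \<open>c\<close> is invertible, or it is \<open>0\<close>
  and \<open>c\<close> is nilpotent, so that \<open>f - c\<close> is invertible.
\<close>

lemma primitive_corner_local:
  assumes C: "subspace C" "\<And>x y. x \<in> C \<Longrightarrow> y \<in> C \<Longrightarrow> x * y \<in> C"
    and prim: "primitive_idempotent (subalgebra_ring C) f"
    and fd: "fin_dim s (peirce f C f)"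
    and c: "c \<in> C" "f * c = c" "c * f = c"
  shows "\<exists>r\<in>C. f * r = r \<and> r * f = r \<and> (c * r = f \<and> r * c = f \<or> (f - c) * r = f \<and> r * (f - c) = f)"
proof -
  have f: "f \<in> C" "f * f = f" using prim by (auto simp: primitive_idempotent_subalgebra_iff)
  define pw where "pw n = ((*) c ^^ n) f" for n
  have pw0: "pw 0 = f" and pwS: "pw (Suc n) = c * pw n" for n by (simp_all add: pw_def)
  have pwC: "pw n \<in> C" "f * pw n = pw n" "pw n * f = pw n" for n
    by (induction n) (use f c C(2) in \<open>simp_all add: pw0 pwS mult.assoc flip: mult.assoc[of f]\<close>)
  have pw_add: "pw m * pw n = pw (m + n)" for m n
    by (induction m) (simp_all add: pw0 pwS pwC mult.assoc)
  have pw1: "pw 1 = c" using c by (simp add: pw0 pwS)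
  have pwS': "pw (Suc n) = pw n * c" for n using pw_add[of n 1] pw1 by simp
  obtain n where n: "pw n \<in> span (pw ` {n<..})"
  proof (rule ccontr)
    assume no: "\<not> thesis"
    then have ni: "pw n \<notin> span (pw ` {n<..})" for n using that by blast
    have indep: "independent (pw ` {n..<n + d}) \<and> card (pw ` {n..<n + d}) = d" for n d
    proof (induction d arbitrary: n)
      case 0
      show ?case by (simp add: independent_empty)
    next
      case (Suc d)
      have set: "{n..<n + Suc d} = insert n {Suc n..<Suc n + d}" by auto
      have "pw ` {Suc n..<Suc n + d} \<subseteq> pw ` {n<..}" by auto
      then have nin: "pw n \<notin> span (pw ` {Suc n..<Suc n + d})"
        using ni[of n] span_mono by blast
      then have "pw n \<notin> pw ` {Suc n..<Suc n + d}" using span_base by blast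
      then show ?case
        unfolding set image_insert using Suc[of "Suc n"] nin
        by (simp add: independent_insertI)
    qed
    obtain S where S: "finite S" "peirce f C f \<subseteq> span S" using fd by (auto simp: fin_dim_def)
    have "pw ` {0..<0 + Suc (card S)} \<subseteq> span S"
      using S(2) pwC by (force simp: peirce_def)
    from independent_span_bound[OF S(1) conjunct1[OF indep] this] indep[of 0 "Suc (card S)"]
    show False by simp
  qed
  have n': "pw m \<in> span (pw ` {m<..})" if "n \<le> m" for m
  proof -
    have "pw (m - n) * pw n \<in> span ((*) (pw (m - n)) ` pw ` {n<..})"
      by (rule span_mult_left[OF n])
    moreover have "(*) (pw (m - n)) ` pw ` {n<..} \<subseteq> pw ` {m<..}"
      using that by (auto simp: pw_add)
    ultimately show ?thesis using span_mono that by (metis (no_types) pw_add le_add_diff_inverse2 subsetD)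
  qed
  have deep: "pw n \<in> span (pw ` {n + k<..})" for k
  proof (induction k)
    case (Suc k)
    have "pw m \<in> span (pw ` {n + Suc k<..})" if "n + k < m" for m
    proof (cases "m = n + Suc k")
      case True
      then show ?thesis using n'[of "n + Suc k"] by simp
    next
      case False
      then show ?thesis using that by (intro span_base) auto
    qed
    then have "span (pw ` {n + k<..}) \<subseteq> span (pw ` {n + Suc k<..})"
      by (intro span_minimal) (auto simp: subspace_span)
    then show ?case using Suc by blast
  qed (use n in simp)
  define R where "R = {r \<in> C. f * r = r \<and> r * f = r \<and> r * c = c * r \<and> (\<forall>m. pw m * r = r * pw m)}"
  have "subspace {pw n * pw n * (c * r) | r. r \<in> R}"
    unfolding subspace_def
  proof safe
    show "\<exists>r. 0 = pw n * pw n * (c * r) \<and> r \<in> R"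
      using subspace_0[OF C(1)] by (intro exI[of _ 0]) (auto simp: R_def)
  next
    fix r r' assume "r \<in> R" "r' \<in> R"
    then show "\<exists>t. pw n * pw n * (c * r) + pw n * pw n * (c * r') = pw n * pw n * (c * t) \<and> t \<in> R"
      using subspace_add[OF C(1)]
      by (intro exI[of _ "r + r'"]) (auto simp: R_def distrib_left distrib_right)
  next
    fix a r assume "r \<in> R"
    then show "\<exists>t. s a (pw n * pw n * (c * r)) = pw n * pw n * (c * t) \<and> t \<in> R"
      using subspace_scale[OF C(1)]
      by (intro exI[of _ "s a r"]) (auto simp: R_def scale_mult)
  qed
  moreover have "pw ` {n + n<..} \<subseteq> {pw n * pw n * (c * r) | r. r \<in> R}"
  proof safe
    fix m assume "n + n < m"
    then obtain k where "m = n + n + Suc k" using less_imp_Suc_add by auto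
    then have "pw m = pw n * pw n * (c * pw k)" by (simp only: pw_add flip: pwS)
    moreover have "pw k \<in> R"
      by (simp add: R_def pwC pw_add add.commute flip: pwS pwS')
    ultimately show "\<exists>r. pw m = pw n * pw n * (c * r) \<and> r \<in> R" by blast
  qed
  ultimately have "span (pw ` {n + n<..}) \<subseteq> {pw n * pw n * (c * r) | r. r \<in> R}"
    by (rule span_minimal[rotated])
  then obtain r where r: "r \<in> R" "pw n = pw n * pw n * (c * r)" using deep[of n] by blast
  define w where "w = c * r"
  have rC: "r \<in> C" "f * r = r" "r * f = r" "r * c = c * r" "\<And>m. pw m * r = r * pw m"
    using r(1) by (auto simp: R_def)
  have comm: "pw n * w = w * pw n"
    unfolding w_def by (metis mult.assoc pwS pwS' rC(5))
  have pp: "pw n * (pw n * w) = pw n" using r(2) by (simp add: w_def mult.assoc)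
  define g where "g = pw n * w"
  have "g * g = (pw n * (pw n * w)) * w" unfolding g_def by (metis comm mult.assoc)
  then have gg: "g * g = g" by (simp add: pp g_def)
  have gC: "g \<in> C" "f * g = g" "g * f = g"
    unfolding g_def w_def using C(2) c rC pwC by (auto simp: mult.assoc) (metis mult.assoc pwC(2))
  from primitive_idempotent_trivial[OF prim C(1) gC(1) gg gC(2,3)]
  show ?thesis
  proof
    assume "g = f"
    then have u: "c * (pw n * r) = f" "pw n * r * c = f"
      unfolding g_def w_def by (metis mult.assoc pwS pwS' rC(4,5))+
    have "pw n * r \<in> C" "f * (pw n * r) = pw n * r" "(pw n * r) * f = pw n * r"
      using C(2) pwC rC by (simp_all add: mult.assoc flip: mult.assoc[of f])
    then show ?thesis using u by blast
  next
    assume "g = 0"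
    then have pn: "pw n = 0" using pp by (simp add: g_def)
    define r where "r = (\<Sum>m<n. pw m)"
    have "r \<in> C" unfolding r_def using pwC by (intro subspace_sum[OF C(1)]) auto
    have fr: "f * r = r" "r * f = r"
      by (simp_all add: r_def sum_distrib_left sum_distrib_right pwC)
    have "c * r = (\<Sum>m<n. pw (Suc m))" by (simp add: r_def sum_distrib_left pwS)
    moreover have "r * c = (\<Sum>m<n. pw (Suc m))"
      unfolding r_def sum_distrib_right by (simp only: pwS')
    ultimately have "r - c * r = f" "r - r * c = f"
      using sum_lessThan_telescope'[of pw n] pn by (simp_all add: r_def pw0 sum_subtractf)
    then have "(f - c) * r = f" "r * (f - c) = f"
      by (simp_all add: left_diff_distrib right_diff_distrib fr)
    then show ?thesis using \<open>r \<in> C\<close> fr by blast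
  qed
qed

text \<open>
  Orthogonal nonzero idempotents are linearly independent, so a finite-dimensional corner bounds
  their number; a decomposition with the largest number of summands consists of primitive ones.
\<close>

lemma sum_of_primitive_idempotents:
  assumes C: "subspace C" "\<And>x y. x \<in> C \<Longrightarrow> y \<in> C \<Longrightarrow> x * y \<in> C"
    and g: "g \<in> C" "g * g = g" and fd: "fin_dim s (peirce g C g)"
  obtains F where "finite F" "g = \<Sum>F"
    "\<And>f. f \<in> F \<Longrightarrow> primitive_idempotent (subalgebra_ring C) f"
    "\<And>f. f \<in> F \<Longrightarrow> g * f = f" "\<And>f. f \<in> F \<Longrightarrow> f * g = f"
proof -
  define Q where "Q F \<longleftrightarrow> finite F \<and> F \<subseteq> C \<and> (\<forall>f\<in>F. f * f = f \<and> f \<noteq> 0) \<and>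
    (\<forall>f\<in>F. \<forall>h\<in>F. f \<noteq> h \<longrightarrow> f * h = 0) \<and> g = \<Sum>F" for F
  have unit: "g * f = f" "f * g = f" if "Q F" "f \<in> F" for F f
  proof -
    interpret orthogonal_idempotents F "\<lambda>x. x" using that by unfold_locales (auto simp: Q_def)
    show "g * f = f" "f * g = f"
      using mult_sum_left[of F f] mult_sum_right[of F f] that by (auto simp: Q_def)
  qed
  obtain S where S: "finite S" "peirce g C g \<subseteq> span S" using fd by (auto simp: fin_dim_def)
  have bound: "card F \<le> card S" if "Q F" for F
  proof -
    have F: "finite F" "\<And>f. f \<in> F \<Longrightarrow> f * f = f \<and> f \<noteq> 0"
      "\<And>f h. f \<in> F \<Longrightarrow> h \<in> F \<Longrightarrow> f \<noteq> h \<Longrightarrow> f * h = 0"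
      using that by (auto simp: Q_def)
    have "independent F"
      unfolding independent_explicit_finite_subsets
    proof (intro allI impI ballI)
      fix T u f assume T: "T \<subseteq> F" "finite T" "(\<Sum>v\<in>T. s (u v) v) = 0" and f: "f \<in> T"
      have "f * (\<Sum>v\<in>T. s (u v) v) = (\<Sum>v\<in>T. if v = f then s (u f) f else 0)"
        unfolding sum_distrib_left
        using T(1) f F(2,3) by (intro sum.cong) (auto simp: scale_mult subset_iff)
      then have "s (u f) f = 0" using T f by simp
      moreover have "f \<noteq> 0" using F(2) T f by auto
      ultimately show "u f = 0" by simp
    qed
    moreover have "F \<subseteq> span S"
    proof
      fix f assume f: "f \<in> F"
      then have "f = g * f * g" using unit[OF that f] by (simp add: mult.assoc)
      then show "f \<in> span S" using S(2) f that by (auto simp: peirce_def Q_def)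
    qed
    ultimately show ?thesis using independent_span_bound[OF S(1)] by blast
  qed
  have "\<exists>F. Q F"
  proof (cases "g = 0")
    case True
    then show ?thesis by (intro exI[of _ "{}"]) (simp add: Q_def)
  next
    case False
    then show ?thesis using g by (intro exI[of _ "{g}"]) (simp add: Q_def)
  qed
  then obtain F where F: "Q F" and max: "\<And>G. Q G \<Longrightarrow> card G \<le> card F"
    using ex_has_greatest_nat[of Q _ card "Suc (card S)"] bound by (metis le_imp_less_Suc)
  have F': "finite F" "F \<subseteq> C" "g = \<Sum>F" "\<And>f. f \<in> F \<Longrightarrow> f * f = f \<and> f \<noteq> 0"
      "\<And>f h. f \<in> F \<Longrightarrow> h \<in> F \<Longrightarrow> f \<noteq> h \<Longrightarrow> f * h = 0"
    using F by (auto simp: Q_def)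
  have "primitive_idempotent (subalgebra_ring C) f" if f: "f \<in> F" for f
    unfolding primitive_idempotent_subalgebra_iff
  proof (intro conjI ballI impI)
    show "f \<in> C" "f * f = f" "f \<noteq> 0" using F' f by auto
    fix u v assume uv: "u \<in> C" "v \<in> C" "u * u = u" "v * v = v" "u * v = 0" "v * u = 0" "f = u + v"
    show "u = 0 \<or> v = 0"
    proof (rule ccontr)
      assume "\<not> ?thesis"
      then have nz: "u \<noteq> 0" "v \<noteq> 0" by auto
      have fu: "f * u = u" "u * f = u" "f * v = v" "v * f = v"
        using uv by (simp_all add: distrib_left distrib_right)
      have o: "u * h = 0" "h * u = 0" "v * h = 0" "h * v = 0" if "h \<in> F - {f}" for h
        using F'(5)[of f h] F'(5)[of h f] f that fu
        by (metis DiffE insertI1 mult.assoc mult_zero_left mult_zero_right)+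
      let ?G = "insert u (insert v (F - {f}))"
      have nin: "u \<notin> F - {f}" "v \<notin> F - {f}" using o nz uv by metis+
      have "u \<noteq> v" using uv nz by metis
      then have "card ?G = Suc (Suc (card (F - {f})))" "\<Sum>?G = f + \<Sum>(F - {f})"
        using nin F'(1) uv(7) by (simp_all add: add.assoc)
      then have "card ?G = Suc (card F)" "\<Sum>?G = g"
        using F'(3) card.remove[OF F'(1) f] sum.remove[OF F'(1) f, of "\<lambda>x. x"] by (simp_all only:)
      moreover have "Q ?G"
        unfolding Q_def using F' uv nz o \<open>\<Sum>?G = g\<close> by auto
      ultimately show False using max[of ?G] by simp
    qed
  qed
  then show thesis using that[OF F'(1,3)] unit[OF F] by blast
qed

end

section \<open>Dual bases over a ring with local idempotents\<close>

text \<open>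
  Left and right modules are treated together: a right module is a left module for the opposite
  multiplication. So \<open>mul\<close> below is either \<open>(*)\<close> or \<^term>\<open>opp\<close>, and modules are subsets \<open>V\<close> of the
  ambient ring on which the subring \<open>C\<close> acts by \<open>mul\<close>.
\<close>

locale subring_mult =
  fixes mul :: "'a::ring \<Rightarrow> 'a \<Rightarrow> 'a" (infixl \<open>\<cdot>\<close> 70) and C :: "'a set"
  assumes mul_assoc: "(x \<cdot> y) \<cdot> z = x \<cdot> (y \<cdot> z)"
    and mul_add_left: "(x + y) \<cdot> z = x \<cdot> z + y \<cdot> z"
    and mul_add_right: "z \<cdot> (x + y) = z \<cdot> x + z \<cdot> y"
    and C_zero: "0 \<in> C"
    and C_minus: "x \<in> C \<Longrightarrow> y \<in> C \<Longrightarrow> x - y \<in> C"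
    and C_mul: "x \<in> C \<Longrightarrow> y \<in> C \<Longrightarrow> x \<cdot> y \<in> C"
begin

lemma mul_zero [simp]: "0 \<cdot> x = 0" "x \<cdot> 0 = 0"
  using mul_add_left[of 0 0 x] mul_add_right[of x 0 0] by auto

lemma mul_minus_left: "(x - y) \<cdot> z = x \<cdot> z - y \<cdot> z"
  using mul_add_left[of "x - y" y z] by (simp add: algebra_simps)

lemma mul_minus_right: "z \<cdot> (x - y) = z \<cdot> x - z \<cdot> y"
  using mul_add_right[of z "x - y" y] by (simp add: algebra_simps)

lemma mul_sum_left: "(\<Sum>k\<in>K. g k) \<cdot> z = (\<Sum>k\<in>K. g k \<cdot> z)"
  by (induction K rule: infinite_finite_induct) (simp_all add: mul_add_left)

lemma mul_sum_right: "z \<cdot> (\<Sum>k\<in>K. g k) = (\<Sum>k\<in>K. z \<cdot> g k)"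
  by (induction K rule: infinite_finite_induct) (simp_all add: mul_add_right)

lemma C_add: "x \<in> C \<Longrightarrow> y \<in> C \<Longrightarrow> x + y \<in> C"
  using C_minus[of x "0 - y"] C_minus[of 0 y] C_zero by simp

text \<open>Submodules of the ambient ring; local unitality is not required.\<close>

definition submodule :: "'a set \<Rightarrow> bool" where
  "submodule V \<longleftrightarrow> 0 \<in> V \<and> (\<forall>v\<in>V. \<forall>w\<in>V. v - w \<in> V) \<and> (\<forall>d\<in>C. \<forall>v\<in>V. d \<cdot> v \<in> V)"

lemma submoduleD:
  assumes "submodule V"
  shows "0 \<in> V" "v \<in> V \<Longrightarrow> w \<in> V \<Longrightarrow> v - w \<in> V" "d \<in> C \<Longrightarrow> v \<in> V \<Longrightarrow> d \<cdot> v \<in> V"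
    "v \<in> V \<Longrightarrow> w \<in> V \<Longrightarrow> v + w \<in> V"
proof -
  show "0 \<in> V" "v \<in> V \<Longrightarrow> w \<in> V \<Longrightarrow> v - w \<in> V" "d \<in> C \<Longrightarrow> v \<in> V \<Longrightarrow> d \<cdot> v \<in> V" for v w d
    using assms by (auto simp: submodule_def)
  from this(2)[of v "0 - w"] this(2)[of 0 w] this(1)
  show "v \<in> V \<Longrightarrow> w \<in> V \<Longrightarrow> v + w \<in> V" by simp
qed

lemma submodule_sum:
  assumes "submodule V" shows "(\<And>k. k \<in> K \<Longrightarrow> g k \<in> V) \<Longrightarrow> (\<Sum>k\<in>K. g k) \<in> V"
  by (induction K rule: infinite_finite_induct) (simp_all add: submoduleD[OF assms])

text \<open>A \<open>C\<close>-linear map from \<open>V\<close> to the left ideal \<open>C f\<close>, where \<open>f\<close> is an idempotent.\<close>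

definition functional :: "'a set \<Rightarrow> 'a \<Rightarrow> ('a \<Rightarrow> 'a) \<Rightarrow> bool" where
  "functional V f \<phi> \<longleftrightarrow>
     (\<forall>v\<in>V. \<phi> v \<in> C \<and> \<phi> v \<cdot> f = \<phi> v) \<and> (\<forall>v\<in>V. \<forall>w\<in>V. \<phi> (v + w) = \<phi> v + \<phi> w) \<and>
     (\<forall>d\<in>C. \<forall>v\<in>V. \<phi> (d \<cdot> v) = d \<cdot> \<phi> v)"

lemma functionalD:
  assumes "functional V f \<phi>"
  shows "v \<in> V \<Longrightarrow> \<phi> v \<in> C" "v \<in> V \<Longrightarrow> \<phi> v \<cdot> f = \<phi> v"
    "v \<in> V \<Longrightarrow> w \<in> V \<Longrightarrow> \<phi> (v + w) = \<phi> v + \<phi> w" "d \<in> C \<Longrightarrow> v \<in> V \<Longrightarrow> \<phi> (d \<cdot> v) = d \<cdot> \<phi> v"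
  using assms by (auto simp: functional_def)

lemma functional_minus:
  assumes "functional V f \<phi>" "submodule V" "v \<in> V" "w \<in> V"
  shows "\<phi> (v - w) = \<phi> v - \<phi> w"
  using functionalD(3)[OF assms(1) submoduleD(2)[OF assms(2)], of v w w] assms(3,4)
  by (simp add: algebra_simps)

lemma functional_zero: "functional V f \<phi> \<Longrightarrow> submodule V \<Longrightarrow> \<phi> 0 = 0"
  using functionalD(4)[of V f \<phi> 0 0] by (auto simp: C_zero submoduleD)

lemma functional_sum:
  assumes "functional V f \<phi>" "submodule V"
  shows "(\<And>k. k \<in> K \<Longrightarrow> g k \<in> V) \<Longrightarrow> \<phi> (\<Sum>k\<in>K. g k) = (\<Sum>k\<in>K. \<phi> (g k))"
proof (induction K rule: infinite_finite_induct)
  case (insert k K)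
  then show ?case
    using functionalD(3)[OF assms(1), of "g k" "\<Sum>k\<in>K. g k"] submodule_sum[OF assms(2), of K g]
    by simp
qed (use functional_zero assms in auto)

text \<open>
  A dual basis \<open>(p, \<phi>)\<close> of \<open>V\<close> with idempotents \<open>f\<close>: elements \<open>p k \<in> f k V\<close> and linear maps
  \<open>\<phi> k : V \<rightarrow> C f k\<close> with \<open>v = \<Sum>\<^sub>k \<phi> k v \<cdot> p k\<close>. It exists only if \<open>V\<close> is projective. If it is
  orthonormal, then \<open>V\<close> is the direct sum of the modules \<open>C \<cdot> p k\<close>, each isomorphic to \<open>C f k\<close>.
\<close>

definition dual_basis ::
    "'a set \<Rightarrow> 'k set \<Rightarrow> ('k \<Rightarrow> 'a) \<Rightarrow> ('k \<Rightarrow> 'a) \<Rightarrow> ('k \<Rightarrow> 'a \<Rightarrow> 'a) \<Rightarrow> bool" where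
  "dual_basis V K f p \<phi> \<longleftrightarrow>
     (\<forall>k\<in>K. p k \<in> V \<and> f k \<cdot> p k = p k \<and> functional V (f k) (\<phi> k)) \<and>
     (\<forall>v\<in>V. finite {k \<in> K. \<phi> k v \<noteq> 0} \<and> v = (\<Sum>k | k \<in> K \<and> \<phi> k v \<noteq> 0. \<phi> k v \<cdot> p k))"

definition orthonormal ::
    "'k set \<Rightarrow> ('k \<Rightarrow> 'a) \<Rightarrow> ('k \<Rightarrow> 'a) \<Rightarrow> ('k \<Rightarrow> 'a \<Rightarrow> 'a) \<Rightarrow> bool" where
  "orthonormal K f p \<phi> \<longleftrightarrow> (\<forall>k\<in>K. \<forall>l\<in>K. \<phi> k (p l) = (if k = l then f k else 0))"

lemma dual_basisD:
  assumes "dual_basis V K f p \<phi>" "k \<in> K"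
  shows "p k \<in> V" "f k \<cdot> p k = p k" "functional V (f k) (\<phi> k)"
  using assms by (auto simp: dual_basis_def)

lemma dual_basis_finite_iff:
  assumes "finite K"
  shows "dual_basis V K f p \<phi> \<longleftrightarrow>
     (\<forall>k\<in>K. p k \<in> V \<and> f k \<cdot> p k = p k \<and> functional V (f k) (\<phi> k)) \<and>
     (\<forall>v\<in>V. v = (\<Sum>k\<in>K. \<phi> k v \<cdot> p k))"
proof -
  have "(\<Sum>k | k \<in> K \<and> \<phi> k v \<noteq> 0. \<phi> k v \<cdot> p k) = (\<Sum>k\<in>K. \<phi> k v \<cdot> p k)" for v
    using assms by (intro sum.mono_neutral_left) auto
  then show ?thesis using assms by (simp add: dual_basis_def)
qed

text \<open>An idempotent \<open>f\<close> of \<open>C\<close> whose corner \<open>f C f\<close> is local: always \<open>c\<close> or \<open>f - c\<close> is invertible in it.\<close>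

definition local_idempotent :: "'a \<Rightarrow> bool" where
  "local_idempotent f \<longleftrightarrow> f \<in> C \<and> f \<cdot> f = f \<and>
     (\<forall>c\<in>C. f \<cdot> c = c \<longrightarrow> c \<cdot> f = c \<longrightarrow>
       (\<exists>r\<in>C. f \<cdot> r = r \<and> r \<cdot> f = r \<and>
              (c \<cdot> r = f \<and> r \<cdot> c = f \<or> (f - c) \<cdot> r = f \<and> r \<cdot> (f - c) = f)))"

text \<open>
  If a functional \<open>\<eta>\<close> takes the value \<open>f\<^sub>0\<close> at \<open>p\<^sub>0\<close>, then \<open>V\<close> is the direct sum of \<open>C \<cdot> p\<^sub>0\<close> and the kernel of
  \<open>\<eta>\<close>; here \<open>\<pi>\<close> is the projection onto the kernel.
\<close>

lemma kernel_projection: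
  assumes V: "submodule V" and \<eta>: "functional V f\<^sub>0 \<eta>" and p\<^sub>0: "p\<^sub>0 \<in> V" "f\<^sub>0 \<cdot> p\<^sub>0 = p\<^sub>0" "\<eta> p\<^sub>0 = f\<^sub>0"
  defines "W \<equiv> {v \<in> V. \<eta> v = 0}" and "\<pi> \<equiv> \<lambda>v. v - \<eta> v \<cdot> p\<^sub>0"
  shows "submodule W" "\<And>v. v \<in> V \<Longrightarrow> \<pi> v \<in> W" "\<And>v. v \<in> W \<Longrightarrow> \<pi> v = v" "\<pi> p\<^sub>0 = 0"
    "\<And>v w. v \<in> V \<Longrightarrow> w \<in> V \<Longrightarrow> \<pi> (v + w) = \<pi> v + \<pi> w"
    "\<And>d v. d \<in> C \<Longrightarrow> v \<in> V \<Longrightarrow> \<pi> (d \<cdot> v) = d \<cdot> \<pi> v"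
proof -
  note VD = submoduleD[OF V] and F = functionalD[OF \<eta>]
  show "submodule W"
    unfolding submodule_def W_def
    using VD F functional_zero[OF \<eta> V] functional_minus[OF \<eta> V] by auto
  show "\<pi> v \<in> W" if v: "v \<in> V" for v
  proof -
    have "\<pi> v \<in> V" using VD F v p\<^sub>0 by (simp add: \<pi>_def)
    moreover have "\<eta> (\<pi> v) = \<eta> v - \<eta> v \<cdot> f\<^sub>0"
      using functional_minus[OF \<eta> V v] VD F v p\<^sub>0 by (simp add: \<pi>_def)
    ultimately show ?thesis using F(2)[OF v] by (simp add: W_def)
  qed
  show "\<pi> v = v" if "v \<in> W" for v using that by (simp add: \<pi>_def W_def)
  show "\<pi> p\<^sub>0 = 0" using p\<^sub>0 by (simp add: \<pi>_def)
  show "\<pi> (v + w) = \<pi> v + \<pi> w" if "v \<in> V" "w \<in> V" for v w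
    using that F by (simp add: \<pi>_def mul_add_left algebra_simps)
  show "\<pi> (d \<cdot> v) = d \<cdot> \<pi> v" if "d \<in> C" "v \<in> V" for d v
    using that F by (simp add: \<pi>_def mul_minus_right mul_assoc)
qed

text \<open>An orthonormal dual basis of the kernel of \<open>\<eta>\<close> and an element with \<open>\<eta> p\<^sub>0 = f\<^sub>0\<close> make one of \<open>V\<close>.\<close>

lemma orthonormal_dual_basis_extend:
  assumes V: "submodule V" and \<eta>: "functional V f\<^sub>0 \<eta>" and p\<^sub>0: "p\<^sub>0 \<in> V" "f\<^sub>0 \<cdot> p\<^sub>0 = p\<^sub>0" "\<eta> p\<^sub>0 = f\<^sub>0"
    and K: "finite K" "l \<notin> K"
    and db: "dual_basis {v \<in> V. \<eta> v = 0} K f p \<phi>" and on: "orthonormal K f p \<phi>"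
  shows "\<exists>\<phi>'. dual_basis V (insert l K) (f(l := f\<^sub>0)) (p(l := p\<^sub>0)) \<phi>' \<and>
    orthonormal (insert l K) (f(l := f\<^sub>0)) (p(l := p\<^sub>0)) \<phi>'"
proof (intro exI conjI)
  define \<pi> where "\<pi> v = v - \<eta> v \<cdot> p\<^sub>0" for v
  note \<pi> = kernel_projection[OF V \<eta> p\<^sub>0, folded \<pi>_def]
  note D = dual_basisD[OF db]
  let ?\<phi> = "(\<lambda>k v. \<phi> k (\<pi> v))(l := \<eta>)"
  have fin: "finite (insert l K)" using K by simp
  show "dual_basis V (insert l K) (f(l := f\<^sub>0)) (p(l := p\<^sub>0)) ?\<phi>"
    unfolding dual_basis_finite_iff[OF fin]
  proof (intro conjI ballI)
    fix k assume k: "k \<in> insert l K"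
    show "(p(l := p\<^sub>0)) k \<in> V" "(f(l := f\<^sub>0)) k \<cdot> (p(l := p\<^sub>0)) k = (p(l := p\<^sub>0)) k"
      using k D p\<^sub>0 by auto
    show "functional V ((f(l := f\<^sub>0)) k) (?\<phi> k)"
    proof (cases "k = l")
      case False
      then have "functional {v \<in> V. \<eta> v = 0} (f k) (\<phi> k)" using k D(3) by simp
      then show ?thesis using \<pi>(2,5,6) False by (simp add: functional_def)
    qed (use \<eta> in simp)
  next
    fix v assume v: "v \<in> V"
    have "(\<Sum>k\<in>K. ?\<phi> k v \<cdot> (p(l := p\<^sub>0)) k) = (\<Sum>k\<in>K. \<phi> k (\<pi> v) \<cdot> p k)"
      using K(2) by (intro sum.cong) auto
    also have "\<dots> = \<pi> v"
      using db \<pi>(2)[OF v] unfolding dual_basis_finite_iff[OF K(1)] by auto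
    finally show "v = (\<Sum>k\<in>insert l K. ?\<phi> k v \<cdot> (p(l := p\<^sub>0)) k)" using K by (simp add: \<pi>_def)
  qed
  have "\<phi> k 0 = 0" if "k \<in> K" for k using functional_zero[OF D(3)[OF that] \<pi>(1)] .
  then show "orthonormal (insert l K) (f(l := f\<^sub>0)) (p(l := p\<^sub>0)) ?\<phi>"
    using on D(1) K(2) \<pi>(3,4) p\<^sub>0 by (auto simp: orthonormal_def)
qed

lemma dual_basis_reindex:
  assumes db: "dual_basis V K f p \<phi>" and h: "bij_betw h K' K"
    and eq: "\<And>k. k \<in> K' \<Longrightarrow> f' k = f (h k)" "\<And>k. k \<in> K' \<Longrightarrow> p' k = p (h k)"
  shows "dual_basis V K' f' p' (\<phi> \<circ> h)"
    and "orthonormal K f p \<phi> \<Longrightarrow> orthonormal K' f' p' (\<phi> \<circ> h)"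
proof -
  have inj: "inj_on h K'" and im: "h ` K' = K" using h by (auto simp: bij_betw_def)
  have supp: "h ` {k \<in> K'. (\<phi> \<circ> h) k v \<noteq> 0} = {k \<in> K. \<phi> k v \<noteq> 0}" for v using im by auto
  have inj': "inj_on h {k \<in> K'. (\<phi> \<circ> h) k v \<noteq> 0}" for v by (rule inj_on_subset[OF inj]) auto
  show "dual_basis V K' f' p' (\<phi> \<circ> h)"
    unfolding dual_basis_def
  proof (intro conjI ballI)
    fix k assume k: "k \<in> K'"
    then have "h k \<in> K" using im by blast
    from dual_basisD[OF db this]
    show "p' k \<in> V" "f' k \<cdot> p' k = p' k" "functional V (f' k) ((\<phi> \<circ> h) k)" using eq k by simp_all
  next
    fix v assume v: "v \<in> V"
    have *: "finite {k \<in> K. \<phi> k v \<noteq> 0}" "v = (\<Sum>k | k \<in> K \<and> \<phi> k v \<noteq> 0. \<phi> k v \<cdot> p k)"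
      using db v by (auto simp: dual_basis_def)
    show "finite {k \<in> K'. (\<phi> \<circ> h) k v \<noteq> 0}"
      by (rule finite_imageD[OF _ inj']) (simp only: supp *(1))
    have "(\<Sum>k | k \<in> K \<and> \<phi> k v \<noteq> 0. \<phi> k v \<cdot> p k) =
        (\<Sum>k | k \<in> K' \<and> (\<phi> \<circ> h) k v \<noteq> 0. (\<phi> \<circ> h) k v \<cdot> p' k)"
      unfolding supp[symmetric] sum.reindex[OF inj'] by (rule sum.cong) (auto simp: eq)
    from trans[OF *(2) this]
    show "v = (\<Sum>k | k \<in> K' \<and> (\<phi> \<circ> h) k v \<noteq> 0. (\<phi> \<circ> h) k v \<cdot> p' k)" .
  qed
  assume "orthonormal K f p \<phi>"
  then show "orthonormal K' f' p' (\<phi> \<circ> h)"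
    using im inj by (fastforce simp: orthonormal_def inj_on_eq_iff eq)
qed

text \<open>
  A finite dual basis with local idempotents can be made orthonormal. Remove an index \<open>l\<close> and
  consider \<open>c = \<phi> l (p l)\<close> in the local ring \<open>f l C f l\<close>. If \<open>c\<close> is invertible, then \<open>C \<cdot> p l\<close> splits
  off with complement the kernel of \<open>\<phi> l\<close>. If \<open>f l - c\<close> is invertible, then \<open>p l\<close> is a combination
  of the other \<open>p k\<close> and is superfluous.
\<close>

proposition orthonormal_dual_basis_exists:
  assumes "finite K" "submodule V" "dual_basis V K f p \<phi>" "\<And>k. k \<in> K \<Longrightarrow> local_idempotent (f k)"
  shows "\<exists>K'\<subseteq>K. \<exists>p' \<phi>'. dual_basis V K' f p' \<phi>' \<and> orthonormal K' f p' \<phi>'"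
  using assms
proof (induction K arbitrary: V p \<phi> rule: finite_induct)
  case empty
  then show ?case by (intro exI[of _ "{}"]) (auto simp: orthonormal_def)
next
  case (insert l K)
  note V = submoduleD[OF insert.prems(1)]
  note db = dual_basisD[OF insert.prems(2)]
  have lin: "functional V (f k) (\<phi> k)" if "k \<in> insert l K" for k using db that by blast
  have expand: "v = \<phi> l v \<cdot> p l + (\<Sum>k\<in>K. \<phi> k v \<cdot> p k)" if "v \<in> V" for v
    using insert.prems(2) insert.hyps that by (auto simp: dual_basis_finite_iff)
  have pl: "p l \<in> V" "f l \<cdot> p l = p l" using db by auto
  have loc: "local_idempotent (f l)" using insert.prems by simp
  then have fl: "f l \<in> C" "f l \<cdot> f l = f l" by (auto simp: local_idempotent_def)
  note fD = functionalD[OF lin[of l, simplified]]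
  define c where "c = \<phi> l (p l)"
  have c: "c \<in> C" "c \<cdot> f l = c" "f l \<cdot> c = c"
    using fD(1,2)[OF pl(1)] fD(4)[OF fl(1) pl(1)] pl by (auto simp: c_def)
  then obtain r where r: "r \<in> C" "f l \<cdot> r = r" "r \<cdot> f l = r"
    and "c \<cdot> r = f l \<and> r \<cdot> c = f l \<or> (f l - c) \<cdot> r = f l \<and> r \<cdot> (f l - c) = f l"
    using loc unfolding local_idempotent_def by metis
  then consider "c \<cdot> r = f l" "r \<cdot> c = f l" | "(f l - c) \<cdot> r = f l" "r \<cdot> (f l - c) = f l"
    by auto
  then show ?case
  proof cases
    case 1
    define \<eta> where "\<eta> v = \<phi> l v \<cdot> r" for v
    define Q where "Q = {v \<in> V. \<eta> v = 0}"
    define \<pi> where "\<pi> v = v - \<eta> v \<cdot> p l" for v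
    have \<eta>: "functional V (f l) \<eta>" "\<eta> (p l) = f l"
      using fD r C_mul 1 by (simp_all add: functional_def \<eta>_def mul_add_left mul_assoc flip: c_def)
    note \<pi> = kernel_projection[OF insert.prems(1) \<eta>(1) pl \<eta>(2), folded \<pi>_def Q_def]
    have \<pi>sum: "\<pi> (\<Sum>k\<in>K. g k) = (\<Sum>k\<in>K. \<pi> (g k))" if "\<And>k. k \<in> K \<Longrightarrow> g k \<in> V" for g
      using \<open>finite K\<close> that
    proof (induction K rule: finite_induct)
      case empty
      then show ?case using \<pi>(3) submoduleD(1)[OF \<pi>(1)] by simp
    next
      case (insert x F)
      then show ?case using \<pi>(5) submodule_sum[OF \<open>submodule V\<close>, of F g] by simp
    qed
    have dQ: "dual_basis Q K f (\<lambda>k. \<pi> (p k)) \<phi>"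
      unfolding dual_basis_finite_iff[OF \<open>finite K\<close>]
    proof (intro conjI ballI)
      fix k assume k: "k \<in> K"
      have fk: "f k \<in> C" using insert.prems(3) k by (auto simp: local_idempotent_def)
      show "\<pi> (p k) \<in> Q" using \<pi>(2) db k by simp
      show "f k \<cdot> \<pi> (p k) = \<pi> (p k)" using \<pi>(6)[OF fk] db k by (metis insertI2)
      show "functional Q (f k) (\<phi> k)"
        using lin[of k] k by (auto simp: functional_def Q_def)
    next
      fix v assume v: "v \<in> Q"
      then have vV: "v \<in> V" and "\<phi> l v \<cdot> r \<cdot> c = 0" by (simp_all add: Q_def \<eta>_def)
      then have "\<phi> l v = 0" using 1(2) fD(2)[OF vV] by (simp add: mul_assoc)
      then have "v = (\<Sum>k\<in>K. \<phi> k v \<cdot> p k)" using expand[OF vV] by simp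
      moreover have mem: "\<phi> k v \<in> C" "p k \<in> V" if "k \<in> K" for k
        using functionalD(1)[OF lin] vV db that by auto
      ultimately have "v = \<pi> (\<Sum>k\<in>K. \<phi> k v \<cdot> p k)" using \<pi>(3)[OF v] by simp
      also have "\<dots> = (\<Sum>k\<in>K. \<phi> k v \<cdot> \<pi> (p k))"
        using \<pi>sum[of "\<lambda>k. \<phi> k v \<cdot> p k"] \<pi>(6) mem V by simp
      finally show "v = (\<Sum>k\<in>K. \<phi> k v \<cdot> \<pi> (p k))" .
    qed
    obtain K' p' \<phi>' where K': "K' \<subseteq> K" and dQ': "dual_basis Q K' f p' \<phi>'" "orthonormal K' f p' \<phi>'"
      using insert.IH[OF \<pi>(1) dQ] insert.prems(3) by auto
    have "finite K'" "l \<notin> K'" using K' insert.hyps finite_subset by auto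
    from orthonormal_dual_basis_extend[OF insert.prems(1) \<eta>(1) pl \<eta>(2) this dQ'[unfolded Q_def]]
    obtain \<phi>'' where "dual_basis V (insert l K') f (p'(l := p l)) \<phi>''"
      "orthonormal (insert l K') f (p'(l := p l)) \<phi>''" by auto
    then show ?thesis using K' by (meson insert_mono)
  next
    case 2
    define \<phi>' where "\<phi>' k v = \<phi> k v + \<phi> l v \<cdot> r \<cdot> \<phi> k (p l)" for k v
    have "dual_basis V K f p \<phi>'"
      unfolding dual_basis_finite_iff[OF \<open>finite K\<close>]
    proof (intro conjI ballI)
      fix k assume k: "k \<in> K"
      show "p k \<in> V" "f k \<cdot> p k = p k" using db k by auto
      show "functional V (f k) (\<phi>' k)"
        using functionalD[OF lin[of k]] fD k r pl C_mul C_add V unfolding functional_def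
        by (auto simp: \<phi>'_def mul_add_left mul_add_right mul_assoc algebra_simps)
    next
      fix v assume v: "v \<in> V"
      have "(f l - c) \<cdot> p l = (\<Sum>k\<in>K. \<phi> k (p l) \<cdot> p k)"
        using expand[OF pl(1)] pl(2) by (simp add: mul_minus_left c_def algebra_simps)
      then have "r \<cdot> (\<Sum>k\<in>K. \<phi> k (p l) \<cdot> p k) = r \<cdot> (f l - c) \<cdot> p l" by (simp add: mul_assoc)
      then have *: "p l = r \<cdot> (\<Sum>k\<in>K. \<phi> k (p l) \<cdot> p k)" using 2 pl by simp
      have "(\<Sum>k\<in>K. \<phi>' k v \<cdot> p k) =
          (\<Sum>k\<in>K. \<phi> k v \<cdot> p k) + \<phi> l v \<cdot> (r \<cdot> (\<Sum>k\<in>K. \<phi> k (p l) \<cdot> p k))"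
        by (simp add: \<phi>'_def mul_add_left sum.distrib mul_sum_right mul_assoc)
      also have "\<dots> = v" using expand[OF v] * by (simp add: add.commute)
      finally show "v = (\<Sum>k\<in>K. \<phi>' k v \<cdot> p k)" by simp
    qed
    from insert.IH[OF insert.prems(1) this] insert.prems(3) show ?thesis
      by (metis insertI2 subset_insertI2)
  qed
qed

lemma orthonormal_direct_sum:
  assumes V: "submodule V" and db: "dual_basis V K f p \<phi>" and on: "orthonormal K f p \<phi>"
  shows "is_direct_sum V K (\<lambda>k. (\<lambda>d. d \<cdot> p k) ` C)"
proof -
  note D = dual_basisD[OF db]
  let ?P = "{g. (\<forall>k\<in>K. g k \<in> (\<lambda>d. d \<cdot> p k) ` C) \<and> (\<forall>k. k \<notin> K \<longrightarrow> g k = 0) \<and>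
                finite {k. g k \<noteq> 0}}"
  let ?S = "\<lambda>g::'b \<Rightarrow> 'a. \<Sum>k | g k \<noteq> 0. g k"
  have memV: "g k \<in> V" if "g \<in> ?P" for g k
    using that D(1) submoduleD(1,3)[OF V] by (cases "k \<in> K") force+
  have val: "\<phi> k (g l) = (if k = l then \<phi> k (g k) else 0)" "\<phi> k (g k) \<cdot> p k = g k"
    if g: "g \<in> ?P" and k: "k \<in> K" and l: "l \<in> K" for g k l
  proof -
    have *: "\<exists>d\<in>C. g m = d \<cdot> p m" if "m \<in> K" for m using g that by auto
    obtain d where d: "d \<in> C" "g l = d \<cdot> p l" using *[OF l] by blast
    obtain d' where d': "d' \<in> C" "g k = d' \<cdot> p k" using *[OF k] by blast
    show "\<phi> k (g l) = (if k = l then \<phi> k (g k) else 0)"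
      using functionalD(4)[OF D(3)[OF k] d(1) D(1)[OF l]] on k l d
      by (auto simp: orthonormal_def)
    show "\<phi> k (g k) \<cdot> p k = g k"
      using functionalD(4)[OF D(3)[OF k] d'(1) D(1)[OF k]] on k d' D(2)[OF k]
      by (simp add: orthonormal_def mul_assoc)
  qed
  have comp: "\<phi> k (?S g) \<cdot> p k = g k" if g: "g \<in> ?P" and k: "k \<in> K" for g k
  proof -
    have sub: "l \<in> K" if "g l \<noteq> 0" for l using g that by blast
    have "\<phi> k (?S g) = (\<Sum>l | g l \<noteq> 0. \<phi> k (g l))"
      by (rule functional_sum[OF D(3)[OF k] V]) (rule memV[OF g])
    also have "\<dots> = (\<Sum>l | g l \<noteq> 0. if k = l then \<phi> k (g k) else 0)"
      using val(1)[OF g k] sub by (intro sum.cong refl) blast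
    also have "\<dots> = (if g k \<noteq> 0 then \<phi> k (g k) else 0)" using g by simp
    finally show ?thesis using val(2)[OF g k k] by auto
  qed
  have "inj_on ?S ?P"
  proof (rule inj_onI)
    fix g h assume g: "g \<in> ?P" and h: "h \<in> ?P" and eq: "?S g = ?S h"
    show "g = h"
    proof
      fix k show "g k = h k"
      proof (cases "k \<in> K")
        case True
        then show ?thesis using comp[OF g] comp[OF h] eq by metis
      next
        case False
        then have "g k = 0" "h k = 0" using g h by blast+
        then show ?thesis by simp
      qed
    qed
  qed
  moreover have "?S g \<in> V" if "g \<in> ?P" for g
    using memV[OF that] by (intro submodule_sum[OF V])
  moreover have "v \<in> ?S ` ?P" if v: "v \<in> V" for v
  proof -
    define g where "g k = (if k \<in> K then \<phi> k v \<cdot> p k else 0)" for k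
    have fin: "finite {k \<in> K. \<phi> k v \<noteq> 0}" and ex: "v = (\<Sum>k | k \<in> K \<and> \<phi> k v \<noteq> 0. \<phi> k v \<cdot> p k)"
      using db v by (auto simp: dual_basis_def)
    have sub: "{k. g k \<noteq> 0} \<subseteq> {k \<in> K. \<phi> k v \<noteq> 0}" by (auto simp: g_def)
    have "?S g = (\<Sum>k | k \<in> K \<and> \<phi> k v \<noteq> 0. g k)"
      using sub fin by (intro sum.mono_neutral_left) auto
    also have "\<dots> = (\<Sum>k | k \<in> K \<and> \<phi> k v \<noteq> 0. \<phi> k v \<cdot> p k)"
      by (intro sum.cong) (auto simp: g_def)
    finally have "?S g = v" using ex by simp
    moreover have "g \<in> ?P"
      using finite_subset[OF sub fin] functionalD(1)[OF D(3) v] by (auto simp: g_def)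
    ultimately show ?thesis by (metis (no_types, lifting) imageI)
  qed
  ultimately have "bij_betw ?S ?P V" unfolding bij_betw_def by blast
  then show ?thesis by (simp add: is_direct_sum_def)
qed

lemma orthonormal_component:
  assumes db: "dual_basis V K f p \<phi>" and on: "orthonormal K f p \<phi>" and k: "k \<in> K"
  shows "bij_betw (\<lambda>a. a \<cdot> p k) ((\<lambda>d. d \<cdot> f k) ` C) ((\<lambda>d. d \<cdot> p k) ` C)"
    and "f k \<in> C \<Longrightarrow> module_isomorphic C mul ((\<lambda>d. d \<cdot> p k) ` C) mul ((\<lambda>d. d \<cdot> f k) ` C)"
proof -
  note D = dual_basisD[OF db k]
  note F = functionalD[OF D(3)]
  have ph: "\<phi> k (d \<cdot> p k) = d \<cdot> f k" if "d \<in> C" for d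
    using F(4)[OF that D(1)] on k by (simp add: orthonormal_def)
  have idm: "f k \<cdot> f k = f k"
    using on k F(2)[OF D(1)] by (simp add: orthonormal_def)
  have im: "(\<lambda>a. a \<cdot> p k) ` ((\<lambda>d. d \<cdot> f k) ` C) = (\<lambda>d. d \<cdot> p k) ` C"
    by (simp add: image_image mul_assoc D(2))
  have inj: "inj_on (\<lambda>a. a \<cdot> p k) ((\<lambda>d. d \<cdot> f k) ` C)"
  proof (rule inj_onI)
    fix a b assume "a \<in> (\<lambda>d. d \<cdot> f k) ` C" "b \<in> (\<lambda>d. d \<cdot> f k) ` C" and eq: "a \<cdot> p k = b \<cdot> p k"
    then obtain d d' where d: "d \<in> C" "a = d \<cdot> f k" "d' \<in> C" "b = d' \<cdot> f k" by auto
    have "d \<cdot> p k = d' \<cdot> p k" using eq d by (simp add: mul_assoc D(2))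
    then show "a = b" using ph d by metis
  qed
  show "bij_betw (\<lambda>a. a \<cdot> p k) ((\<lambda>d. d \<cdot> f k) ` C) ((\<lambda>d. d \<cdot> p k) ` C)"
    using im inj by (simp add: bij_betw_def)
  assume fk: "f k \<in> C"
  have "is_module_hom C mul ((\<lambda>d. d \<cdot> p k) ` C) mul ((\<lambda>d. d \<cdot> f k) ` C) (\<phi> k)"
    unfolding is_module_hom_def
  proof (intro conjI ballI)
    show "\<phi> k \<in> (\<lambda>d. d \<cdot> p k) ` C \<rightarrow> (\<lambda>d. d \<cdot> f k) ` C" using ph by auto
  next
    fix m n assume "m \<in> (\<lambda>d. d \<cdot> p k) ` C" "n \<in> (\<lambda>d. d \<cdot> p k) ` C"
    then obtain d d' where "d \<in> C" "m = d \<cdot> p k" "d' \<in> C" "n = d' \<cdot> p k" by auto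
    then show "\<phi> k (m + n) = \<phi> k m + \<phi> k n"
      using ph C_add by (metis mul_add_left)
  next
    fix c m assume "c \<in> C" "m \<in> (\<lambda>d. d \<cdot> p k) ` C"
    then obtain d where "d \<in> C" "m = d \<cdot> p k" by auto
    then show "\<phi> k (c \<cdot> m) = c \<cdot> \<phi> k m"
      using ph C_mul \<open>c \<in> C\<close> by (metis mul_assoc)
  qed
  moreover have "bij_betw (\<phi> k) ((\<lambda>d. d \<cdot> p k) ` C) ((\<lambda>d. d \<cdot> f k) ` C)"
    unfolding bij_betw_def
  proof
    show "\<phi> k ` (\<lambda>d. d \<cdot> p k) ` C = (\<lambda>d. d \<cdot> f k) ` C"
      unfolding image_image using ph by (intro image_cong) auto
    show "inj_on (\<phi> k) ((\<lambda>d. d \<cdot> p k) ` C)"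
    proof (rule inj_onI)
      fix m n assume "m \<in> (\<lambda>d. d \<cdot> p k) ` C" "n \<in> (\<lambda>d. d \<cdot> p k) ` C" "\<phi> k m = \<phi> k n"
      then obtain d d' where *: "d \<in> C" "m = d \<cdot> p k" "d' \<in> C" "n = d' \<cdot> p k"
        "d \<cdot> f k = d' \<cdot> f k" using ph by auto
      then show "m = n" using D(2) by (metis mul_assoc)
    qed
  qed
  ultimately show "module_isomorphic C mul ((\<lambda>d. d \<cdot> p k) ` C) mul ((\<lambda>d. d \<cdot> f k) ` C)"
    unfolding module_isomorphic_def by blast
qed

text \<open>One-sided inverses in a local corner are two-sided, since \<open>y \<cdot> x\<close> is idempotent.\<close>

lemma local_idempotent_inverse:
  assumes loc: "local_idempotent f" and x: "x \<in> C" "f \<cdot> x = x" "x \<cdot> f = x"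
    and y: "y \<in> C" "f \<cdot> y = y" "y \<cdot> f = y" and xy: "x \<cdot> y = f"
  shows "y \<cdot> x = f"
proof -
  have f: "f \<in> C" "f \<cdot> f = f" using loc by (auto simp: local_idempotent_def)
  define g where "g = y \<cdot> x"
  have g: "g \<in> C" "f \<cdot> g = g" "g \<cdot> f = g" "g \<cdot> g = g"
    using x y xy C_mul unfolding g_def by (metis mul_assoc)+
  then obtain r where r: "r \<in> C" "f \<cdot> r = r" "r \<cdot> f = r"
    and "g \<cdot> r = f \<and> r \<cdot> g = f \<or> (f - g) \<cdot> r = f \<and> r \<cdot> (f - g) = f"
    using loc unfolding local_idempotent_def by metis
  then consider "r \<cdot> g = f" | "r \<cdot> (f - g) = f" by auto
  then show ?thesis
  proof cases
    case 1
    then show ?thesis using g by (metis g_def mul_assoc)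
  next
    case 2
    have "(f - g) \<cdot> g = 0" using g by (simp add: mul_minus_left)
    then have "g = 0" using 2 g by (metis mul_assoc mul_zero(2))
    then have "f = 0" using xy x y f by (metis g_def mul_assoc mul_zero(1,2))
    then show ?thesis using x xy by (metis mul_zero(1) mul_zero(2))
  qed
qed

text \<open>
  Conversely, the modules \<open>C \<cdot> p k\<close> of a direct sum with \<open>C \<cdot> p k \<cong> C f k\<close> come from an orthonormal
  dual basis, even though the isomorphism is not assumed to send \<open>p k\<close> to \<open>f k\<close>: it sends \<open>p k\<close> to
  an element of the local ring \<open>f k C f k\<close> with a left inverse, hence to a unit.
\<close>

lemma orthonormal_dual_basis_of_direct_sum:
  assumes V: "submodule V" and ds: "is_direct_sum V K (\<lambda>k. (\<lambda>d. d \<cdot> p k) ` C)"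
    and p: "\<And>k. k \<in> K \<Longrightarrow> p k \<in> V" "\<And>k. k \<in> K \<Longrightarrow> f k \<cdot> p k = p k"
    and iso: "\<And>k. k \<in> K \<Longrightarrow> module_isomorphic C mul ((\<lambda>d. d \<cdot> p k) ` C) mul ((\<lambda>d. d \<cdot> f k) ` C)"
    and loc: "\<And>k. k \<in> K \<Longrightarrow> local_idempotent (f k)"
  shows "\<exists>\<phi>. dual_basis V K f p \<phi> \<and> orthonormal K f p \<phi>"
proof -
  have f: "f k \<in> C" "f k \<cdot> f k = f k" if "k \<in> K" for k
    using loc[OF that] by (auto simp: local_idempotent_def)
  have ann: "x = 0" if k: "k \<in> K" and x: "x \<in> C" "x \<cdot> f k = x" "x \<cdot> p k = 0" for k x
  proof -
    obtain \<theta> where hom: "is_module_hom C mul ((\<lambda>d. d \<cdot> p k) ` C) mul ((\<lambda>d. d \<cdot> f k) ` C) \<theta>"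
      and bij: "bij_betw \<theta> ((\<lambda>d. d \<cdot> p k) ` C) ((\<lambda>d. d \<cdot> f k) ` C)"
      using iso[OF k] by (auto simp: module_isomorphic_def)
    have pin: "p k \<in> (\<lambda>d. d \<cdot> p k) ` C" using p(2)[OF k] f(1)[OF k] by force
    have lin: "\<theta> (d \<cdot> m) = d \<cdot> \<theta> m" if "d \<in> C" "m \<in> (\<lambda>d. d \<cdot> p k) ` C" for d m
      using hom that unfolding is_module_hom_def by blast
    define c where "c = \<theta> (p k)"
    have "c \<in> (\<lambda>d. d \<cdot> f k) ` C" using bij pin unfolding c_def by (simp add: bij_betw_apply)
    then have c: "c \<in> C" "c \<cdot> f k = c" using f[OF k] C_mul by (auto simp: mul_assoc)
    have c2: "f k \<cdot> c = c" using lin[OF f(1)[OF k] pin] p(2)[OF k] by (simp add: c_def)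
    have "f k \<in> (\<lambda>d. d \<cdot> f k) ` C" using f[OF k] by force
    then obtain d where d: "d \<in> C" "f k = \<theta> (d \<cdot> p k)" using bij by (auto simp: bij_betw_def)
    then have dc: "d \<cdot> c = f k" using lin pin by (simp add: c_def)
    have ff: "f k \<cdot> (f k \<cdot> z) = f k \<cdot> z" for z using f(2)[OF k] by (simp flip: mul_assoc)
    define r where "r = f k \<cdot> d \<cdot> f k"
    have r: "r \<in> C" "f k \<cdot> r = r" "r \<cdot> f k = r" "r \<cdot> c = f k"
      using d(1) f[OF k] C_mul c2 dc ff by (simp_all add: r_def mul_assoc)
    have "c \<cdot> r = f k"
      using local_idempotent_inverse[OF loc[OF k] r(1-3) c(1) c2 c(2) r(4)] .
    moreover have "x \<cdot> c = \<theta> (x \<cdot> p k)" using lin[OF x(1) pin] by (simp add: c_def)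
    moreover have "\<theta> 0 = 0" using lin[OF C_zero pin] by simp
    ultimately show "x = 0" using x by (metis mul_assoc mul_zero(1))
  qed
  let ?P = "{g. (\<forall>k\<in>K. g k \<in> (\<lambda>d. d \<cdot> p k) ` C) \<and> (\<forall>k. k \<notin> K \<longrightarrow> g k = 0) \<and>
                finite {k. g k \<noteq> 0}}"
  let ?S = "\<lambda>g::'b \<Rightarrow> 'a. \<Sum>k | g k \<noteq> 0. g k"
  have bij: "bij_betw ?S ?P V" using ds by (simp add: is_direct_sum_def)
  define F where "F = inv_into ?P ?S"
  have F: "F v \<in> ?P" "?S (F v) = v" if "v \<in> V" for v
    using bij_betw_inv_into[OF bij] bij_betw_inv_into_right[OF bij that] that
    unfolding F_def by (meson bij_betw_apply, simp)
  have Fu: "F v = g" if "g \<in> ?P" "?S g = v" for g v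
    using bij_betw_inv_into_left[OF bij that(1)] that(2) by (simp add: F_def)
  have ex1: "\<exists>x. x \<in> C \<and> x \<cdot> f k = x \<and> F v k = x \<cdot> p k" if v: "v \<in> V" and k: "k \<in> K" for v k
  proof -
    obtain d where "d \<in> C" "F v k = d \<cdot> p k" using F(1)[OF v] k by auto
    then show ?thesis
      using f[OF k] C_mul p(2)[OF k] by (intro exI[of _ "d \<cdot> f k"]) (simp add: mul_assoc)
  qed
  define \<phi> where "\<phi> k v = (SOME x. x \<in> C \<and> x \<cdot> f k = x \<and> F v k = x \<cdot> p k)" for k v
  have \<phi>: "\<phi> k v \<in> C" "\<phi> k v \<cdot> f k = \<phi> k v" "F v k = \<phi> k v \<cdot> p k" if "v \<in> V" "k \<in> K" for v k
    using someI_ex[OF ex1[OF that]] unfolding \<phi>_def by auto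
  have \<phi>u: "\<phi> k v = x" if "v \<in> V" "k \<in> K" "x \<in> C" "x \<cdot> f k = x" "F v k = x \<cdot> p k" for v k x
  proof -
    have "\<phi> k v \<cdot> p k = x \<cdot> p k" using \<phi>(3)[OF that(1,2)] that(5) by metis
    then have "\<phi> k v - x = 0"
      using \<phi>(1,2)[OF that(1,2)] that(3,4) C_minus
      by (intro ann[OF that(2), of "\<phi> k v - x"]) (simp_all add: mul_minus_left)
    then show ?thesis by simp
  qed
  have S_superset: "?S g = (\<Sum>k\<in>T. g k)" if "finite T" "{k. g k \<noteq> 0} \<subseteq> T" for g T
    using that by (intro sum.mono_neutral_left) auto
  have Fadd: "F (v + w) k = F v k + F w k" if "v \<in> V" "w \<in> V" for v w k
  proof -
    let ?g = "\<lambda>k. F v k + F w k"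
    let ?T = "{k. F v k \<noteq> 0} \<union> {k. F w k \<noteq> 0}"
    have fin: "finite ?T" using F(1)[OF that(1)] F(1)[OF that(2)] by blast
    have "?g k \<in> (\<lambda>d. d \<cdot> p k) ` C" if "k \<in> K" for k
      using \<phi>[OF \<open>v \<in> V\<close> that] \<phi>[OF \<open>w \<in> V\<close> that] C_add
      by (intro image_eqI[of _ _ "\<phi> k v + \<phi> k w"]) (auto simp: mul_add_left)
    moreover have "?g k = 0" if "k \<notin> K" for k using F(1)[OF \<open>v \<in> V\<close>] F(1)[OF \<open>w \<in> V\<close>] that by simp
    moreover have "finite {k. ?g k \<noteq> 0}" by (rule finite_subset[OF _ fin]) auto
    ultimately have "?g \<in> ?P" by blast
    moreover have "?S ?g = v + w"
    proof -
      have "?S ?g = (\<Sum>k\<in>?T. ?g k)" by (rule S_superset[OF fin]) auto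
      also have "\<dots> = (\<Sum>k\<in>?T. F v k) + (\<Sum>k\<in>?T. F w k)" by (rule sum.distrib)
      also have "\<dots> = ?S (F v) + ?S (F w)"
        using S_superset[OF fin, of "F v"] S_superset[OF fin, of "F w"] by simp
      finally show ?thesis using F(2) that by simp
    qed
    ultimately have "F (v + w) = ?g" by (rule Fu)
    then show ?thesis by simp
  qed
  have Fmul: "F (d \<cdot> v) k = d \<cdot> F v k" if "d \<in> C" "v \<in> V" for d v k
  proof -
    let ?g = "\<lambda>k. d \<cdot> F v k"
    have fin: "finite {k. F v k \<noteq> 0}" using F(1)[OF that(2)] by blast
    have "?g k \<in> (\<lambda>d. d \<cdot> p k) ` C" if "k \<in> K" for k
      using \<phi>[OF \<open>v \<in> V\<close> that] C_mul \<open>d \<in> C\<close>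
      by (intro image_eqI[of _ _ "d \<cdot> \<phi> k v"]) (auto simp: mul_assoc)
    moreover have "?g k = 0" if "k \<notin> K" for k using F(1)[OF \<open>v \<in> V\<close>] that by simp
    moreover have "finite {k. ?g k \<noteq> 0}" by (rule finite_subset[OF _ fin]) auto
    ultimately have "?g \<in> ?P" by blast
    moreover have "?S ?g = d \<cdot> v"
    proof -
      have "?S ?g = (\<Sum>k | F v k \<noteq> 0. ?g k)" by (rule S_superset[OF fin]) auto
      also have "\<dots> = d \<cdot> v" using F(2)[OF that(2)] by (simp flip: mul_sum_right)
      finally show ?thesis .
    qed
    ultimately have "F (d \<cdot> v) = ?g" by (rule Fu)
    then show ?thesis by simp
  qed
  have supp: "{k \<in> K. \<phi> k v \<noteq> 0} = {k. F v k \<noteq> 0}" if "v \<in> V" for v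
  proof -
    have "k \<in> K" if "F v k \<noteq> 0" for k using F(1)[OF \<open>v \<in> V\<close>] that by blast
    moreover have "F v k \<noteq> 0 \<longleftrightarrow> \<phi> k v \<noteq> 0" if "k \<in> K" for k
      using \<phi>[OF \<open>v \<in> V\<close> that] ann[OF that] by (metis mul_zero(1))
    ultimately show ?thesis by blast
  qed
  have "dual_basis V K f p \<phi>"
    unfolding dual_basis_def
  proof (intro conjI ballI)
    fix k assume k: "k \<in> K"
    show "p k \<in> V" "f k \<cdot> p k = p k" using p k by auto
    show "functional V (f k) (\<phi> k)"
      unfolding functional_def
    proof (intro conjI ballI)
      fix v w assume v: "v \<in> V" and w: "w \<in> V"
      show "\<phi> k v \<in> C" "\<phi> k v \<cdot> f k = \<phi> k v" using \<phi>[OF v k] by auto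
      show "\<phi> k (v + w) = \<phi> k v + \<phi> k w"
        using v w \<phi>[OF v k] \<phi>[OF w k] submoduleD(4)[OF V] C_add Fadd
        by (intro \<phi>u[OF _ k]) (auto simp: mul_add_left)
    next
      fix d v assume d: "d \<in> C" and v: "v \<in> V"
      show "\<phi> k (d \<cdot> v) = d \<cdot> \<phi> k v"
        using v d \<phi>[OF v k] submoduleD(3)[OF V] C_mul Fmul
        by (intro \<phi>u[OF _ k]) (auto simp: mul_assoc)
    qed
  next
    fix v assume v: "v \<in> V"
    show "finite {k \<in> K. \<phi> k v \<noteq> 0}" unfolding supp[OF v] using F(1)[OF v] by blast
    have "(\<Sum>k | k \<in> K \<and> \<phi> k v \<noteq> 0. \<phi> k v \<cdot> p k) = ?S (F v)"
      by (rule sum.cong[OF supp[OF v]]) (use supp[OF v] \<phi>(3)[OF v] in force)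
    then show "v = (\<Sum>k | k \<in> K \<and> \<phi> k v \<noteq> 0. \<phi> k v \<cdot> p k)" using F(2)[OF v] by simp
  qed
  moreover have "orthonormal K f p \<phi>"
    unfolding orthonormal_def
  proof (intro ballI)
    fix k l assume k: "k \<in> K" and l: "l \<in> K"
    let ?g = "\<lambda>m. if m = l then p l else 0"
    have pl: "p l \<in> (\<lambda>d. d \<cdot> p l) ` C" using p(2)[OF l] f(1)[OF l] by force
    have z: "0 \<in> (\<lambda>d. d \<cdot> p m) ` C" for m using C_zero by force
    have sub: "{m. ?g m \<noteq> 0} \<subseteq> {l}" by auto
    have "?g \<in> ?P" using pl z l finite_subset[OF sub] by auto
    moreover have "?S ?g = p l" using S_superset[OF _ sub] by simp
    ultimately have "F (p l) = ?g" by (rule Fu)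
    then show "\<phi> k (p l) = (if k = l then f k else 0)"
      using f[OF k] p k l C_zero by (intro \<phi>u) auto
  qed
  ultimately show ?thesis by blast
qed

text \<open>Indexing an orthonormal dual basis by its own elements, sorted by their idempotents.\<close>

lemma orthonormal_dual_basis_by_elements:
  assumes db: "dual_basis V K (e \<circ> b) p \<phi>" and on: "orthonormal K (e \<circ> b) p \<phi>"
    and nz: "\<And>k. k \<in> K \<Longrightarrow> b k \<in> B \<and> e (b k) \<noteq> 0"
    and Z: "\<And>a. Z a = p ` {k \<in> K. b k = a}"
  shows "\<exists>\<psi>. dual_basis V (Sigma B Z) (e \<circ> fst) snd \<psi> \<and> orthonormal (Sigma B Z) (e \<circ> fst) snd \<psi>"
proof -
  define g where "g k = (b k, p k)" for k
  have T: "Sigma B Z = g ` K" using nz by (auto simp: Z g_def)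
  have inj: "inj_on g K"
  proof (rule inj_onI)
    fix k l assume kl: "k \<in> K" "l \<in> K" and "g k = g l"
    then have "p k = p l" by (simp add: g_def)
    moreover have "\<phi> k (p l) = (if k = l then e (b k) else 0)" "\<phi> k (p k) = e (b k)"
      using on kl by (auto simp: orthonormal_def)
    ultimately show "k = l" using nz[OF kl(1)] by metis
  qed
  have h: "bij_betw (inv_into K g) (Sigma B Z) K"
    unfolding T by (rule bij_betw_inv_into) (simp add: inj bij_betw_def)
  have gh: "g (inv_into K g t) = t" if "t \<in> Sigma B Z" for t
    using that f_inv_into_f[of t g K] unfolding T by blast
  have eq: "(e \<circ> fst) t = (e \<circ> b) (inv_into K g t)" "snd t = p (inv_into K g t)"
    if "t \<in> Sigma B Z" for t
    using gh[OF that] by (metis comp_apply fst_conv g_def, metis snd_conv g_def)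
  show ?thesis
    using dual_basis_reindex[OF db h, where f' = "e \<circ> fst" and p' = snd, OF eq] on by blast
qed

end

section \<open>Dual bases of projective modules\<close>

context subring_mult
begin

text \<open>
  Lifting \<open>\<theta>\<close> along the surjection \<open>\<Oplus>\<^sub>k C f k \<rightarrow> V\<close> given by the generators \<open>k \<in> K\<close> of \<open>V\<close>. The free
  module is realised by functions supported on \<open>K\<close>, and \<open>V\<close> by constant functions.
\<close>

lemma projective_dual_basis:
  assumes proj: "projective mul C mul P" and V: "is_module mul C mul V" "V \<subseteq> P"
    and \<theta>: "\<And>u. u \<in> P \<Longrightarrow> \<theta> u \<in> V" "\<And>v. v \<in> V \<Longrightarrow> \<theta> v = v"
      "\<And>u w. u \<in> P \<Longrightarrow> w \<in> P \<Longrightarrow> \<theta> (u + w) = \<theta> u + \<theta> w"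
      "\<And>d u. d \<in> C \<Longrightarrow> u \<in> P \<Longrightarrow> \<theta> (d \<cdot> u) = d \<cdot> \<theta> u"
    and K: "finite K" "K \<subseteq> V" "\<And>k. k \<in> K \<Longrightarrow> f k \<in> C \<and> f k \<cdot> f k = f k \<and> f k \<cdot> k = k"
    and gen: "\<And>v. v \<in> V \<Longrightarrow> \<exists>x. (\<forall>k\<in>K. x k \<in> C) \<and> v = (\<Sum>k\<in>K. x k \<cdot> k)"
    and unit: "\<And>S. finite S \<Longrightarrow> S \<subseteq> C \<Longrightarrow> \<exists>d\<in>C. \<forall>x\<in>S. d \<cdot> x = x"
  shows "\<exists>\<phi>. dual_basis V K f (\<lambda>k. k) \<phi>"
proof -
  define M where "M = {g. (\<forall>k\<in>K. g k \<in> C \<and> g k \<cdot> f k = g k) \<and> (\<forall>k. k \<notin> K \<longrightarrow> g k = 0)}"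
  define N where "N = {g. \<exists>v\<in>V. g = (\<lambda>_::'a. v)}"
  define act where "act d g = (\<lambda>k::'a. d \<cdot> (g k :: 'a))" for d g
  define F where "F g = (\<lambda>_::'a. \<Sum>k\<in>K. g k \<cdot> k)" for g
  define G where "G u = (\<lambda>_::'a. \<theta> u)" for u
  have sub: "submodule V" using V(1) by (simp add: is_module_def submodule_def)
  note VD = submoduleD[OF sub]
  have "is_module mul C act M"
    unfolding is_module_def
  proof (intro conjI ballI)
    fix m assume m: "m \<in> M"
    obtain d where d: "d \<in> C" "\<forall>x\<in>m ` K. d \<cdot> x = x"
      using unit[of "m ` K"] K(1) m by (auto simp: M_def)
    then have "act d m = m" using m by (auto simp: act_def M_def fun_eq_iff)
    then show "\<exists>d\<in>C. act d m = m" using d by blast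
  qed (auto simp: M_def act_def C_zero C_minus C_mul mul_minus_left mul_assoc mul_add_left
      mul_add_right)
  moreover have "is_module mul C act N"
    unfolding is_module_def
  proof (intro conjI ballI)
    show "0 \<in> N" using VD(1) by (auto simp: N_def zero_fun_def)
  next
    fix m n assume "m \<in> N" "n \<in> N"
    then show "m - n \<in> N" using VD(2) by (auto simp: N_def fun_diff_def)
  next
    fix m assume "m \<in> N"
    then obtain v where v: "v \<in> V" "m = (\<lambda>_. v)" by (auto simp: N_def)
    then obtain d where "d \<in> C" "d \<cdot> v = v" using V(1) unfolding is_module_def by blast
    then show "\<exists>d\<in>C. act d m = m" using v by (auto simp: act_def)
  qed (use VD in \<open>auto simp: N_def act_def mul_add_left mul_add_right mul_assoc fun_eq_iff\<close>)
  moreover have "is_module_hom C act M act N F"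
    unfolding is_module_hom_def
  proof (intro conjI ballI)
    have "(\<Sum>k\<in>K. g k \<cdot> k) \<in> V" if "g \<in> M" for g
      using that K(2) VD(3) by (intro submodule_sum[OF sub]) (auto simp: M_def)
    then show "F \<in> M \<rightarrow> N" by (auto simp: F_def N_def)
  qed (simp_all add: F_def act_def mul_add_left sum.distrib mul_sum_right mul_assoc fun_eq_iff)
  moreover have "F ` M = N"
  proof
    show "F ` M \<subseteq> N" using calculation(3) by (auto simp: is_module_hom_def)
    show "N \<subseteq> F ` M"
    proof
      fix n assume "n \<in> N"
      then obtain v where v: "v \<in> V" "n = (\<lambda>_. v)" by (auto simp: N_def)
      obtain x where x: "\<forall>k\<in>K. x k \<in> C" "v = (\<Sum>k\<in>K. x k \<cdot> k)" using gen[OF v(1)] by blast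
      define g where "g k = (if k \<in> K then x k \<cdot> f k else 0)" for k
      have "g \<in> M" using x(1) K(3) C_mul by (auto simp: M_def g_def mul_assoc)
      moreover have "F g = n"
      proof -
        have "(\<Sum>k\<in>K. g k \<cdot> k) = (\<Sum>k\<in>K. x k \<cdot> k)"
          by (intro sum.cong) (auto simp: g_def mul_assoc K(3))
        then show ?thesis by (simp add: F_def v x(2))
      qed
      ultimately show "n \<in> F ` M" by blast
    qed
  qed
  moreover have "is_module_hom C mul P act N G"
    unfolding is_module_hom_def
    using \<theta> by (auto simp: G_def N_def act_def fun_eq_iff)
  ultimately obtain h where h: "is_module_hom C mul P act M h" "\<forall>u\<in>P. F (h u) = G u"
    using proj unfolding projective_def by blast
  define \<phi> where "\<phi> k v = h v k" for k v
  have "dual_basis V K f (\<lambda>k. k) \<phi>"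
    unfolding dual_basis_finite_iff[OF K(1)]
  proof (intro conjI ballI)
    fix k assume k: "k \<in> K"
    show "k \<in> V" "f k \<cdot> k = k" using k K by auto
    show "functional V (f k) (\<phi> k)"
      unfolding functional_def
    proof (intro conjI ballI)
      fix v w assume v: "v \<in> V" and w: "w \<in> V"
      have "h v \<in> M" using h(1) v V(2) by (auto simp: is_module_hom_def)
      then show "\<phi> k v \<in> C" "\<phi> k v \<cdot> f k = \<phi> k v" using k by (auto simp: \<phi>_def M_def)
      have "h (v + w) = h v + h w" using h(1) v w V(2) unfolding is_module_hom_def by blast
      then show "\<phi> k (v + w) = \<phi> k v + \<phi> k w" by (simp add: \<phi>_def)
    next
      fix d v assume d: "d \<in> C" and v: "v \<in> V"
      have "h (d \<cdot> v) = act d (h v)" using h(1) d v V(2) unfolding is_module_hom_def by blast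
      then show "\<phi> k (d \<cdot> v) = d \<cdot> \<phi> k v" by (simp add: \<phi>_def act_def)
    qed
  next
    fix v assume v: "v \<in> V"
    have "F (h v) = G v" using h(2) v V(2) by auto
    from fun_cong[OF this, of 0] show "v = (\<Sum>k\<in>K. \<phi> k v \<cdot> k)"
      using \<theta>(2)[OF v] by (simp add: F_def G_def \<phi>_def)
  qed
  then show ?thesis by blast
qed

text \<open>
  \<open>f\<close> factors through the idempotent \<open>e b\<close> for some \<open>b \<in> B\<close>; for primitive \<open>f\<close>, conjugacy to
  \<open>e b\<close> provides this.
\<close>

definition factors_through :: "('b \<Rightarrow> 'a) \<Rightarrow> 'b set \<Rightarrow> 'a \<Rightarrow> bool" where
  "factors_through e B f \<longleftrightarrow>
     (\<exists>b\<in>B. \<exists>x\<in>C. \<exists>y\<in>C. f = x \<cdot> y \<and> x \<cdot> e b = x \<and> e b \<cdot> y = y)"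

end

text \<open>The same with scalars, which enter only through finite dimension.\<close>

locale algebra_mult = subring_mult mul C + vector_space s
  for mul :: "'a::ring \<Rightarrow> 'a \<Rightarrow> 'a" (infixl \<open>\<cdot>\<close> 70) and C
    and s :: "'k::field \<Rightarrow> 'a \<Rightarrow> 'a" +
  assumes mul_scale_left: "s c x \<cdot> y = s c (x \<cdot> y)"
    and C_scale: "x \<in> C \<Longrightarrow> s c x \<in> C"
begin

text \<open>
  A finite-dimensional module has finitely many generators \<open>k \<in> e b V\<close> with \<open>b \<in> B\<close>: if \<open>f = x \<cdot> y\<close>
  factors through \<open>e b\<close>, then \<open>f \<cdot> v = x \<cdot> (y \<cdot> v)\<close> with \<open>y \<cdot> v \<in> e b V\<close>.
\<close>

lemma finite_generators:
  assumes V: "submodule V" "subspace V" and fd: "fin_dim s V"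
    and e: "\<And>b. b \<in> B \<Longrightarrow> e b \<in> C \<and> e b \<cdot> e b = e b"
    and cover: "\<And>v. v \<in> V \<Longrightarrow> \<exists>F. finite F \<and> (\<forall>f\<in>F. factors_through e B f) \<and> \<Sum>F \<cdot> v = v"
  shows "\<exists>K b. finite K \<and> K \<subseteq> V \<and> (\<forall>k\<in>K. b k \<in> B \<and> e (b k) \<cdot> k = k) \<and>
    (\<forall>v\<in>V. \<exists>x. (\<forall>k\<in>K. x k \<in> C) \<and> v = (\<Sum>k\<in>K. x k \<cdot> k))"
proof -
  obtain S where S: "S \<subseteq> V" "independent S" "V \<subseteq> span S"
    using maximal_independent_subset[of V] by blast
  have "finite S"
  proof -
    obtain T where "finite T" "V \<subseteq> span T" using fd by (auto simp: fin_dim_def)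
    then show ?thesis using independent_span_bound[OF _ S(2)] S(1) by blast
  qed
  have "\<forall>v\<in>S. \<exists>F. finite F \<and> (\<forall>f\<in>F. factors_through e B f) \<and> \<Sum>F \<cdot> v = v"
    using cover S(1) by blast
  then obtain F where F: "\<And>v. v \<in> S \<Longrightarrow> finite (F v)"
    "\<And>v f. v \<in> S \<Longrightarrow> f \<in> F v \<Longrightarrow> factors_through e B f" "\<And>v. v \<in> S \<Longrightarrow> \<Sum>(F v) \<cdot> v = v"
    by metis
  define Q where "Q f b x y \<longleftrightarrow>
    b \<in> B \<and> x \<in> C \<and> y \<in> C \<and> f = x \<cdot> y \<and> x \<cdot> e b = x \<and> e b \<cdot> y = y" for f b x y
  have "\<exists>b x y. Q f b x y" if "factors_through e B f" for f
    using that unfolding factors_through_def Q_def by blast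
  then obtain bb x y where Q: "\<And>f. factors_through e B f \<Longrightarrow> Q f (bb f) (x f) (y f)"
    by metis
  have bxy: "bb f \<in> B" "x f \<in> C" "y f \<in> C" "x f \<cdot> y f = f" "e (bb f) \<cdot> y f = y f"
    if "factors_through e B f" for f
    using Q[OF that] unfolding Q_def by metis+
  define K where "K = (\<Union>v\<in>S. (\<lambda>f. y f \<cdot> v) ` F v)"
  have K: "finite K" using \<open>finite S\<close> F(1) by (auto simp: K_def)
  have KV: "K \<subseteq> V"
    unfolding K_def using S(1) by (auto intro!: submoduleD(3)[OF V(1)] bxy(3) F(2))
  have "\<exists>b\<in>B. e b \<cdot> k = k" if k: "k \<in> K" for k
  proof -
    obtain v f where vf: "v \<in> S" "f \<in> F v" "k = y f \<cdot> v" using k by (auto simp: K_def)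
    note fac = F(2)[OF vf(1,2)]
    have "e (bb f) \<cdot> k = k" using bxy(5)[OF fac] by (simp add: vf(3) flip: mul_assoc)
    then show ?thesis using bxy(1)[OF fac] by blast
  qed
  then obtain b where b: "\<And>k. k \<in> K \<Longrightarrow> b k \<in> B \<and> e (b k) \<cdot> k = k" by metis
  define G where "G = {v. \<exists>x. (\<forall>k\<in>K. x k \<in> C) \<and> v = (\<Sum>k\<in>K. x k \<cdot> k)}"
  have GI: "d \<cdot> k \<in> G" if "d \<in> C" "k \<in> K" for d k
  proof -
    have "(\<Sum>l\<in>K. (if l = k then d else 0) \<cdot> l) = (\<Sum>l\<in>K. if l = k then d \<cdot> k else 0)"
      by (intro sum.cong) auto
    then have "d \<cdot> k = (\<Sum>l\<in>K. (if l = k then d else 0) \<cdot> l)" using K that by simp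
    then show ?thesis
      unfolding G_def using that C_zero by (intro CollectI exI[of _ "\<lambda>l. if l = k then d else 0"]) simp
  qed
  have G: "subspace G"
    unfolding subspace_def
  proof (intro conjI ballI allI)
    show "0 \<in> G" unfolding G_def using C_zero by (intro CollectI exI[of _ "\<lambda>_. 0"]) simp
  next
    fix v w assume "v \<in> G" "w \<in> G"
    then obtain x y where "\<forall>k\<in>K. x k \<in> C" "v = (\<Sum>k\<in>K. x k \<cdot> k)" "\<forall>k\<in>K. y k \<in> C"
      "w = (\<Sum>k\<in>K. y k \<cdot> k)" by (auto simp: G_def)
    then show "v + w \<in> G"
      unfolding G_def using C_add
      by (intro CollectI exI[of _ "\<lambda>k. x k + y k"]) (simp add: mul_add_left sum.distrib)
  next
    fix c v assume "v \<in> G"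
    then obtain x where "\<forall>k\<in>K. x k \<in> C" "v = (\<Sum>k\<in>K. x k \<cdot> k)" by (auto simp: G_def)
    then show "s c v \<in> G"
      unfolding G_def using C_scale
      by (intro CollectI exI[of _ "\<lambda>k. s c (x k)"]) (simp add: mul_scale_left scale_sum_right)
  qed
  have "v \<in> G" if v: "v \<in> S" for v
  proof -
    have "v = (\<Sum>f\<in>F v. f \<cdot> v)" using F(3)[OF v] by (simp add: mul_sum_left)
    also have "\<dots> = (\<Sum>f\<in>F v. x f \<cdot> (y f \<cdot> v))"
      using bxy(4) F(2)[OF v] by (intro sum.cong) (simp_all flip: mul_assoc)
    also have "\<dots> \<in> G"
      using GI bxy(2) F(2)[OF v] v by (intro subspace_sum[OF G]) (auto simp: K_def)
    finally show ?thesis .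
  qed
  then have "V \<subseteq> G" using S(3) span_minimal[OF _ G, of S] by blast
  then have "\<forall>v\<in>V. \<exists>x. (\<forall>k\<in>K. x k \<in> C) \<and> v = (\<Sum>k\<in>K. x k \<cdot> k)"
    unfolding G_def by blast
  moreover have "\<forall>k\<in>K. b k \<in> B \<and> e (b k) \<cdot> k = k" using b by simp
  ultimately show ?thesis by (intro exI[of _ K] exI[of _ b] conjI K KV)
qed

text \<open>
  If \<open>C\<close> has enough idempotents that factor through the local idempotents \<open>e b\<close>, then every
  finite-dimensional direct summand \<open>V\<close> of a projective module \<open>P\<close>, with projection \<open>\<theta>\<close>, is free on
  generators with idempotents \<open>e b\<close>.
\<close>

theorem projective_orthonormal_dual_basis:
  assumes proj: "projective mul C mul P"
    and V: "is_module mul C mul V" "V \<subseteq> P" "subspace V" and fd: "fin_dim s V"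
    and \<theta>: "\<And>u. u \<in> P \<Longrightarrow> \<theta> u \<in> V" "\<And>v. v \<in> V \<Longrightarrow> \<theta> v = v"
      "\<And>u w. u \<in> P \<Longrightarrow> w \<in> P \<Longrightarrow> \<theta> (u + w) = \<theta> u + \<theta> w"
      "\<And>d u. d \<in> C \<Longrightarrow> u \<in> P \<Longrightarrow> \<theta> (d \<cdot> u) = d \<cdot> \<theta> u"
    and unit: "\<And>S. finite S \<Longrightarrow> S \<subseteq> C \<Longrightarrow> \<exists>d\<in>C. \<forall>x\<in>S. d \<cdot> x = x"
    and loc: "\<And>b. b \<in> B \<Longrightarrow> local_idempotent (e b)"
    and cover: "\<And>v. v \<in> V \<Longrightarrow> \<exists>F. finite F \<and> (\<forall>f\<in>F. factors_through e B f) \<and> \<Sum>F \<cdot> v = v"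
  shows "\<exists>K b p \<phi>. finite (K :: 'a set) \<and> b ` K \<subseteq> B \<and>
    dual_basis V K (e \<circ> b) p \<phi> \<and> orthonormal K (e \<circ> b) p \<phi>"
proof -
  have sub: "submodule V" using V(1) by (simp add: is_module_def submodule_def)
  have e: "e b \<in> C \<and> e b \<cdot> e b = e b" if "b \<in> B" for b
    using loc[OF that] by (simp add: local_idempotent_def)
  have "\<exists>K b. finite K \<and> K \<subseteq> V \<and> (\<forall>k\<in>K. b k \<in> B \<and> e (b k) \<cdot> k = k) \<and>
    (\<forall>v\<in>V. \<exists>x. (\<forall>k\<in>K. x k \<in> C) \<and> v = (\<Sum>k\<in>K. x k \<cdot> k))"
    by (rule finite_generators[OF sub V(3) fd]) (fact e, fact cover)
  then obtain K b where K': "finite K" "K \<subseteq> V" "\<forall>k\<in>K. b k \<in> B \<and> e (b k) \<cdot> k = k"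
    and gen': "\<forall>v\<in>V. \<exists>x. (\<forall>k\<in>K. x k \<in> C) \<and> v = (\<Sum>k\<in>K. x k \<cdot> k)"
    by (elim exE conjE) (rule that)
  note K = K'(1,2) bspec[OF K'(3)] and gen = bspec[OF gen']
  have "\<exists>\<phi>. dual_basis V K (e \<circ> b) (\<lambda>k. k) \<phi>"

  proof (rule projective_dual_basis[OF proj V(1,2), of \<theta>])
    show "(e \<circ> b) k \<in> C \<and> (e \<circ> b) k \<cdot> (e \<circ> b) k = (e \<circ> b) k \<and> (e \<circ> b) k \<cdot> k = k" if "k \<in> K" for k
      using K(3)[OF that] e by simp
  qed (fact \<theta> K(1,2) gen unit)+
  then obtain \<phi> where db: "dual_basis V K (e \<circ> b) (\<lambda>k. k) \<phi>" by blast
  have "local_idempotent ((e \<circ> b) k)" if "k \<in> K" for k using K(3) loc that by simp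
  from orthonormal_dual_basis_exists[OF K(1) sub db this]
  obtain K' p' \<phi>' where K': "K' \<subseteq> K" and db': "dual_basis V K' (e \<circ> b) p' \<phi>'"
    and on: "orthonormal K' (e \<circ> b) p' \<phi>'"
    by blast
  have fin: "finite K'" by (rule finite_subset[OF K' K(1)])
  have sub: "b ` K' \<subseteq> B" using K' K(3) by blast
  show ?thesis
    by (rule exI[of _ K'], rule exI[of _ b], rule exI[of _ p'], rule exI[of _ \<phi>'])
      (intro conjI fin sub db' on)
qed

end

section \<open>The universal property of the triangular decomposition\<close>

context k_algebra
begin

lemma free_scale_lookup: "Poly_Mapping.lookup (free_scale c f) x = c * Poly_Mapping.lookup f x"
  by (simp add: free_scale_def Poly_Mapping.map.rep_eq when_def)

lemma vector_space_free_scale: "vector_space (free_scale :: 'k \<Rightarrow> ('b \<Rightarrow>\<^sub>0 'k) \<Rightarrow> ('b \<Rightarrow>\<^sub>0 'k))"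
  by unfold_locales
    (auto intro!: poly_mapping_eqI simp: free_scale_lookup lookup_add algebra_simps)

text \<open>The linear map on the free vector space with prescribed values on the basis.\<close>

definition free_lift :: "('b \<Rightarrow> 'a) \<Rightarrow> ('b \<Rightarrow>\<^sub>0 'k) \<Rightarrow> 'a" where
  "free_lift \<beta> t = (\<Sum>p\<in>Poly_Mapping.keys t. s (Poly_Mapping.lookup t p) (\<beta> p))"

lemma free_lift_superset:
  assumes "finite S" "Poly_Mapping.keys t \<subseteq> S"
  shows "free_lift \<beta> t = (\<Sum>p\<in>S. s (Poly_Mapping.lookup t p) (\<beta> p))"
  unfolding free_lift_def using assms
  by (intro sum.mono_neutral_left) (auto simp: in_keys_iff)

lemma free_lift_add: "free_lift \<beta> (t + t') = free_lift \<beta> t + free_lift \<beta> t'"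
proof -
  let ?S = "Poly_Mapping.keys t \<union> Poly_Mapping.keys t'"
  have "finite ?S" "Poly_Mapping.keys (t + t') \<subseteq> ?S" by (auto simp: Poly_Mapping.keys_add)
  then show ?thesis
    using free_lift_superset[of ?S t] free_lift_superset[of ?S t'] free_lift_superset[of ?S "t + t'"]
    by (simp add: lookup_add scale_left_distrib sum.distrib)
qed

lemma free_lift_scale: "free_lift \<beta> (free_scale c t) = s c (free_lift \<beta> t)"
proof -
  have "Poly_Mapping.keys (free_scale c t) \<subseteq> Poly_Mapping.keys t"
    by (auto simp: in_keys_iff free_scale_lookup)
  then have "free_lift \<beta> (free_scale c t) =
      (\<Sum>p\<in>Poly_Mapping.keys t. s (Poly_Mapping.lookup (free_scale c t) p) (\<beta> p))"
    by (intro free_lift_superset) auto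
  then show ?thesis by (simp add: free_scale_lookup free_lift_def scale_sum_right)
qed

lemma free_lift_zero: "free_lift \<beta> 0 = 0"
  by (simp add: free_lift_def)

lemma free_lift_diff: "free_lift \<beta> (t - t') = free_lift \<beta> t - free_lift \<beta> t'"
  using free_lift_add[of \<beta> "t - t'" t'] by (simp add: algebra_simps)

lemma free_lift_single: "free_lift \<beta> (Poly_Mapping.single p 1) = \<beta> p"
  by (simp add: free_lift_def)

lemma mult_free_eq: "mult_free s t = free_lift (\<lambda>(x, y). x * y) t"
  by (simp add: mult_free_def free_lift_def case_prod_unfold)

text \<open>Bilinear maps \<open>P \<times> Q \<rightarrow> A\<close> that are balanced over \<open>D\<close>.\<close>

definition balanced :: "'a set \<Rightarrow> 'a set \<Rightarrow> 'a set \<Rightarrow> ('a \<Rightarrow> 'a \<Rightarrow> 'a) \<Rightarrow> bool" where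
  "balanced D P Q \<beta> \<longleftrightarrow>
     (\<forall>x\<in>P. \<forall>x'\<in>P. \<forall>y\<in>Q. \<beta> (x + x') y = \<beta> x y + \<beta> x' y) \<and>
     (\<forall>x\<in>P. \<forall>y\<in>Q. \<forall>y'\<in>Q. \<beta> x (y + y') = \<beta> x y + \<beta> x y') \<and>
     (\<forall>c. \<forall>x\<in>P. \<forall>y\<in>Q. \<beta> (s c x) y = s c (\<beta> x y)) \<and>
     (\<forall>c. \<forall>x\<in>P. \<forall>y\<in>Q. \<beta> x (s c y) = s c (\<beta> x y)) \<and>
     (\<forall>x\<in>P. \<forall>d\<in>D. \<forall>y\<in>Q. \<beta> (x * d) y = \<beta> x (d * y))"

lemma free_lift_relations:
  assumes "balanced D P Q \<beta>" "t \<in> module.span free_scale (tensor_relations s D P Q)"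
  shows "free_lift (\<lambda>(x, y). \<beta> x y) t = 0"
proof -
  interpret F: vector_space "free_scale :: 'k \<Rightarrow> ('a \<times> 'a \<Rightarrow>\<^sub>0 'k) \<Rightarrow> _"
    by (rule vector_space_free_scale)
  let ?L = "free_lift (\<lambda>(x, y). \<beta> x y)"
  have "F.subspace {t. ?L t = 0}"
    by (simp add: F.subspace_def free_lift_add free_lift_scale free_lift_zero)
  moreover have "tensor_relations s D P Q \<subseteq> {t. ?L t = 0}"
    using assms(1)
    by (auto simp: tensor_relations_def Let_def balanced_def free_lift_diff free_lift_scale
        free_lift_single)
  ultimately have "F.span (tensor_relations s D P Q) \<subseteq> {t. ?L t = 0}" by (intro F.span_minimal)
  then show ?thesis using assms(2) by blast
qed

lemma balanced_mult: "balanced D P Q (*)"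
  by (simp add: balanced_def distrib_left distrib_right scale_mult mult.assoc)

text \<open>
  Bijectivity of the induced map \<open>P \<otimes>\<^sub>D Q \<rightarrow> A\<close> in terms of representatives in the free vector space.
\<close>

lemma tensor_iso_consequences:
  assumes bij: "bij_betw (mult_tensor s) (tensor_product s D P Q) UNIV"
  shows "\<exists>t. Poly_Mapping.keys t \<subseteq> P \<times> Q \<and> mult_free s t = x"
    and "\<lbrakk>Poly_Mapping.keys t \<subseteq> P \<times> Q; Poly_Mapping.keys t' \<subseteq> P \<times> Q; mult_free s t = mult_free s t'\<rbrakk>
      \<Longrightarrow> t' - t \<in> module.span free_scale (tensor_relations s D P Q)"
proof -
  interpret F: vector_space "free_scale :: 'k \<Rightarrow> ('a \<times> 'a \<Rightarrow>\<^sub>0 'k) \<Rightarrow> _"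
    by (rule vector_space_free_scale)
  define A where "A = {t. Poly_Mapping.keys t \<subseteq> P \<times> Q}" for t :: "'a \<times> 'a \<Rightarrow>\<^sub>0 'k"
  let ?A = "{t :: 'a \<times> 'a \<Rightarrow>\<^sub>0 'k. Poly_Mapping.keys t \<subseteq> P \<times> Q}"
  let ?R = "{(t, t'). Poly_Mapping.keys t \<subseteq> P \<times> Q \<and> Poly_Mapping.keys t' \<subseteq> P \<times> Q \<and>
               t' - t \<in> F.span (tensor_relations s D P Q)}"
  have val: "mult_tensor s (?R `` {t}) = mult_free s t" and cls: "?R `` {t} \<in> ?A // ?R"
    if t: "t \<in> ?A" for t
  proof -
    have "t \<in> ?R `` {t}" using t by (simp add: F.span_zero)
    moreover have "mult_free s t' = mult_free s t" if "t' \<in> ?R `` {t}" for t'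
      using free_lift_relations[OF balanced_mult, of "t' - t" D P Q] that
      by (simp add: mult_free_eq free_lift_diff)
    ultimately have "mult_free s ` (?R `` {t}) = {mult_free s t}" by blast
    then show "mult_tensor s (?R `` {t}) = mult_free s t" by (simp add: mult_tensor_def)
    show "?R `` {t} \<in> ?A // ?R" using t by (rule quotientI)
  qed
  have "x \<in> mult_tensor s ` (?A // ?R)"
    using bij by (simp add: bij_betw_def tensor_product_def)
  then obtain T where T: "T \<in> ?A // ?R" "x = mult_tensor s T" by blast
  then obtain t0 where "t0 \<in> ?A" "T = ?R `` {t0}" by (auto elim: quotientE)
  then show "\<exists>t. Poly_Mapping.keys t \<subseteq> P \<times> Q \<and> mult_free s t = x" using val T by auto
  assume t: "Poly_Mapping.keys t \<subseteq> P \<times> Q" and t': "Poly_Mapping.keys t' \<subseteq> P \<times> Q"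
    and eq: "mult_free s t = mult_free s t'"
  have "?R `` {t} = ?R `` {t'}"
    using bij cls[of t] cls[of t'] val[of t] val[of t'] t t' eq
    by (auto simp: bij_betw_def tensor_product_def inj_on_def)
  moreover have "t' \<in> ?R `` {t'}" using t' by (simp add: F.span_zero)
  ultimately have "t' \<in> ?R `` {t}" by simp
  then show "t' - t \<in> F.span (tensor_relations s D P Q)" by simp
qed

text \<open>If \<open>P \<otimes>\<^sub>D Q \<cong> A\<close> by multiplication, then balanced maps on \<open>P \<times> Q\<close> extend to \<open>A\<close>.\<close>

lemma tensor_iso_universal:
  assumes bij: "bij_betw (mult_tensor s) (tensor_product s D P Q) UNIV"
    and bal: "balanced D P Q \<beta>"
  obtains G where "\<And>x y. G (x + y) = G x + G y" "\<And>c x. G (s c x) = s c (G x)"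
    "\<And>x y. x \<in> P \<Longrightarrow> y \<in> Q \<Longrightarrow> G (x * y) = \<beta> x y"
proof -
  let ?L = "free_lift (\<lambda>(x, y). \<beta> x y)"
  obtain \<tau> where \<tau>: "\<And>x. Poly_Mapping.keys (\<tau> x) \<subseteq> P \<times> Q" "\<And>x. mult_free s (\<tau> x) = x"
    using tensor_iso_consequences(1)[OF bij] by metis
  define G where "G x = ?L (\<tau> x)" for x
  have G: "G (mult_free s t) = ?L t" if "Poly_Mapping.keys t \<subseteq> P \<times> Q" for t
  proof -
    have "t - \<tau> (mult_free s t) \<in> module.span free_scale (tensor_relations s D P Q)"
      using tensor_iso_consequences(2)[OF bij \<tau>(1) that] \<tau>(2) by simp
    from free_lift_relations[OF bal this] show ?thesis by (simp add: G_def free_lift_diff)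
  qed
  show thesis
  proof (rule that[of G])
    fix x y
    have "Poly_Mapping.keys (\<tau> x + \<tau> y) \<subseteq> P \<times> Q"
      using Poly_Mapping.keys_add[of "\<tau> x" "\<tau> y"] \<tau>(1)[of x] \<tau>(1)[of y] by blast
    from G[OF this] show "G (x + y) = G x + G y"
      by (simp add: mult_free_eq free_lift_add) (simp add: G_def \<tau>(2) flip: mult_free_eq)
  next
    fix c x
    have "Poly_Mapping.keys (free_scale c (\<tau> x)) \<subseteq> P \<times> Q"
      using \<tau>(1)[of x] by (auto simp: in_keys_iff free_scale_lookup)
    from G[OF this] show "G (s c x) = s c (G x)"
      by (simp add: mult_free_eq free_lift_scale) (simp add: G_def \<tau>(2) flip: mult_free_eq)
  next
    fix x y assume "x \<in> P" "y \<in> Q"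
    then have "Poly_Mapping.keys (Poly_Mapping.single (x, y) (1::'k)) \<subseteq> P \<times> Q" by simp
    from G[OF this] show "G (x * y) = \<beta> x y" by (simp add: mult_free_eq free_lift_single)
  qed
qed

lemma tensor_iso_span:
  assumes bij: "bij_betw (mult_tensor s) (tensor_product s D P Q) UNIV"
  shows "span {x * y | x y. x \<in> P \<and> y \<in> Q} = UNIV"
proof -
  have "x \<in> span {x * y | x y. x \<in> P \<and> y \<in> Q}" for x
  proof -
    obtain t where t: "Poly_Mapping.keys t \<subseteq> P \<times> Q" "mult_free s t = x"
      using tensor_iso_consequences(1)[OF bij] by blast
    show ?thesis unfolding t(2)[symmetric] mult_free_def
    proof (intro span_sum)
      fix p assume "p \<in> Poly_Mapping.keys t"
      then have "fst p \<in> P" "snd p \<in> Q" using t(1) by auto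
      then have "fst p * snd p \<in> span {x * y | x y. x \<in> P \<and> y \<in> Q}"
        by (intro span_base) blast
      then show "(case p of (x, y) \<Rightarrow> s (Poly_Mapping.lookup t (x, y)) (x * y))
          \<in> span {x * y | x y. x \<in> P \<and> y \<in> Q}"
        by (simp add: case_prod_unfold span_scale)
    qed
  qed
  then show ?thesis by blast
qed

end

section \<open>Free generators of the Borel subalgebras\<close>

context algebra_mult
begin

lemma functional_scale:
  assumes \<phi>: "functional V f \<phi>" and V: "is_module mul C mul V" and v: "v \<in> V"
  shows "\<phi> (s c v) = s c (\<phi> v)"
proof -
  obtain d where d: "d \<in> C" "d \<cdot> v = v" using V v unfolding is_module_def by blast
  have "s c v = s c d \<cdot> v" using d by (simp add: mul_scale_left)
  then have "\<phi> (s c v) = s c d \<cdot> \<phi> v" using functionalD(4)[OF \<phi> C_scale[OF d(1)] v] by simp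
  also have "\<dots> = s c (d \<cdot> \<phi> v)" by (simp add: mul_scale_left)
  also have "d \<cdot> \<phi> v = \<phi> v" using functionalD(4)[OF \<phi> d(1) v] d(2) by simp
  finally show ?thesis .
qed

text \<open>
  Free generators of the projective module \<open>V\<close>. For \<open>i \<in> B\<close> it is assumed that \<open>C e i\<close> splits off
  by \<open>\<eta>\<close> and that no copy of \<open>C e i\<close> is left in the complement; then \<open>e i\<close> is the only generator
  with idempotent \<open>e i\<close>.
\<close>

theorem projective_free_generators:
  assumes proj: "projective mul C mul P"
    and V: "is_module mul C mul V" "V \<subseteq> P" "subspace V" and fd: "fin_dim s V"
    and \<theta>: "\<And>u. u \<in> P \<Longrightarrow> \<theta> u \<in> V" "\<And>v. v \<in> V \<Longrightarrow> \<theta> v = v"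
      "\<And>u w. u \<in> P \<Longrightarrow> w \<in> P \<Longrightarrow> \<theta> (u + w) = \<theta> u + \<theta> w"
      "\<And>d u. d \<in> C \<Longrightarrow> u \<in> P \<Longrightarrow> \<theta> (d \<cdot> u) = d \<cdot> \<theta> u"
    and unit: "\<And>S. finite S \<Longrightarrow> S \<subseteq> C \<Longrightarrow> \<exists>d\<in>C. \<forall>x\<in>S. d \<cdot> x = x"
    and loc: "\<And>b. b \<in> B \<Longrightarrow> local_idempotent (e b)" and nz: "\<And>b. b \<in> B \<Longrightarrow> e b \<noteq> 0"
    and cover: "\<And>v. v \<in> V \<Longrightarrow> \<exists>F. finite F \<and> (\<forall>f\<in>F. factors_through e B f) \<and> \<Sum>F \<cdot> v = v"
    and \<eta>: "i \<in> B \<Longrightarrow> functional V (e i) \<eta> \<and> e i \<in> V \<and> \<eta> (e i) = e i"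
      "\<And>v. i \<in> B \<Longrightarrow> v \<in> V \<Longrightarrow> e i \<cdot> v = v \<Longrightarrow> \<eta> v = 0 \<Longrightarrow> v = 0"
  shows "\<exists>Z \<psi>. (i \<in> B \<longrightarrow> Z i = {e i}) \<and> dual_basis V (Sigma B Z) (e \<circ> fst) snd \<psi> \<and>
    orthonormal (Sigma B Z) (e \<circ> fst) snd \<psi>"
proof (cases "i \<in> B")
  case False
  have "\<exists>K b p \<phi>. finite (K :: 'a set) \<and> b ` K \<subseteq> B \<and>
      dual_basis V K (e \<circ> b) p \<phi> \<and> orthonormal K (e \<circ> b) p \<phi>"
    by (rule projective_orthonormal_dual_basis[OF proj V fd, of \<theta>]) (fact \<theta> unit loc cover)+
  then obtain K :: "'a set" and b p \<phi> where K: "b ` K \<subseteq> B" "dual_basis V K (e \<circ> b) p \<phi>"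
    "orthonormal K (e \<circ> b) p \<phi>" by blast
  have "b k \<in> B \<and> e (b k) \<noteq> 0" if "k \<in> K" for k using K(1) nz that by auto
  then show ?thesis
    using orthonormal_dual_basis_by_elements[OF K(2,3), of B "\<lambda>a. p ` {k \<in> K. b k = a}"] False by blast
next
  case True
  have sub: "submodule V" using V(1) by (simp add: is_module_def submodule_def)
  have fn: "functional V (e i) \<eta>" and ei: "e i \<in> V" "\<eta> (e i) = e i" using \<eta>(1)[OF True] by auto
  have idm: "e i \<cdot> e i = e i" using loc[OF True] by (simp add: local_idempotent_def)
  define W where "W = {v \<in> V. \<eta> v = 0}"
  define \<pi> where "\<pi> v = v - \<eta> v \<cdot> e i" for v
  note \<pi> = kernel_projection[OF sub fn ei(1) idm ei(2), folded W_def \<pi>_def]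
  have W: "is_module mul C mul W"
    using V(1) submoduleD(1-3)[OF \<pi>(1)] unfolding is_module_def W_def by auto
  have sW: "subspace W"
    using V(3) submoduleD(1,4)[OF \<pi>(1)] functional_scale[OF fn V(1)]
    by (auto simp: subspace_def W_def)
  have fdW: "fin_dim s W"
    using fd unfolding fin_dim_def W_def by blast
  have "\<exists>K b p \<phi>. finite (K :: 'a set) \<and> b ` K \<subseteq> B \<and>
      dual_basis W K (e \<circ> b) p \<phi> \<and> orthonormal K (e \<circ> b) p \<phi>"
  proof (rule projective_orthonormal_dual_basis[OF proj W _ sW fdW, of "\<pi> \<circ> \<theta>"])
    show "W \<subseteq> P" using V(2) by (auto simp: W_def)
    show "\<exists>F. finite F \<and> (\<forall>f\<in>F. factors_through e B f) \<and> \<Sum>F \<cdot> v = v" if "v \<in> W" for v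
      using cover that by (auto simp: W_def)
    show "(\<pi> \<circ> \<theta>) v = v" if "v \<in> W" for v using that \<theta>(2)[of v] \<pi>(3) by (simp add: W_def)
  qed (use \<theta> \<pi> unit loc in simp_all)
  then obtain K :: "'a set" and b p \<phi> where K: "finite K" "b ` K \<subseteq> B"
    "dual_basis W K (e \<circ> b) p \<phi>" "orthonormal K (e \<circ> b) p \<phi>" by blast
  \<comment> \<open>The index \<open>None\<close> is reserved for the new generator \<open>e i\<close>.\<close>
  have the: "bij_betw the (Some ` K) K" by (rule bij_betwI[of _ _ _ Some]) auto
  define b' where "b' = (b \<circ> the)(None := i)"
  define p' where "p' = (p \<circ> the)(None := e i)"
  define K' where "K' = insert None (Some ` K)"
  have feq: "(e \<circ> b \<circ> the)(None := e i) = e \<circ> b'" by (auto simp: b'_def)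
  have "\<exists>\<phi>'. dual_basis V K' (e \<circ> b') p' \<phi>' \<and> orthonormal K' (e \<circ> b') p' \<phi>'"
    unfolding K'_def p'_def feq[symmetric]
  proof (rule orthonormal_dual_basis_extend[OF sub fn ei(1) idm ei(2), folded W_def])
    show "dual_basis W (Some ` K) (e \<circ> b \<circ> the) (p \<circ> the) (\<phi> \<circ> the)"
      by (rule dual_basis_reindex(1)[OF K(3) the]) simp_all
    show "orthonormal (Some ` K) (e \<circ> b \<circ> the) (p \<circ> the) (\<phi> \<circ> the)"
      by (rule dual_basis_reindex(2)[OF K(3) the _ _ K(4)]) simp_all
  qed (use K(1) in auto)
  then obtain \<phi>' where ext: "dual_basis V K' (e \<circ> b') p' \<phi>'" "orthonormal K' (e \<circ> b') p' \<phi>'" by blast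
  have bB: "b' k \<in> B \<and> e (b' k) \<noteq> 0" if "k \<in> K'" for k
    using that K(2) nz True by (auto simp: K'_def b'_def)
  define Z where "Z a = p' ` {k \<in> K'. b' k = a}" for a
  have only: "b k \<noteq> i" if "k \<in> K" for k
  proof
    assume bk: "b k = i"
    note D = dual_basisD[OF K(3) that]
    have "p k = 0" using D(1,2) bk \<eta>(2)[OF True, of "p k"] by (simp add: W_def)
    then have "\<phi> k (p k) = 0" using functional_zero[OF D(3) \<pi>(1)] by simp
    then show False using K(4) that bk nz[OF True] by (simp add: orthonormal_def)
  qed
  have "{k \<in> K'. b' k = i} = {None}" by (auto simp: K'_def b'_def dest: only)
  then have "Z i = {e i}" by (simp add: Z_def p'_def)
  moreover have "\<exists>\<psi>. dual_basis V (Sigma B Z) (e \<circ> fst) snd \<psi> \<and> orthonormal (Sigma B Z) (e \<circ> fst) snd \<psi>"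
    using orthonormal_dual_basis_by_elements[OF ext bB] Z_def by blast
  ultimately show ?thesis by blast
qed

lemma B_free_of_dual_basis:
  assumes V: "is_module mul C mul V"
    and db: "dual_basis V (Sigma B Z) (e \<circ> fst) snd \<psi>"
    and on: "orthonormal (Sigma B Z) (e \<circ> fst) snd \<psi>"
    and nz: "\<And>b. b \<in> B \<Longrightarrow> e b \<noteq> 0"
    and orth: "\<And>a b. a \<in> B \<Longrightarrow> b \<in> B \<Longrightarrow> a \<noteq> b \<Longrightarrow> e a \<cdot> e b = 0"
  shows "B_free mul C e B mul V"
proof -
  have sub: "submodule V" using V by (simp add: is_module_def submodule_def)
  have z: "z \<in> V" "e b \<cdot> z = z" "z \<noteq> 0" if "b \<in> B" "z \<in> Z b" for b z
  proof -
    have t: "(b, z) \<in> Sigma B Z" using that by simp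
    note D = dual_basisD[OF db t]
    show "z \<in> V" "e b \<cdot> z = z" using D by simp_all
    have "\<psi> (b, z) z = e b" using on t by (auto simp: orthonormal_def)
    then show "z \<noteq> 0" using functional_zero[OF D(3) sub] nz that by auto
  qed
  have uniq: "a = b" if "a \<in> B" "b \<in> B" "z \<in> Z a" "z \<in> Z b" for a b z
    using z[OF that(1,3)] z[OF that(2,4)] orth[OF that(1,2)] by (metis mul_assoc mul_zero(1))
  have inj: "inj_on snd (Sigma B Z)"
    using uniq by (auto simp: inj_on_def)
  define h where "h = inv_into (Sigma B Z) snd"
  have im: "snd ` Sigma B Z = (\<Union>b\<in>B. Z b)" by force
  have h: "bij_betw h (\<Union>b\<in>B. Z b) (Sigma B Z)"
    unfolding h_def im[symmetric] by (rule bij_betw_inv_into) (simp add: inj bij_betw_def)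
  have sh: "snd (h z) = z" if "z \<in> (\<Union>b\<in>B. Z b)" for z
    unfolding h_def by (rule f_inv_into_f) (use that im in blast)
  have eq: "e (fst (h z)) = (e \<circ> fst) (h z)" "z = snd (h z)" if "z \<in> (\<Union>b\<in>B. Z b)" for z
    using sh[OF that] by simp_all
  have ds: "is_direct_sum V (\<Union>b\<in>B. Z b) (\<lambda>x. (\<lambda>d. d \<cdot> x) ` C)"
    by (rule orthonormal_direct_sum[OF sub dual_basis_reindex(1)[OF db h eq]
          dual_basis_reindex(2)[OF db h eq on]])
  show ?thesis
    unfolding B_free_def
  proof (rule conjI[OF V], rule exI[of _ Z], intro conjI ballI)
    show "Z b \<subseteq> mul (e b) ` V" if "b \<in> B" for b using z that by force
    show "disjoint_family_on Z B" using uniq by (auto simp: disjoint_family_on_def)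
    show "bij_betw (\<lambda>a. a \<cdot> x) ((\<lambda>d. d \<cdot> e b) ` C) ((\<lambda>d. d \<cdot> x) ` C)" if "b \<in> B" "x \<in> Z b" for b x
      using orthonormal_component(1)[OF db on, of "(b, x)"] that by simp
  qed (fact ds)
qed

end

text \<open>
  What the two Borel subalgebras have in common: with \<open>mul = (*)\<close> and \<open>P = A\<^sup>\<sharp>\<close>, or with \<open>mul\<close> the
  opposite multiplication and \<open>P = A\<^sup>\<flat>\<close>, the subring \<open>P\<close> is a projective left module over the Cartan
  subalgebra \<open>C\<close>, and \<open>\<epsilon> l\<close> is the central idempotent of \<open>C\<close> of weight \<open>l\<close>.
\<close>

locale borel_module = algebra_mult mul C s
  for mul :: "'a::ring \<Rightarrow> 'a \<Rightarrow> 'a" (infixl \<open>\<cdot>\<close> 70) and C and s :: "'k::field \<Rightarrow> 'a \<Rightarrow> 'a" +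
  fixes P :: "'a set" and I B :: "'i set" and e :: "'i \<Rightarrow> 'a"
    and ord :: "('l \<times> 'l) set" and \<delta> :: "'i \<Rightarrow> 'l" and \<epsilon> :: "'l \<Rightarrow> 'a"
  assumes P: "subspace P" "\<And>u v. u \<in> P \<Longrightarrow> v \<in> P \<Longrightarrow> u \<cdot> v \<in> P" "C \<subseteq> P" "projective mul C mul P"
    and units: "\<And>x. \<exists>F. finite F \<and> F \<subseteq> I \<and> (\<Sum>i\<in>F. e i) \<cdot> x = x"
      "\<And>S. finite S \<Longrightarrow> \<exists>d\<in>C. \<forall>x\<in>S. d \<cdot> x = x"
    and idem: "\<And>i. i \<in> I \<Longrightarrow> e i \<in> C \<and> e i \<cdot> e i = e i"
      "\<And>i j. i \<in> I \<Longrightarrow> j \<in> I \<Longrightarrow> i \<noteq> j \<Longrightarrow> e i \<cdot> e j = 0"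
    and order: "\<And>i j u. i \<in> I \<Longrightarrow> j \<in> I \<Longrightarrow> u \<in> P \<Longrightarrow> e i \<cdot> u \<cdot> e j \<noteq> 0 \<Longrightarrow> (\<delta> j, \<delta> i) \<in> ord"
      "\<And>i j u. i \<in> I \<Longrightarrow> j \<in> I \<Longrightarrow> u \<in> P \<Longrightarrow> \<delta> i = \<delta> j \<Longrightarrow> e i \<cdot> u \<cdot> e j \<in> C"
    and \<epsilon>: "\<And>i. i \<in> I \<Longrightarrow> \<epsilon> (\<delta> i) \<cdot> e i = e i" "\<And>i d. i \<in> I \<Longrightarrow> d \<in> C \<Longrightarrow> \<epsilon> (\<delta> i) \<cdot> d = d \<cdot> \<epsilon> (\<delta> i)"
      "\<And>i u. i \<in> I \<Longrightarrow> u \<in> P \<Longrightarrow> \<epsilon> (\<delta> i) \<cdot> (u \<cdot> e i) \<in> C"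
    and finite_type: "\<And>i. i \<in> I \<Longrightarrow> fin_dim s (range (\<lambda>u. u \<cdot> e i)) \<or> finite {j \<in> I. (\<delta> i, \<delta> j) \<in> ord}"
      "\<And>i j. i \<in> I \<Longrightarrow> j \<in> I \<Longrightarrow> fin_dim s (range (\<lambda>u. e j \<cdot> u \<cdot> e i))"
    and scale_right: "\<And>c x y. x \<cdot> s c y = s c (x \<cdot> y)"
    and B: "B \<subseteq> I" "\<And>b. b \<in> B \<Longrightarrow> local_idempotent (e b)" "\<And>b. b \<in> B \<Longrightarrow> e b \<noteq> 0"
      "\<And>v. \<exists>F. finite F \<and> (\<forall>f\<in>F. factors_through e B f) \<and> \<Sum>F \<cdot> v = v"
begin

text \<open>The module \<open>P e i\<close>: it is \<open>A\<^sup>\<sharp> e i\<close> in the first case and \<open>e i A\<^sup>\<flat>\<close> in the second.\<close>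

definition column :: "'i \<Rightarrow> 'a set" where
  "column i = (\<lambda>u. u \<cdot> e i) ` P"

lemma columnI: "u \<in> P \<Longrightarrow> u \<cdot> e i \<in> column i"
  by (auto simp: column_def)

lemma column_eq: "i \<in> I \<Longrightarrow> column i = {v \<in> P. v \<cdot> e i = v}"
  unfolding column_def using P(2,3) idem(1) by (auto simp: mul_assoc image_iff) metis

lemma column_module:
  assumes i: "i \<in> I"
  shows "is_module mul C mul (column i)" "submodule (column i)" "subspace (column i)" "column i \<subseteq> P"
proof -
  note * = column_eq[OF i]
  have C: "d \<cdot> v \<in> P" if "d \<in> C" "v \<in> P" for d v using P(2,3) that by blast
  show sub: "submodule (column i)"
    unfolding * submodule_def
    using subspace_0[OF P(1)] subspace_diff[OF P(1)] C by (simp add: mul_minus_left mul_assoc)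
  show "subspace (column i)"
    unfolding * using P(1) by (auto simp: subspace_def mul_add_left mul_scale_left)
  show "column i \<subseteq> P" unfolding * by auto
  have "\<exists>d\<in>C. d \<cdot> v = v" for v using units(2)[of "{v}"] by simp
  then show "is_module mul C mul (column i)"
    using sub unfolding submodule_def is_module_def
    by (simp add: mul_add_left mul_add_right mul_assoc)
qed

lemma fin_dim_column:
  assumes i: "i \<in> I"
  shows "fin_dim s (column i)"
proof -
  consider "fin_dim s (range (\<lambda>u. u \<cdot> e i))" | "finite {j \<in> I. (\<delta> i, \<delta> j) \<in> ord}"
    using finite_type(1)[OF i] by blast
  then show ?thesis
  proof cases
    case 1
    then show ?thesis unfolding fin_dim_def column_def by blast
  next
    case 2
    let ?T = "{j \<in> I. (\<delta> i, \<delta> j) \<in> ord}"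
    have "\<forall>j\<in>I. \<exists>S. finite S \<and> range (\<lambda>u. e j \<cdot> u \<cdot> e i) \<subseteq> span S"
      using finite_type(2)[OF i] by (simp add: fin_dim_def)
    then obtain S where S: "\<forall>j\<in>I. finite (S j) \<and> range (\<lambda>u. e j \<cdot> u \<cdot> e i) \<subseteq> span (S j)" by metis
    have "column i \<subseteq> span (\<Union>j\<in>?T. S j)"
    proof
      fix v assume "v \<in> column i"
      then obtain u where u: "u \<in> P" "v = u \<cdot> e i" by (auto simp: column_def)
      obtain F where F: "finite F" "F \<subseteq> I" "(\<Sum>j\<in>F. e j) \<cdot> v = v" using units(1) by blast
      have "e j \<cdot> u \<cdot> e i \<in> span (\<Union>j\<in>?T. S j)" if j: "j \<in> F" for j
      proof (cases "e j \<cdot> u \<cdot> e i = 0")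
        case False
        have jI: "j \<in> I" using j F(2) by auto
        then have "j \<in> ?T" using order(1)[OF jI i u(1) False] by simp
        then have "span (S j) \<subseteq> span (\<Union>j\<in>?T. S j)" by (intro span_mono) blast
        then show ?thesis using S jI by blast
      qed (simp add: span_zero)
      then have "(\<Sum>j\<in>F. e j \<cdot> u \<cdot> e i) \<in> span (\<Union>j\<in>?T. S j)" by (rule span_sum)
      then show "v \<in> span (\<Union>j\<in>?T. S j)" using F(3) by (simp add: u(2) mul_assoc mul_sum_left)
    qed
    moreover have "finite (\<Union>j\<in>?T. S j)" using 2 S by auto
    ultimately show ?thesis unfolding fin_dim_def by blast
  qed
qed

abbreviation "column_basis i Z \<psi> \<equiv>
  dual_basis (column i) (Sigma B Z) (e \<circ> fst) snd \<psi> \<and> orthonormal (Sigma B Z) (e \<circ> fst) snd \<psi>"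

proposition column_free_generators:
  assumes i: "i \<in> I"
  shows "\<exists>Z \<psi>. (i \<in> B \<longrightarrow> Z i = {e i}) \<and> column_basis i Z \<psi>"
proof (rule projective_free_generators[OF P(4) column_module(1,4,3)[OF i] fin_dim_column[OF i],
      of "\<lambda>u. u \<cdot> e i" B e i "\<lambda>v. \<epsilon> (\<delta> i) \<cdot> v"])
  note \<epsilon>i = \<epsilon>[OF i] and ei = idem(1)[OF i] and col = column_eq[OF i]
  show "v \<cdot> e i = v" if "v \<in> column i" for v using that by (simp add: col)
  show "functional (column i) (e i) (\<lambda>v. \<epsilon> (\<delta> i) \<cdot> v) \<and> e i \<in> column i \<and> \<epsilon> (\<delta> i) \<cdot> e i = e i"
    unfolding functional_def
  proof (intro conjI ballI)
    show "e i \<in> column i" using ei P(3) by (auto simp: col)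
    show "\<epsilon> (\<delta> i) \<cdot> v \<in> C" "\<epsilon> (\<delta> i) \<cdot> v \<cdot> e i = \<epsilon> (\<delta> i) \<cdot> v" if "v \<in> column i" for v
      using that \<epsilon>i(3)[of v] by (simp_all add: col mul_assoc)
    show "\<epsilon> (\<delta> i) \<cdot> (d \<cdot> v) = d \<cdot> (\<epsilon> (\<delta> i) \<cdot> v)" if "d \<in> C" for v d
      using \<epsilon>i(2)[OF that] by (simp flip: mul_assoc)
  qed (simp_all add: mul_add_right \<epsilon>i)
  show "v = 0" if "e i \<cdot> v = v" "\<epsilon> (\<delta> i) \<cdot> v = 0" for v
  proof -
    have "v = e i \<cdot> \<epsilon> (\<delta> i) \<cdot> v" using that(1) \<epsilon>i(1) \<epsilon>i(2)[of "e i"] ei by simp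
    then show ?thesis using that(2) by (simp add: mul_assoc)
  qed
qed (use columnI units(2) B in \<open>simp_all add: mul_add_left mul_assoc\<close>)

lemma e_orth: "a \<in> B \<Longrightarrow> b \<in> B \<Longrightarrow> a \<noteq> b \<Longrightarrow> e a \<cdot> e b = 0"
  using idem(2) B(1) by blast

proposition column_B_free: "i \<in> I \<Longrightarrow> B_free mul C e B mul (column i)"
  using column_free_generators[of i] B_free_of_dual_basis[OF column_module(1)[of i], of B _ e]
    B(3) e_orth by metis

text \<open>The requirement of \<^const>\<open>admissible_generators\<close> on the generators of a single column.\<close>

definition generating_family :: "'i \<Rightarrow> ('i \<Rightarrow> 'a set) \<Rightarrow> bool" where
  "generating_family i Z \<longleftrightarrow> (\<forall>b\<in>B. Z b \<subseteq> (\<lambda>u. e b \<cdot> u \<cdot> e i) ` P) \<and>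
     is_direct_sum (column i) (Sigma B Z) (\<lambda>(b, z). (\<lambda>d. d \<cdot> z) ` C) \<and>
     (\<forall>b\<in>B. \<forall>z\<in>Z b. module_isomorphic C mul ((\<lambda>d. d \<cdot> z) ` C) mul ((\<lambda>d. d \<cdot> e b) ` C))"

lemma generating_family_exists:
  assumes i: "i \<in> I"
  shows "\<exists>Z. generating_family i Z \<and> (i \<in> B \<longrightarrow> Z i = {e i})"
proof -
  obtain Z \<psi> where Zi: "i \<in> B \<longrightarrow> Z i = {e i}" and db: "dual_basis (column i) (Sigma B Z) (e \<circ> fst) snd \<psi>"
    and on: "orthonormal (Sigma B Z) (e \<circ> fst) snd \<psi>"
    using column_free_generators[OF i] by (elim exE conjE) (rule that)
  have "generating_family i Z"
    unfolding generating_family_def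
  proof (intro conjI ballI subsetI)
    fix b z assume b: "b \<in> B" and z: "z \<in> Z b"
    then have t: "(b, z) \<in> Sigma B Z" by simp
    have "z \<in> column i" "e b \<cdot> z = z" using dual_basisD(1,2)[OF db t] by simp_all
    then show "z \<in> (\<lambda>u. e b \<cdot> u \<cdot> e i) ` P" by (force simp: column_def mul_assoc)
    show "module_isomorphic C mul ((\<lambda>d. d \<cdot> z) ` C) mul ((\<lambda>d. d \<cdot> e b) ` C)"
      using orthonormal_component(2)[OF db on t] idem(1) B(1) b by auto
  next
    show "is_direct_sum (column i) (Sigma B Z) (\<lambda>(b, z). (\<lambda>d. d \<cdot> z) ` C)"
      using orthonormal_direct_sum[OF column_module(2)[OF i] db on] by (simp add: case_prod_unfold)
  qed
  then show ?thesis using Zi by blast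
qed

context
  fixes i Z assumes i: "i \<in> I" and Z: "generating_family i Z"
begin

lemma generating_family_mem:
  assumes b: "b \<in> B" and z: "z \<in> Z b"
  shows "z \<in> P" "e b \<cdot> z = z" "z \<cdot> e i = z"
proof -
  have bI: "b \<in> I" using b B(1) by blast
  obtain u where u: "u \<in> P" "z = e b \<cdot> u \<cdot> e i"
    using Z b z unfolding generating_family_def by blast
  show "z \<in> P" unfolding u(2) using P(2,3) u(1) idem(1)[OF bI] idem(1)[OF i] by blast
  show "z \<cdot> e i = z" unfolding u(2) using idem(1)[OF i] by (simp add: mul_assoc)
  have "e b \<cdot> (e b \<cdot> x) = e b \<cdot> x" for x using idem(1)[OF bI] by (simp flip: mul_assoc)
  then show "e b \<cdot> z = z" unfolding u(2) by (simp add: mul_assoc)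
qed

lemma generating_family_basis: "\<exists>\<psi>. column_basis i Z \<psi>"
proof (rule orthonormal_dual_basis_of_direct_sum[OF column_module(2)[OF i]])
  show "is_direct_sum (column i) (Sigma B Z) (\<lambda>k. (\<lambda>d. d \<cdot> snd k) ` C)"
    using Z by (simp add: generating_family_def case_prod_unfold)
  fix t assume t: "t \<in> Sigma B Z"
  then have bz: "fst t \<in> B" "snd t \<in> Z (fst t)" by auto
  show "snd t \<in> column i" "(e \<circ> fst) t \<cdot> snd t = snd t"
    using generating_family_mem[OF bz] by (simp_all add: column_eq[OF i])
  show "local_idempotent ((e \<circ> fst) t)" using B(2) bz(1) by simp
  show "module_isomorphic C mul ((\<lambda>d. d \<cdot> snd t) ` C) mul ((\<lambda>d. d \<cdot> (e \<circ> fst) t) ` C)"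
    using Z bz unfolding generating_family_def by auto
qed

lemma generating_family_nonzero:
  assumes "b \<in> B" "z \<in> Z b"
  shows "z \<noteq> 0"
proof
  assume "z = 0"
  obtain \<psi> where \<psi>: "column_basis i Z \<psi>" using generating_family_basis by blast
  have t: "(b, z) \<in> Sigma B Z" using assms by simp
  have "\<psi> (b, z) 0 = 0"
    by (rule functional_zero[OF dual_basisD(3)[OF conjunct1[OF \<psi>] t] column_module(2)[OF i]])
  moreover have "\<psi> (b, z) z = e b" using conjunct2[OF \<psi>] t by (auto simp: orthonormal_def)
  ultimately show False using \<open>z = 0\<close> B(3) assms by simp
qed

text \<open>
  If \<open>a \<noteq> i\<close> has the weight of \<open>i\<close>, then \<open>Z a \<subseteq> e a P e i \<subseteq> C\<close> lies in the summand \<open>C e i\<close>.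
\<close>

lemma generating_family_order:
  assumes a: "a \<in> B" "a \<noteq> i" and iB: "i \<in> B" "e i \<in> Z i" and z: "z \<in> Z a"
  shows "(\<delta> i, \<delta> a) \<in> ord" "\<delta> i \<noteq> \<delta> a"
proof -
  have aI: "a \<in> I" using a B(1) by blast
  note m = generating_family_mem[OF a(1) z] and nz = generating_family_nonzero[OF a(1) z]
  have zz: "e a \<cdot> z \<cdot> e i = z" using m by (simp add: mul_assoc)
  show "(\<delta> i, \<delta> a) \<in> ord" using order(1)[OF aI i m(1)] nz zz by simp
  show "\<delta> i \<noteq> \<delta> a"
  proof
    assume eq: "\<delta> i = \<delta> a"
    have zC: "z \<in> C" using order(2)[OF aI i m(1)] eq zz by simp
    obtain \<psi> where \<psi>: "column_basis i Z \<psi>" using generating_family_basis by blast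
    have t: "(a, z) \<in> Sigma B Z" "(i, e i) \<in> Sigma B Z" using a iB z by simp_all
    have "\<psi> (a, z) z = e a" "\<psi> (a, z) (e i) = 0"
      using conjunct2[OF \<psi>] t a(2) by (auto simp: orthonormal_def)
    moreover have "e i \<in> column i" using dual_basisD(1)[OF conjunct1[OF \<psi>] t(2)] by simp
    then have "\<psi> (a, z) (z \<cdot> e i) = z \<cdot> \<psi> (a, z) (e i)"
      by (rule functionalD(4)[OF dual_basisD(3)[OF conjunct1[OF \<psi>] t(1)] zC])
    ultimately show False using m B(3)[OF a(1)] by simp
  qed
qed

end

end

section \<open>The Cartan subalgebra\<close>

lemma lmul_eq_image: "lmul y D = (\<lambda>d. y * d) ` D"
  and rmul_eq_image: "rmul D x = (\<lambda>d. d * x) ` D"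
  and peirce_eq_image: "peirce g D g' = (\<lambda>d. g * d * g') ` D"
  by (auto simp: lmul_def rmul_def peirce_def)

lemma peirceI:
  assumes "g * y = y" "y * g' = y" "y \<in> D" shows "y \<in> peirce g D g'"
  using assms unfolding peirce_def by (intro CollectI exI[of _ y]) simp

context triangular_decomposition
begin

abbreviation "Acirc \<equiv> Aflat \<inter> Asharp"

sublocale orthogonal_idempotents I e
  by (rule idem_decomp_orthogonal_idempotents[OF decomp])

lemma borel_closed:
  shows "subspace Aflat" "subspace Asharp"
    and "x \<in> Aflat \<Longrightarrow> y \<in> Aflat \<Longrightarrow> x * y \<in> Aflat" "x \<in> Asharp \<Longrightarrow> y \<in> Asharp \<Longrightarrow> x * y \<in> Asharp"
    and "i \<in> I \<Longrightarrow> e i \<in> Aflat" "i \<in> I \<Longrightarrow> e i \<in> Asharp"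
  using TD3 by (auto simp: lu_subalgebra_def)

lemma cartan_closed:
  shows "subspace Acirc" "x \<in> Acirc \<Longrightarrow> y \<in> Acirc \<Longrightarrow> x * y \<in> Acirc" "i \<in> I \<Longrightarrow> e i \<in> Acirc"
  using borel_closed by (auto intro: subspace_inter)

text \<open>
  The prefix \<open>L\<close> refers to left modules over the Cartan subalgebra, such as \<open>A\<^sup>\<sharp>\<close>, and \<open>R\<close> to right modules,
  such as \<open>A\<^sup>\<flat>\<close>.
\<close>

sublocale L: algebra_mult "(*)" Acirc s
  using cartan_closed(1)
  by unfold_locales (auto simp: mult.assoc distrib_left distrib_right scale_mult borel_closed
      intro: subspace_0 subspace_diff subspace_scale)

sublocale R: algebra_mult opp Acirc s
  using cartan_closed(1)
  by unfold_locales (auto simp: mult.assoc distrib_left distrib_right scale_mult borel_closed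
      intro: subspace_0 subspace_diff subspace_scale)

lemma local_unit:
  assumes "finite S"
  obtains F where "finite F" "F \<subseteq> I"
    "\<And>x. x \<in> S \<Longrightarrow> (\<Sum>i\<in>F. e i) * x = x" "\<And>x. x \<in> S \<Longrightarrow> x * (\<Sum>i\<in>F. e i) = x"
  using idem_decomp_local_unit[OF decomp assms] by blast

lemma local_unit1:
  obtains F where "finite F" "F \<subseteq> I" "(\<Sum>i\<in>F. e i) * x = x" "x * (\<Sum>i\<in>F. e i) = x"
  by (rule local_unit[of "{x}"]) (simp, rule that, simp_all)

lemma sum_e_mem: "F \<subseteq> I \<Longrightarrow> (\<Sum>i\<in>F. e i) \<in> Acirc"
  using cartan_closed(3) by (intro subspace_sum[OF cartan_closed(1)]) auto

lemma borel_local_units: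
  assumes "finite S"
  shows "\<exists>d\<in>Acirc. \<forall>x\<in>S. d * x = x" "\<exists>d\<in>Acirc. \<forall>x\<in>S. x * d = x"
  using local_unit[OF assms] sum_e_mem by metis+

lemma flat_order: "i \<in> I \<Longrightarrow> j \<in> I \<Longrightarrow> x \<in> Aflat \<Longrightarrow> e i * x * e j \<noteq> 0 \<Longrightarrow> (\<delta> i, \<delta> j) \<in> ord"
  using TD6(1)[of j i] by (auto simp: peirce_def)

lemma sharp_order: "i \<in> I \<Longrightarrow> j \<in> I \<Longrightarrow> x \<in> Asharp \<Longrightarrow> e i * x * e j \<noteq> 0 \<Longrightarrow> (\<delta> j, \<delta> i) \<in> ord"
  using TD6(1)[of i j] by (auto simp: peirce_def)

lemma ord_antisym: "(a, b) \<in> ord \<Longrightarrow> (b, a) \<in> ord \<Longrightarrow> a = b"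
  using TD1(1) by (auto simp: partial_order_on_def dest: antisymD)

lemma ord_trans: "(a, b) \<in> ord \<Longrightarrow> (b, c) \<in> ord \<Longrightarrow> (a, c) \<in> ord"
  using TD1(1) by (auto simp: partial_order_on_def preorder_on_def dest: transD)

text \<open>
  The Cartan subalgebra is the direct sum of blocks, one for each weight: \<open>e i A\<^sup>\<flat> e j \<noteq> 0\<close> forces
  \<open>\<delta> i \<le> \<delta> j\<close>, and \<open>e i A\<^sup>\<sharp> e j \<noteq> 0\<close> forces \<open>\<delta> j \<le> \<delta> i\<close>.
\<close>

lemma cartan_block: "i \<in> I \<Longrightarrow> j \<in> I \<Longrightarrow> x \<in> Acirc \<Longrightarrow> \<delta> i \<noteq> \<delta> j \<Longrightarrow> e i * x * e j = 0"
  using flat_order[of i j x] sharp_order[of i j x] ord_antisym by blast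

lemma same_weight_mem:
  assumes "i \<in> I" "j \<in> I" "\<delta> i = \<delta> j"
  shows "x \<in> Aflat \<Longrightarrow> e i * x * e j \<in> Acirc" "x \<in> Asharp \<Longrightarrow> e i * x * e j \<in> Acirc"
proof -
  have eq: "peirce (e i) Aflat (e j) = peirce (e i) Asharp (e j)" using TD6(2)[OF assms] .
  have f: "e i * y * e j \<in> Aflat" if "y \<in> Aflat" for y using that borel_closed assms by simp
  have s: "e i * y * e j \<in> Asharp" if "y \<in> Asharp" for y using that borel_closed assms by simp
  show "e i * x * e j \<in> Acirc" if "x \<in> Aflat"
  proof -
    have "e i * x * e j \<in> peirce (e i) Asharp (e j)" by (subst eq[symmetric]) (use that in \<open>auto simp: peirce_def\<close>)
    then obtain y where "y \<in> Asharp" and y: "e i * x * e j = e i * y * e j"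
      unfolding peirce_def by blast
    then have "e i * x * e j \<in> Asharp" unfolding y by (intro s)
    then show ?thesis using f[OF \<open>x \<in> Aflat\<close>] by blast
  qed
  show "e i * x * e j \<in> Acirc" if "x \<in> Asharp"
  proof -
    have "e i * x * e j \<in> peirce (e i) Aflat (e j)" by (subst eq) (use that in \<open>auto simp: peirce_def\<close>)
    then obtain y where "y \<in> Aflat" and y: "e i * x * e j = e i * y * e j"
      unfolding peirce_def by blast
    then have "e i * x * e j \<in> Aflat" unfolding y by (intro f)
    then show ?thesis using s[OF \<open>x \<in> Asharp\<close>] by blast
  qed
qed

text \<open>The idempotent \<open>\<epsilon> l\<close> of weight \<open>l\<close>; it is central in the Cartan subalgebra.\<close>

definition \<epsilon> :: "'l \<Rightarrow> 'a" where
  "\<epsilon> l = (\<Sum>j | j \<in> I \<and> \<delta> j = l. e j)"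

lemma finite_weight: "l \<in> \<Lambda> \<Longrightarrow> finite {j \<in> I. \<delta> j = l}"
  using TD2 by (auto simp: finite_fibres_def)

lemma weight_in: "i \<in> I \<Longrightarrow> \<delta> i \<in> \<Lambda>"
  using TD2 by (auto simp: finite_fibres_def)

lemma \<epsilon>_mult:
  assumes "i \<in> I" "l \<in> \<Lambda>"
  shows "\<epsilon> l * e i = (if \<delta> i = l then e i else 0)" "e i * \<epsilon> l = (if \<delta> i = l then e i else 0)"
  unfolding \<epsilon>_def
  using mult_sum_left[of "{j \<in> I. \<delta> j = l}" i] mult_sum_right[of "{j \<in> I. \<delta> j = l}" i]
    finite_weight assms by auto

lemma \<epsilon>_idem: "l \<in> \<Lambda> \<Longrightarrow> \<epsilon> l * \<epsilon> l = \<epsilon> l"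
  using mult_sum_sum(1)[of "{j \<in> I. \<delta> j = l}" "{j \<in> I. \<delta> j = l}"] finite_weight
  by (simp add: \<epsilon>_def)

lemma \<epsilon>_central:
  assumes x: "x \<in> Acirc" and l: "l \<in> \<Lambda>"
  shows "\<epsilon> l * x = x * \<epsilon> l"
proof -
  obtain F where F: "finite F" "F \<subseteq> I" "(\<Sum>i\<in>F. e i) * x = x" "x * (\<Sum>i\<in>F. e i) = x"
    by (rule local_unit1[of x])
  have fin: "finite {j \<in> I. \<delta> j = l}" by (rule finite_weight[OF l])
  define G where "G = F \<union> {j \<in> I. \<delta> j = l}"
  have G: "finite G" "G \<subseteq> I" "{j \<in> I. \<delta> j = l} \<subseteq> G" "F \<subseteq> G" using F(1,2) fin by (auto simp: G_def)
  note U = local_unit_mono[OF G(1,2,4)]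
  have blk: "e i * x * e j = 0" if "i \<in> I" "j \<in> I" "\<delta> i \<noteq> \<delta> j" for i j
    using cartan_block[OF that(1,2) x that(3)] .
  have "\<epsilon> l * x = \<epsilon> l * x * (\<Sum>j\<in>G. e j)" using U(2)[OF F(4)] by (simp add: mult.assoc)
  also have "\<dots> = (\<Sum>j\<in>G. \<epsilon> l * x * e j)" by (simp add: sum_distrib_left)
  also have "\<dots> = (\<Sum>j | j \<in> I \<and> \<delta> j = l. \<epsilon> l * x * e j)"
  proof (rule sum.mono_neutral_right[OF G(1,3)], rule ballI)
    fix j assume j: "j \<in> G - {j \<in> I. \<delta> j = l}"
    then have "j \<in> I" "\<delta> j \<noteq> l" using G(2) by auto
    then have "e i * x * e j = 0" if "i \<in> I" "\<delta> i = l" for i using blk[of i j] that by simp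
    then show "\<epsilon> l * x * e j = 0" by (simp add: \<epsilon>_def sum_distrib_right)
  qed
  also have "\<dots> = \<epsilon> l * x * \<epsilon> l" by (simp add: \<epsilon>_def sum_distrib_left)
  finally have 1: "\<epsilon> l * x = \<epsilon> l * x * \<epsilon> l" .
  have "x * \<epsilon> l = (\<Sum>j\<in>G. e j) * (x * \<epsilon> l)" using U(1)[OF F(3)] by (simp flip: mult.assoc)
  also have "\<dots> = (\<Sum>j\<in>G. e j * (x * \<epsilon> l))" by (simp add: sum_distrib_right)
  also have "\<dots> = (\<Sum>j | j \<in> I \<and> \<delta> j = l. e j * (x * \<epsilon> l))"
  proof (rule sum.mono_neutral_right[OF G(1,3)], rule ballI)
    fix j assume j: "j \<in> G - {j \<in> I. \<delta> j = l}"
    then have "j \<in> I" "\<delta> j \<noteq> l" using G(2) by auto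
    then have "e j * x * e i = 0" if "i \<in> I" "\<delta> i = l" for i using blk[of j i] that by simp
    then show "e j * (x * \<epsilon> l) = 0" by (simp add: \<epsilon>_def sum_distrib_left mult.assoc)
  qed
  also have "\<dots> = \<epsilon> l * (x * \<epsilon> l)" by (simp add: \<epsilon>_def sum_distrib_right)
  finally show ?thesis using 1 by (simp add: mult.assoc)
qed

lemma fin_dim_peirce:
  assumes "i \<in> I" "j \<in> I"
  shows "fin_dim s (peirce (e i) UNIV (e j))"
proof (cases kind)
  case Finite
  then show ?thesis using dim fin_dim_mono by auto
next
  case Upper_Finite
  then show ?thesis using dim assms by auto
next
  case Essentially_Finite
  then have "fin_dim s (lmul (e i) UNIV)" using dim assms by auto
  then show ?thesis by (rule fin_dim_mono) (auto simp: peirce_def lmul_def mult.assoc)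
qed

lemma finite_above:
  assumes "kind = Upper_Finite" "i \<in> I"
  shows "finite {j \<in> I. (\<delta> i, \<delta> j) \<in> ord}"
proof -
  have fin: "finite {l \<in> \<Lambda>. (\<delta> i, l) \<in> ord}" using TD1(2) assms weight_in by auto
  have eq: "{j \<in> I. (\<delta> i, \<delta> j) \<in> ord} = (\<Union>l\<in>{l \<in> \<Lambda>. (\<delta> i, l) \<in> ord}. {j \<in> I. \<delta> j = l})"
    using weight_in by auto
  show ?thesis unfolding eq using fin finite_weight by (intro finite_UN_I) auto
qed

lemma primitive_decomposition_of_unit:
  assumes i: "i \<in> I"
  obtains P where "finite P" "e i = \<Sum>P"
    "\<And>f. f \<in> P \<Longrightarrow> primitive_idempotent (subalgebra_ring Acirc) f"
    "\<And>f. f \<in> P \<Longrightarrow> e i * f = f" "\<And>f. f \<in> P \<Longrightarrow> f * e i = f"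
proof -
  have "fin_dim s (peirce (e i) Acirc (e i))"
    by (rule fin_dim_mono[OF fin_dim_peirce[OF i i]]) (auto simp: peirce_def)
  from sum_of_primitive_idempotents[OF cartan_closed(1,2) cartan_closed(3)[OF i] idem[OF i] this]
  show thesis using that by blast
qed

end

text \<open>A triangular decomposition together with representatives of the primitive idempotents.\<close>

locale triangular_decomposition_primitive =
  triangular_decomposition kind s I e \<Lambda> ord \<delta> Aflat Asharp
  for kind :: fin_kind
    and s :: "'k::field \<Rightarrow> 'a::ring \<Rightarrow> 'a" and I :: "'i set" and e :: "'i \<Rightarrow> 'a"
    and \<Lambda> :: "'l set" and ord :: "('l \<times> 'l) set" and \<delta> :: "'i \<Rightarrow> 'l"
    and Aflat :: "'a set" and Asharp :: "'a set" +
  fixes B :: "'i set"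
  assumes B: "B \<subseteq> I" "full_set_of_primitive_idempotents (subalgebra_ring Acirc) B e"
begin

lemma BI: "b \<in> B \<Longrightarrow> b \<in> I"
  using B(1) by auto

lemma prim: "b \<in> B \<Longrightarrow> primitive_idempotent (subalgebra_ring Acirc) (e b)"
  using B(2) by (simp add: full_set_of_primitive_idempotents_def)

lemma e_nonzero: "b \<in> B \<Longrightarrow> e b \<noteq> 0"
  using prim by (simp add: primitive_idempotent_subalgebra_iff)

lemma e_local:
  assumes b: "b \<in> B"
  shows "L.local_idempotent (e b)" "R.local_idempotent (e b)"
proof -
  have fd: "fin_dim s (peirce (e b) Acirc (e b))"
    by (rule fin_dim_mono[OF fin_dim_peirce[OF BI[OF b] BI[OF b]]]) (auto simp: peirce_def)
  have *: "\<exists>r\<in>Acirc. e b * r = r \<and> r * e b = r \<and>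
      (c * r = e b \<and> r * c = e b \<or> (e b - c) * r = e b \<and> r * (e b - c) = e b)"
    if "c \<in> Acirc" "e b * c = c" "c * e b = c" for c
    by (rule primitive_corner_local[OF cartan_closed(1,2) prim[OF b] fd that])
  show "L.local_idempotent (e b)"
    unfolding L.local_idempotent_def
    using * cartan_closed(3)[OF BI[OF b]] idem[OF BI[OF b]] by simp
  show "R.local_idempotent (e b)"
    unfolding R.local_idempotent_def
  proof (intro conjI ballI impI)
    fix c assume "c \<in> Acirc" "c * e b = c" "e b * c = c"
    from *[OF this(1,3,2)] show "\<exists>r\<in>Acirc. r * e b = r \<and> e b * r = r \<and>
       (r * c = e b \<and> c * r = e b \<or> r * (e b - c) = e b \<and> (e b - c) * r = e b)"
      by blast
  qed (use cartan_closed(3)[OF BI[OF b]] idem[OF BI[OF b]] in simp_all)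
qed

text \<open>If \<open>u f u\<^sup>-\<^sup>1 = e b\<close>, then \<open>f = (u\<^sup>-\<^sup>1 e b) (e b u)\<close>.\<close>

lemma primitive_factor:
  assumes "primitive_idempotent (subalgebra_ring Acirc) f"
  shows "\<exists>b\<in>B. \<exists>x\<in>Acirc. \<exists>y\<in>Acirc. f = x * y \<and> x * e b = x \<and> e b * y = y"
proof -
  obtain b where b: "b \<in> B" and "conjugate_idempotents (subalgebra_ring Acirc) f (e b)"
    using B(2) assms unfolding full_set_of_primitive_idempotents_def by blast
  then obtain g u v where g: "g \<in> Acirc" "g * g = g"
    and mem: "{f, e b, u, v} \<subseteq> {g * x * g | x. x \<in> Acirc}"
    and uv: "u * v = g" "v * u = g" "u * f * v = e b"
    unfolding conjugate_idempotents_subalgebra_iff by blast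
  have *: "x \<in> Acirc" "g * x = x" "x * g = x" if x: "x \<in> {f, e b, u, v}" for x
  proof -
    obtain z where z: "z \<in> Acirc" "x = g * z * g" using subsetD[OF mem x] by blast
    have gg: "g * (g * y) = g * y" for y by (simp add: g(2) flip: mult.assoc)
    show "x \<in> Acirc" unfolding z(2) using g(1) z(1) by (intro cartan_closed(2))
    show "g * x = x" "x * g = x" unfolding z(2) by (simp_all add: mult.assoc g(2) gg)
  qed
  have "f = v * e b * (e b * u)"
  proof -
    have "v * e b * (e b * u) = v * (e b * e b) * u" by (simp add: mult.assoc)
    also have "\<dots> = v * (u * f * v) * u" using idem[OF BI[OF b]] uv by simp
    also have "\<dots> = (v * u) * f * (v * u)" by (simp add: mult.assoc)
    also have "\<dots> = f" using uv * by simp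
    finally show ?thesis by simp
  qed
  moreover have "v * e b \<in> Acirc" "e b * u \<in> Acirc" using * cartan_closed(2) by simp_all
  moreover have "v * e b * e b = v * e b" "e b * (e b * u) = e b * u"
    using idem[OF BI[OF b]] by (simp_all add: mult.assoc flip: mult.assoc[of "e b" "e b"])
  ultimately show ?thesis using b by blast
qed

lemma primitive_factors_through:
  assumes "primitive_idempotent (subalgebra_ring Acirc) f"
  shows "L.factors_through e B f" "R.factors_through e B f"
  using primitive_factor[OF assms] unfolding L.factors_through_def R.factors_through_def by blast+

lemma primitive_local_unit:
  shows "\<exists>F. finite F \<and> (\<forall>f\<in>F. primitive_idempotent (subalgebra_ring Acirc) f) \<and> \<Sum>F * v = v \<and> v * \<Sum>F = v"
proof -
  obtain F where F: "finite F" "F \<subseteq> I" "(\<Sum>i\<in>F. e i) * v = v" "v * (\<Sum>i\<in>F. e i) = v"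
    by (rule local_unit1[of v])
  have "\<forall>i\<in>F. \<exists>P. finite P \<and> e i = \<Sum>P \<and> (\<forall>f\<in>P. primitive_idempotent (subalgebra_ring Acirc) f \<and>
      e i * f = f \<and> f * e i = f)"
    using primitive_decomposition_of_unit F(2) by (metis subsetD)
  then obtain P where P: "\<And>i. i \<in> F \<Longrightarrow> finite (P i) \<and> e i = \<Sum>(P i) \<and>
      (\<forall>f\<in>P i. primitive_idempotent (subalgebra_ring Acirc) f \<and> e i * f = f \<and> f * e i = f)"
    by metis
  have disj: "P i \<inter> P j = {}" if ij: "i \<in> F" "j \<in> F" "i \<noteq> j" for i j
  proof (rule ccontr)
    assume "P i \<inter> P j \<noteq> {}"
    then obtain f where f: "f \<in> P i" "f \<in> P j" by auto
    have "f = e i * e j * f" using P[OF ij(1)] P[OF ij(2)] f by (metis mult.assoc)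
    also have "e i * e j = 0" using ij F(2) by (intro orth) auto
    finally have "f = 0" by simp
    moreover have "f \<noteq> 0" using P[OF ij(1)] f by (auto simp: primitive_idempotent_subalgebra_iff)
    ultimately show False by simp
  qed
  have "(\<Sum>i\<in>F. e i) = (\<Sum>i\<in>F. \<Sum>(P i))"
    by (rule sum.cong[OF refl]) (use P in blast)
  also have "\<dots> = \<Sum>(\<Union>i\<in>F. P i)"
    using F(1) P disj by (intro sum.UNION_disjoint[symmetric]) auto
  finally have "\<Sum>(\<Union>i\<in>F. P i) = (\<Sum>i\<in>F. e i)" by simp
  moreover have "finite (\<Union>i\<in>F. P i)" using P F(1) by blast
  moreover have "\<forall>f\<in>\<Union>i\<in>F. P i. primitive_idempotent (subalgebra_ring Acirc) f" using P by blast
  ultimately show ?thesis using F(3,4) by metis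
qed

sublocale L: borel_module "(*)" Acirc s Asharp I B e ord \<delta> \<epsilon>
proof
  show "\<exists>F. finite F \<and> F \<subseteq> I \<and> (\<Sum>i\<in>F. e i) * x = x" for x
    by (rule local_unit1[of x]) blast
  show "\<exists>F. finite F \<and> (\<forall>f\<in>F. L.factors_through e B f) \<and> \<Sum>F * v = v" for v
    using primitive_local_unit primitive_factors_through(1) by meson
  show "fin_dim s (range (\<lambda>u. u * e i)) \<or> finite {j \<in> I. (\<delta> i, \<delta> j) \<in> ord}" if i: "i \<in> I" for i
  proof (cases kind)
    case Finite
    then show ?thesis using dim fin_dim_mono by auto
  next
    case Essentially_Finite
    then show ?thesis using dim i by (simp add: rmul_eq_image)
  qed (use finite_above i in simp)
  show "fin_dim s (range (\<lambda>u. e j * u * e i))" if "i \<in> I" "j \<in> I" for i j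
    using fin_dim_peirce[OF that(2,1)] by (simp add: peirce_eq_image)
  show "\<epsilon> (\<delta> i) * (u * e i) \<in> Acirc" if "i \<in> I" "u \<in> Asharp" for i u
    unfolding \<epsilon>_def sum_distrib_right mult.assoc[symmetric]
    by (rule subspace_sum[OF cartan_closed(1)], rule same_weight_mem(2)) (use that in auto)
qed (use borel_closed cartan_closed TD4 borel_local_units idem orth sharp_order same_weight_mem(2)
    \<epsilon>_mult \<epsilon>_central weight_in B(1) e_local e_nonzero in \<open>simp_all add: scale_mult\<close>)

sublocale R: borel_module opp Acirc s Aflat I B e ord \<delta> \<epsilon>
proof
  show "\<exists>F. finite F \<and> F \<subseteq> I \<and> x * (\<Sum>i\<in>F. e i) = x" for x
    by (rule local_unit1[of x]) blast
  show "\<exists>F. finite F \<and> (\<forall>f\<in>F. R.factors_through e B f) \<and> v * \<Sum>F = v" for v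
    using primitive_local_unit primitive_factors_through(2) by meson
  show "fin_dim s (range (\<lambda>u. e i * u)) \<or> finite {j \<in> I. (\<delta> i, \<delta> j) \<in> ord}" if i: "i \<in> I" for i
  proof (cases kind)
    case Finite
    then show ?thesis using dim fin_dim_mono by auto
  next
    case Essentially_Finite
    then show ?thesis using dim i by (simp add: lmul_eq_image)
  qed (use finite_above i in simp)
  show "fin_dim s (range (\<lambda>u. e i * (u * e j)))" if "i \<in> I" "j \<in> I" for i j
    using fin_dim_peirce[OF that] by (simp add: peirce_eq_image mult.assoc)
  show "e i * u * \<epsilon> (\<delta> i) \<in> Acirc" if "i \<in> I" "u \<in> Aflat" for i u
    unfolding \<epsilon>_def sum_distrib_left
    by (rule subspace_sum[OF cartan_closed(1)], rule same_weight_mem(1)) (use that in auto)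
  show "(\<delta> j, \<delta> i) \<in> ord" if "i \<in> I" "j \<in> I" "u \<in> Aflat" "e j * (u * e i) \<noteq> 0" for i j u
    using flat_order[of j i u] that by (simp add: mult.assoc)
  show "e j * (u * e i) \<in> Acirc" if "i \<in> I" "j \<in> I" "u \<in> Aflat" "\<delta> i = \<delta> j" for i j u
    using same_weight_mem(1)[of j i u] that by (simp add: mult.assoc)
  show "u * v \<in> Aflat" if "v \<in> Aflat" "u \<in> Aflat" for u v using borel_closed(3) that by blast
qed (use borel_closed cartan_closed TD4 borel_local_units idem orth
    \<epsilon>_mult \<epsilon>_central weight_in B(1) e_local e_nonzero in \<open>simp_all add: scale_mult\<close>)

lemmas e_orth = L.e_orth

lemma admissible_generators_iff:
  "admissible_generators Aflat Asharp I e B Y X \<longleftrightarrow>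
     (\<forall>i\<in>I. R.generating_family i (Y i)) \<and> (\<forall>j\<in>I. L.generating_family j (\<lambda>b. X b j)) \<and>
     (\<forall>b\<in>B. Y b b = {e b} \<and> X b b = {e b})"
  unfolding admissible_generators_def Let_def R.generating_family_def L.generating_family_def
    R.column_def L.column_def lmul_eq_image rmul_eq_image peirce_eq_image mult.assoc
  by blast

proposition admissible_generators_exist: "\<exists>Y X. admissible_generators Aflat Asharp I e B Y X"
proof -
  have "\<forall>i\<in>I. \<exists>Z. R.generating_family i Z \<and> (i \<in> B \<longrightarrow> Z i = {e i})"
    using R.generating_family_exists by blast
  then obtain Y where Y: "\<And>i. i \<in> I \<Longrightarrow> R.generating_family i (Y i) \<and> (i \<in> B \<longrightarrow> Y i i = {e i})"
    by metis
  have "\<forall>j\<in>I. \<exists>Z. L.generating_family j Z \<and> (j \<in> B \<longrightarrow> Z j = {e j})"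
    using L.generating_family_exists by blast
  then obtain X where X: "\<And>j. j \<in> I \<Longrightarrow> L.generating_family j (X j) \<and> (j \<in> B \<longrightarrow> X j j = {e j})"
    by metis
  have "admissible_generators Aflat Asharp I e B Y (\<lambda>b j. X j b)"
    unfolding admissible_generators_iff using Y X BI by simp
  then show ?thesis by blast
qed

end

section \<open>The triangular basis\<close>

text \<open>Admissible generators \<open>Y\<close>, \<open>X\<close> and bases \<open>H a b\<close> of \<open>e a A\<^sup>\<circ> e b\<close>.\<close>

locale admissible_data =
  triangular_decomposition_primitive kind s I e \<Lambda> ord \<delta> Aflat Asharp B
  for kind :: fin_kind
    and s :: "'k::field \<Rightarrow> 'a::ring \<Rightarrow> 'a" and I :: "'i set" and e :: "'i \<Rightarrow> 'a"
    and \<Lambda> :: "'l set" and ord :: "('l \<times> 'l) set" and \<delta> :: "'i \<Rightarrow> 'l"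
    and Aflat :: "'a set" and Asharp :: "'a set" and B :: "'i set" +
  fixes Y X H :: "'i \<Rightarrow> 'i \<Rightarrow> 'a set"
  assumes adm: "admissible_generators Aflat Asharp I e B Y X"
    and H: "\<And>a b. a \<in> B \<Longrightarrow> b \<in> B \<Longrightarrow> is_basis s (peirce (e a) Acirc (e b)) (H a b)"
begin

lemma family_Y: "i \<in> I \<Longrightarrow> R.generating_family i (Y i)"
  and family_X: "j \<in> I \<Longrightarrow> L.generating_family j (\<lambda>b. X b j)"
  and YX_diag: "b \<in> B \<Longrightarrow> Y b b = {e b} \<and> X b b = {e b}"
  using adm unfolding admissible_generators_iff by blast+

lemma Y_mem: "i \<in> I \<Longrightarrow> a \<in> B \<Longrightarrow> y \<in> Y i a \<Longrightarrow> y \<in> Aflat \<and> e i * y = y \<and> y * e a = y"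
  using R.generating_family_mem[OF _ family_Y] by blast

lemma X_mem: "b \<in> B \<Longrightarrow> j \<in> I \<Longrightarrow> x \<in> X b j \<Longrightarrow> x \<in> Asharp \<and> e b * x = x \<and> x * e j = x"
  using L.generating_family_mem[OF _ family_X] by blast

lemma Y_nonzero: "i \<in> I \<Longrightarrow> a \<in> B \<Longrightarrow> y \<in> Y i a \<Longrightarrow> y \<noteq> 0"
  by (rule R.generating_family_nonzero[OF _ family_Y])

lemma X_nonzero: "b \<in> B \<Longrightarrow> j \<in> I \<Longrightarrow> x \<in> X b j \<Longrightarrow> x \<noteq> 0"
  by (rule L.generating_family_nonzero[OF _ family_X])

lemma Y_unique:
  assumes "i \<in> I" "a \<in> B" "y \<in> Y i a" "i' \<in> I" "a' \<in> B" "y \<in> Y i' a'"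
  shows "i' = i" "a' = a"
proof -
  note m = Y_mem[OF assms(1-3)] and m' = Y_mem[OF assms(4-6)] and nz = Y_nonzero[OF assms(1-3)]
  have *: "e i' * e i * y = y" "y * (e a * e a') = y" using m m' by (simp_all add: mult.assoc flip: mult.assoc[of y])
  show "i' = i" by (rule ccontr) (use *(1) nz orth[OF assms(4,1)] in simp)
  show "a' = a" by (rule ccontr) (use *(2) nz e_orth[OF assms(2,5)] in auto)
qed

lemma X_unique:
  assumes "b \<in> B" "j \<in> I" "x \<in> X b j" "b' \<in> B" "j' \<in> I" "x \<in> X b' j'"
  shows "b' = b" "j' = j"
proof -
  note m = X_mem[OF assms(1-3)] and m' = X_mem[OF assms(4-6)] and nz = X_nonzero[OF assms(1-3)]
  have *: "e b' * e b * x = x" "x * (e j * e j') = x" using m m' by (simp_all add: mult.assoc flip: mult.assoc[of x])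
  show "b' = b" by (rule ccontr) (use *(1) nz e_orth[OF assms(4,1)] in simp)
  show "j' = j" by (rule ccontr) (use *(2) nz orth[OF assms(2,5)] in auto)
qed

lemma Y_order:
  assumes "a \<in> B" "b \<in> B" "a \<noteq> b" "y \<in> Y b a"
  shows "(\<delta> b, \<delta> a) \<in> ord" "\<delta> b \<noteq> \<delta> a"
  using R.generating_family_order[OF BI[OF assms(2)] family_Y[OF BI[OF assms(2)]] assms(1,3,2) _ assms(4)]
    YX_diag[OF assms(2)] by simp_all

lemma X_order:
  assumes "a \<in> B" "b \<in> B" "a \<noteq> b" "x \<in> X a b"
  shows "(\<delta> b, \<delta> a) \<in> ord" "\<delta> b \<noteq> \<delta> a"
  using L.generating_family_order[OF BI[OF assms(2)] family_X[OF BI[OF assms(2)]] assms(1,3,2) _ assms(4)]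
    YX_diag[OF assms(2)] by simp_all

lemma H_mem: "a \<in> B \<Longrightarrow> b \<in> B \<Longrightarrow> h \<in> H a b \<Longrightarrow> h \<in> Acirc \<and> e a * h = h \<and> h * e b = h"
proof -
  assume a: "a \<in> B" and b: "b \<in> B" and h: "h \<in> H a b"
  have "h \<in> span (H a b)" using h by (rule span_base)
  also have "span (H a b) = peirce (e a) Acirc (e b)" using H[OF a b] by (simp add: is_basis_def)
  finally obtain c where c: "c \<in> Acirc" "h = e a * c * e b" unfolding peirce_def by blast
  have ea: "e a * (e a * z) = e a * z" for z using idem[OF BI[OF a]] by (simp flip: mult.assoc)
  show ?thesis
  proof (intro conjI)
    show "h \<in> Acirc" unfolding c(2) by (intro cartan_closed(2) cartan_closed(3) BI a b c(1))
    show "e a * h = h" "h * e b = h" unfolding c(2) using idem[OF BI[OF b]] ea by (simp_all add: mult.assoc)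
  qed
qed

lemma H_independent: "a \<in> B \<Longrightarrow> b \<in> B \<Longrightarrow> independent (H a b)"
  using H by (simp add: is_basis_def)

text \<open>
  The linear map \<open>A \<cong> A\<^sup>\<flat> \<otimes> A\<^sup>\<sharp> \<rightarrow> A\<^sup>\<circ>\<close>, \<open>u v \<mapsto> \<psi> u * \<chi> v\<close>, made of the coordinates with respect to \<open>y\<^sub>0\<close>
  and \<open>x\<^sub>0\<close>: it extracts the middle factor of the products \<open>y\<^sub>0 h x\<^sub>0\<close>.
\<close>

lemma middle_coordinate:
  assumes i0: "i0 \<in> I" and a0: "a0 \<in> B" and y0: "y0 \<in> Y i0 a0"
    and b0: "b0 \<in> B" and j0: "j0 \<in> I" and x0: "x0 \<in> X b0 j0"
  obtains G where "\<And>u v. G (u + v) = G u + G v" "\<And>c u. G (s c u) = s c (G u)"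
    "\<And>i a y b j x h. \<lbrakk>i \<in> I; a \<in> B; y \<in> Y i a; b \<in> B; j \<in> I; x \<in> X b j; h \<in> H a b\<rbrakk> \<Longrightarrow>
       G (y * h * x) = (if y = y0 \<and> x = x0 then h else 0)"
proof -
  obtain \<psi>' where fb: "R.column_basis i0 (Y i0) \<psi>'"
    using R.generating_family_basis[OF i0 family_Y[OF i0]] by blast
  obtain \<chi>' where sb: "L.column_basis j0 (\<lambda>b. X b j0) \<chi>'"
    using L.generating_family_basis[OF j0 family_X[OF j0]] by blast
  define \<psi> where "\<psi> = \<psi>' (a0, y0)"
  define \<chi> where "\<chi> = \<chi>' (b0, x0)"
  have t: "(a0, y0) \<in> Sigma B (Y i0)" "(b0, x0) \<in> Sigma B (\<lambda>b. X b j0)" using a0 y0 b0 x0 by simp_all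
  have \<psi>f: "R.functional (R.column i0) (e a0) \<psi>"
    using R.dual_basisD(3)[OF conjunct1[OF fb] t(1)] by (simp add: \<psi>_def)
  have \<chi>f: "L.functional (L.column j0) (e b0) \<chi>"
    using L.dual_basisD(3)[OF conjunct1[OF sb] t(2)] by (simp add: \<chi>_def)
  note \<psi>F = R.functionalD[OF \<psi>f] and \<chi>F = L.functionalD[OF \<chi>f]
  have lm: "e i0 * u \<in> R.column i0" if "u \<in> Aflat" for u by (rule R.columnI[OF that])
  have rm: "v * e j0 \<in> L.column j0" if "v \<in> Asharp" for v by (rule L.columnI[OF that])
  define \<beta> where "\<beta> u v = \<psi> (e i0 * u) * \<chi> (v * e j0)" for u v
  have "balanced Acirc Aflat Asharp \<beta>"
    unfolding balanced_def
  proof (intro conjI ballI allI)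
    fix x x' y assume "x \<in> Aflat" "x' \<in> Aflat"
    then show "\<beta> (x + x') y = \<beta> x y + \<beta> x' y"
      using \<psi>F(3)[OF lm lm, of x x'] by (simp add: \<beta>_def distrib_left distrib_right)
  next
    fix x y y' assume "y \<in> Asharp" "y' \<in> Asharp"
    then show "\<beta> x (y + y') = \<beta> x y + \<beta> x y'"
      using \<chi>F(3)[OF rm rm, of y y'] by (simp add: \<beta>_def distrib_left distrib_right)
  next
    fix c x y assume "x \<in> Aflat"
    then show "\<beta> (s c x) y = s c (\<beta> x y)"
      using R.functional_scale[OF \<psi>f R.column_module(1)[OF i0] lm, of x c]
      by (simp add: \<beta>_def scale_mult)
  next
    fix c x y assume "y \<in> Asharp"
    then show "\<beta> x (s c y) = s c (\<beta> x y)"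
      using L.functional_scale[OF \<chi>f L.column_module(1)[OF j0] rm, of y c]
      by (simp add: \<beta>_def scale_mult)
  next
    fix x d y assume "x \<in> Aflat" "d \<in> Acirc" "y \<in> Asharp"
    then show "\<beta> (x * d) y = \<beta> x (d * y)"
      using \<psi>F(4)[OF _ lm, of d x] \<chi>F(4)[OF _ rm, of d y] by (simp add: \<beta>_def mult.assoc)
  qed
  from tensor_iso_universal[OF TD5 this] obtain G where
    G: "\<And>x y. G (x + y) = G x + G y" "\<And>c x. G (s c x) = s c (G x)"
    "\<And>x y. x \<in> Aflat \<Longrightarrow> y \<in> Asharp \<Longrightarrow> G (x * y) = \<beta> x y" by blast
  show thesis
  proof (rule that[OF G(1,2)])
    fix i a y b j x h
    assume i: "i \<in> I" and a: "a \<in> B" and y: "y \<in> Y i a" and b: "b \<in> B" and j: "j \<in> I"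
      and x: "x \<in> X b j" and h: "h \<in> H a b"
    note ym = Y_mem[OF i a y] and xm = X_mem[OF b j x] and hm = H_mem[OF a b h]
    note y0m = Y_mem[OF i0 a0 y0] and x0m = X_mem[OF b0 j0 x0]
    have \<psi>0: "\<psi> 0 = 0"
      using \<psi>F(4)[OF L.C_zero, of y0] lm[of y0] y0m by simp
    have \<chi>0: "\<chi> 0 = 0"
      using \<chi>F(4)[OF L.C_zero, of x0] rm[of x0] x0m by simp
    have *: "\<psi> (e i0 * y) = (if y = y0 then e a0 else 0) \<and> (y = y0 \<longrightarrow> a = a0)"
    proof (cases "i = i0")
      case True
      have aa: "a = a0" if "y = y0" using Y_unique(2)[OF i0 a0 y0 i a] y that by simp
      have "(a, y) \<in> Sigma B (Y i0)" using a y True by simp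
      then have "\<psi> y = (if (a0, y0) = (a, y) then e a0 else 0)"
        using conjunct2[OF fb] t(1) by (auto simp: R.orthonormal_def \<psi>_def)
      then show ?thesis using True ym aa by auto
    next
      case False
      then have z: "e i0 * y = 0" using ym orth[OF i0 i] by (metis mult.assoc mult_zero_left)
      moreover have "y \<noteq> y0" using Y_unique(1)[OF i0 a0 y0 i a] y False by blast
      ultimately show ?thesis using \<psi>0 by simp
    qed
    have **: "\<chi> (x * e j0) = (if x = x0 then e b0 else 0) \<and> (x = x0 \<longrightarrow> b = b0)"
    proof (cases "j = j0")
      case True
      have bb: "b = b0" if "x = x0" using X_unique(1)[OF b0 j0 x0 b j] x that by simp
      have "(b, x) \<in> Sigma B (\<lambda>b. X b j0)" using b x True by simp
      then have "\<chi> x = (if (b0, x0) = (b, x) then e b0 else 0)"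
        using conjunct2[OF sb] t(2) by (auto simp: L.orthonormal_def \<chi>_def)
      then show ?thesis using True xm bb by auto
    next
      case False
      then have z: "x * e j0 = 0" using xm orth[OF j j0] by (metis mult.assoc mult_zero_right)
      moreover have "x \<noteq> x0" using X_unique(2)[OF b0 j0 x0 b j] x False by blast
      ultimately show ?thesis using \<chi>0 by simp
    qed
    have "h * x \<in> Asharp" using hm xm borel_closed(4) by blast
    then have "G (y * (h * x)) = \<psi> (e i0 * y) * \<chi> (h * x * e j0)" using G(3) ym by (simp add: \<beta>_def)
    also have "\<chi> (h * x * e j0) = h * \<chi> (x * e j0)"
      using \<chi>F(4)[of h "x * e j0"] hm rm[of x] xm by (simp add: mult.assoc)
    finally show "G (y * h * x) = (if y = y0 \<and> x = x0 then h else 0)"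
      using * ** hm by (auto simp: mult.assoc)
  qed
qed

text \<open>The index set of the triangular basis.\<close>

definition triples :: "('a \<times> 'a \<times> 'a) set" where
  "triples = (\<Union>a\<in>B. \<Union>b\<in>B. (\<Union>i\<in>I. Y i a) \<times> H a b \<times> (\<Union>j\<in>I. X b j))"

abbreviation "triple_product \<equiv> \<lambda>(y, h, x). y * h * x"

lemma triplesE:
  assumes "t \<in> triples"
  obtains a b i j y h x where "t = (y, h, x)" "a \<in> B" "b \<in> B" "i \<in> I" "j \<in> I"
    "y \<in> Y i a" "h \<in> H a b" "x \<in> X b j"
  using assms unfolding triples_def by blast

lemma H_nonzero: "a \<in> B \<Longrightarrow> b \<in> B \<Longrightarrow> h \<in> H a b \<Longrightarrow> h \<noteq> 0"
  using H_independent dependent_zero by blast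

lemma triple_product_inj: "inj_on triple_product triples"
proof (rule inj_onI)
  fix t t' assume t: "t \<in> triples" and t': "t' \<in> triples" and eq: "triple_product t = triple_product t'"
  from t obtain a b i j y h x where 1: "t = (y, h, x)" "a \<in> B" "b \<in> B" "i \<in> I" "j \<in> I"
    "y \<in> Y i a" "h \<in> H a b" "x \<in> X b j" by (rule triplesE)
  from t' obtain a' b' i' j' y' h' x' where 2: "t' = (y', h', x')" "a' \<in> B" "b' \<in> B" "i' \<in> I" "j' \<in> I"
    "y' \<in> Y i' a'" "h' \<in> H a' b'" "x' \<in> X b' j'" by (rule triplesE)
  obtain G where G: "\<And>i a y' b j x' h. \<lbrakk>i \<in> I; a \<in> B; y' \<in> Y i a; b \<in> B; j \<in> I; x' \<in> X b j; h \<in> H a b\<rbrakk> \<Longrightarrow>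
       G (y' * h * x') = (if y' = y \<and> x' = x then h else 0)"
    by (rule middle_coordinate[OF 1(4,2,6,3,5,8)]) (rule that)
  have "h = (if y' = y \<and> x' = x then h' else 0)"
    using G[OF 1(4,2,6,3,5,8,7)] G[OF 2(4,2,6,3,5,8,7)] eq 1(1) 2(1) by simp
  then show "t = t'" using H_nonzero[OF 1(2,3,7)] 1(1) 2(1) by (auto split: if_splits)
qed

lemma triple_product_independent: "independent (triple_product ` triples)"
proof
  assume "dependent (triple_product ` triples)"
  then obtain t where t: "t \<in> triples"
    and dep: "triple_product t \<in> span (triple_product ` triples - {triple_product t})"
    unfolding dependent_def by blast
  from t obtain a b i j y h x where 1: "t = (y, h, x)" "a \<in> B" "b \<in> B" "i \<in> I" "j \<in> I"
    "y \<in> Y i a" "h \<in> H a b" "x \<in> X b j" by (rule triplesE)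
  obtain G where G: "\<And>u v. G (u + v) = G u + G v" "\<And>c u. G (s c u) = s c (G u)"
    "\<And>i a y' b j x' h. \<lbrakk>i \<in> I; a \<in> B; y' \<in> Y i a; b \<in> B; j \<in> I; x' \<in> X b j; h \<in> H a b\<rbrakk> \<Longrightarrow>
       G (y' * h * x') = (if y' = y \<and> x' = x then h else 0)"
    by (rule middle_coordinate[OF 1(4,2,6,3,5,8)]) (rule that)
  let ?H = "span (H a b - {h})"
  have "subspace {v. G v \<in> ?H}"
    using G(1)[of 0 0] by (auto simp: subspace_def G(1,2) span_zero span_add span_scale)
  moreover have "triple_product ` triples - {triple_product t} \<subseteq> {v. G v \<in> ?H}"
  proof safe
    fix y' h' x' assume "(y', h', x') \<in> triples" and ne: "y' * h' * x' \<noteq> triple_product t"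
    then obtain a' b' i' j' where 2: "a' \<in> B" "b' \<in> B" "i' \<in> I" "j' \<in> I"
      "y' \<in> Y i' a'" "h' \<in> H a' b'" "x' \<in> X b' j'" by (elim triplesE) auto
    show "G (y' * h' * x') \<in> ?H"
    proof (cases "y' = y \<and> x' = x")
      case True
      then have "a' = a" "b' = b"
        using Y_unique(2)[OF 1(4,2,6) 2(3,1)] X_unique(1)[OF 1(3,5,8) 2(2,4)] 2 by simp_all
      moreover have "h' \<noteq> h" using ne True 1(1) by auto
      ultimately show ?thesis using G(3)[OF 2(3,1,5,2,4,7,6)] 2(6) True by (simp add: span_base)
    next
      case False
      then show ?thesis using G(3)[OF 2(3,1,5,2,4,7,6)] by (auto simp: span_zero)
    qed
  qed
  ultimately have "span (triple_product ` triples - {triple_product t}) \<subseteq> {v. G v \<in> ?H}"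
    by (intro span_minimal)
  then have "G (triple_product t) \<in> ?H" using dep by blast
  then have "h \<in> ?H" using G(3)[OF 1(4,2,6,3,5,8,7)] 1(1) by simp
  then show False using H_independent[OF 1(2,3)] 1(7) unfolding dependent_def by blast
qed

text \<open>
  \<open>A\<^sup>\<flat> = \<Sum> y A\<^sup>\<circ>\<close> and \<open>A\<^sup>\<sharp> = \<Sum> A\<^sup>\<circ> x\<close>, and \<open>A = A\<^sup>\<flat> A\<^sup>\<sharp>\<close> is spanned by the products \<open>y c x\<close> with \<open>c \<in> A\<^sup>\<circ>\<close>.
\<close>

lemma triple_product_span: "span (triple_product ` triples) = UNIV"
proof -
  let ?S = "span (triple_product ` triples)"
  have ycx: "y * c * x \<in> ?S" if y: "i \<in> I" "a \<in> B" "y \<in> Y i a" and x: "b \<in> B" "j \<in> I" "x \<in> X b j"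
    and c: "c \<in> Acirc" for i a y b j x c
  proof -
    have "e a * c * e b \<in> span (H a b)" using H[OF y(2) x(1)] c by (auto simp: is_basis_def peirce_def)
    then have "y * (e a * c * e b) * x \<in> span ((\<lambda>z. z * x) ` (*) y ` H a b)"
      by (intro span_mult_right span_mult_left)
    moreover have "(\<lambda>z. z * x) ` (*) y ` H a b \<subseteq> triple_product ` triples"
    proof safe
      fix h assume "h \<in> H a b"
      then have "(y, h, x) \<in> triples" using y x unfolding triples_def by blast
      then show "y * h * x \<in> triple_product ` triples" by force
    qed
    ultimately have "y * (e a * c * e b) * x \<in> ?S" using span_mono by blast
    moreover have "y * (e a * c * e b) * x = (y * e a) * c * (e b * x)" by (simp add: mult.assoc)
    ultimately show ?thesis using Y_mem[OF y] X_mem[OF x] by simp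
  qed
  have yv: "y * v \<in> ?S" if y: "i \<in> I" "a \<in> B" "y \<in> Y i a" and v: "v \<in> Asharp" for i a y v
  proof -
    obtain F where F: "finite F" "F \<subseteq> I" "v * (\<Sum>j\<in>F. e j) = v" by (rule local_unit1[of v])
    have "y * (v * e j) \<in> ?S" if j: "j \<in> F" for j
    proof -
      have jI: "j \<in> I" using j F(2) by auto
      obtain \<chi> where sb: "L.column_basis j (\<lambda>b. X b j) \<chi>"
        using L.generating_family_basis[OF jI family_X[OF jI]] by blast
      let ?K = "{t \<in> Sigma B (\<lambda>b. X b j). \<chi> t (v * e j) \<noteq> 0}"
      have vj: "v * e j \<in> L.column j" by (rule L.columnI[OF v])
      then have exp: "v * e j = (\<Sum>t\<in>?K. \<chi> t (v * e j) * snd t)"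
        using conjunct1[OF sb] unfolding L.dual_basis_def by blast
      have "y * (\<chi> t (v * e j) * snd t) \<in> ?S" if "t \<in> ?K" for t
      proof -
        have t: "t \<in> Sigma B (\<lambda>b. X b j)" using that by blast
        have "\<chi> t (v * e j) \<in> Acirc"
          using L.functionalD(1)[OF L.dual_basisD(3)[OF conjunct1[OF sb] t] vj] .
        then show ?thesis using ycx[OF y _ jI, of "fst t" "snd t"] t by (auto simp: mult.assoc)
      qed
      then have "(\<Sum>t\<in>?K. y * (\<chi> t (v * e j) * snd t)) \<in> ?S" by (rule span_sum)
      then have "y * (\<Sum>t\<in>?K. \<chi> t (v * e j) * snd t) \<in> ?S" by (simp only: sum_distrib_left)
      then show ?thesis by (simp only: exp[symmetric])
    qed
    then have "(\<Sum>j\<in>F. y * (v * e j)) \<in> ?S" by (rule span_sum)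
    then have "y * (v * (\<Sum>j\<in>F. e j)) \<in> ?S" by (simp only: sum_distrib_left)
    then show ?thesis using F(3) by simp
  qed
  have uv: "u * v \<in> ?S" if u: "u \<in> Aflat" and v: "v \<in> Asharp" for u v
  proof -
    obtain F where F: "finite F" "F \<subseteq> I" "(\<Sum>j\<in>F. e j) * u = u" by (rule local_unit1[of u])
    have "e i * u * v \<in> ?S" if i: "i \<in> F" for i
    proof -
      have iI: "i \<in> I" using i F(2) by auto
      obtain \<psi> where fb: "R.column_basis i (Y i) \<psi>"
        using R.generating_family_basis[OF iI family_Y[OF iI]] by blast
      let ?K = "{t \<in> Sigma B (Y i). \<psi> t (e i * u) \<noteq> 0}"
      have ui: "e i * u \<in> R.column i" by (rule R.columnI[OF u])
      then have exp: "e i * u = (\<Sum>t\<in>?K. snd t * \<psi> t (e i * u))"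
        using conjunct1[OF fb] unfolding R.dual_basis_def by blast
      have "snd t * \<psi> t (e i * u) * v \<in> ?S" if "t \<in> ?K" for t
      proof -
        have t: "t \<in> Sigma B (Y i)" using that by blast
        have "\<psi> t (e i * u) \<in> Acirc"
          using R.functionalD(1)[OF R.dual_basisD(3)[OF conjunct1[OF fb] t] ui] .
        then have "\<psi> t (e i * u) * v \<in> Asharp" using borel_closed(4) v by blast
        then show ?thesis using yv[OF iI, of "fst t" "snd t"] t by (auto simp: mult.assoc)
      qed
      then have "(\<Sum>t\<in>?K. snd t * \<psi> t (e i * u) * v) \<in> ?S" by (rule span_sum)
      then have "(\<Sum>t\<in>?K. snd t * \<psi> t (e i * u)) * v \<in> ?S" by (simp only: sum_distrib_right)
      then show ?thesis by (simp only: exp[symmetric])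
    qed
    then have "(\<Sum>i\<in>F. e i * u * v) \<in> ?S" by (rule span_sum)
    then have "(\<Sum>i\<in>F. e i) * u * v \<in> ?S" by (simp only: sum_distrib_right)
    then show ?thesis using F(3) by simp
  qed
  have "span {u * v | u v. u \<in> Aflat \<and> v \<in> Asharp} \<subseteq> ?S"
    using uv by (intro span_minimal) (auto simp: subspace_span)
  then show ?thesis using tensor_iso_span[OF TD5] by auto
qed

end

section \<open>The stratifying ideals\<close>

context k_algebra
begin

lemma ideal_generated_ideal:
  shows "subspace (ideal_generated s S)" "S \<subseteq> ideal_generated s S"
    and "y \<in> ideal_generated s S \<Longrightarrow> x * y \<in> ideal_generated s S"
    and "y \<in> ideal_generated s S \<Longrightarrow> y * x \<in> ideal_generated s S"
  by (auto simp: ideal_generated_def subspace_def)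

lemma ideal_generated_minimal:
  assumes "S \<subseteq> J" "subspace J" "\<And>x y. y \<in> J \<Longrightarrow> x * y \<in> J \<and> y * x \<in> J"
  shows "ideal_generated s S \<subseteq> J"
  using assms unfolding ideal_generated_def by blast

end

context triangular_decomposition_primitive
begin

text \<open>
  \<open>J l\<close> is the ideal with \<open>A\<^bsub>\<le>l\<^esub> = A / J l\<close>, and \<open>f l\<close> is the sum of the special idempotents of weight \<open>l\<close>.
\<close>

abbreviation "J l \<equiv> strat_ideal s B e \<Lambda> ord \<delta> l"
abbreviation "f l \<equiv> fibre_idem B \<delta> e l"

lemma J_ideal:
  shows "subspace (J l)" "y \<in> J l \<Longrightarrow> x * y \<in> J l" "y \<in> J l \<Longrightarrow> y * x \<in> J l"
  unfolding strat_ideal_def by (rule ideal_generated_ideal; assumption)+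

lemma finite_B_weight: "l \<in> \<Lambda> \<Longrightarrow> finite {b \<in> B. \<delta> b = l}"
  by (rule finite_subset[OF _ finite_weight[of l]]) (auto simp: BI)

lemma f_mult:
  assumes "b \<in> B" "l \<in> \<Lambda>" "\<delta> b = l"
  shows "f l * e b = e b" "e b * f l = e b"
  unfolding fibre_idem_def
  using mult_sum_left[of "{b \<in> B. \<delta> b = l}" b] mult_sum_right[of "{b \<in> B. \<delta> b = l}" b]
    finite_B_weight BI assms by (auto simp: subset_iff)

lemma f_idem: "l \<in> \<Lambda> \<Longrightarrow> f l * f l = f l"
  using mult_sum_sum(1)[of "{b \<in> B. \<delta> b = l}" "{b \<in> B. \<delta> b = l}"] finite_B_weight BI
  by (auto simp: fibre_idem_def)

lemma f_\<epsilon>: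
  assumes l: "l \<in> \<Lambda>"
  shows "\<epsilon> l * f l = f l" "f l * \<epsilon> l = f l"
proof -
  show "\<epsilon> l * f l = f l"
    unfolding fibre_idem_def sum_distrib_left
    by (rule sum.cong) (use l in \<open>auto simp: \<epsilon>_mult BI\<close>)
  show "f l * \<epsilon> l = f l"
    unfolding fibre_idem_def sum_distrib_right
    by (rule sum.cong) (use l in \<open>auto simp: \<epsilon>_mult BI\<close>)
qed

lemma f_mem: "f l \<in> Acirc"
  unfolding fibre_idem_def using cartan_closed(3) BI by (intro subspace_sum[OF cartan_closed(1)]) auto

text \<open>The corner \<open>f\<^sub>l A\<^sup>\<circ> f\<^sub>l\<close>, the basic algebra of the block of weight \<open>l\<close> of the Cartan subalgebra.\<close>

definition corner :: "'l \<Rightarrow> 'a set" where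
  "corner l = {c \<in> Acirc. f l * c = c \<and> c * f l = c}"

lemma corner_closed:
  shows "subspace (corner l)" "x \<in> corner l \<Longrightarrow> y \<in> corner l \<Longrightarrow> x * y \<in> corner l"
  using cartan_closed(1,2)
  by (auto simp: corner_def subspace_def distrib_left distrib_right scale_mult mult.assoc)
    (simp_all flip: mult.assoc)

lemma corner_e: "b \<in> B \<Longrightarrow> l \<in> \<Lambda> \<Longrightarrow> \<delta> b = l \<Longrightarrow> e b \<in> corner l"
  using f_mult cartan_closed(3)[OF BI] by (simp add: corner_def)

text \<open>
  \<open>J l\<close> is generated by special idempotents only, but contains \<open>e j\<close> for all \<open>j \<in> I\<close> of weight not below
  \<open>l\<close>: the primitive summands of \<open>e j\<close> factor through special idempotents of the same weight.
\<close>

lemma e_in_J: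
  assumes j: "j \<in> I" and nle: "(\<delta> j, l) \<notin> ord"
  shows "e j \<in> J l"
proof -
  obtain P where P: "finite P" "e j = \<Sum>P"
    "\<And>g. g \<in> P \<Longrightarrow> primitive_idempotent (subalgebra_ring Acirc) g"
    "\<And>g. g \<in> P \<Longrightarrow> e j * g = g" "\<And>g. g \<in> P \<Longrightarrow> g * e j = g"
    by (rule primitive_decomposition_of_unit[OF j]) (rule that)
  have "g \<in> J l" if g: "g \<in> P" for g
  proof -
    obtain b x y where b: "b \<in> B" and xy: "x \<in> Acirc" "y \<in> Acirc" "g = x * y" "x * e b = x" "e b * y = y"
      using primitive_factor[OF P(3)[OF g]] by blast
    have "\<delta> j = \<delta> b"
    proof (rule ccontr)
      assume "\<delta> j \<noteq> \<delta> b"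
      then have "e j * x * e b = 0" by (rule cartan_block[OF j BI[OF b] xy(1)])
      moreover have "g = e j * x * e b * y" using P(4)[OF g] xy(3,4) by (simp add: mult.assoc)
      ultimately have "g = 0" by simp
      then show False using P(3)[OF g] by (simp add: primitive_idempotent_subalgebra_iff)
    qed
    then have m: "\<delta> b \<in> \<Lambda>" "(\<delta> b, l) \<notin> ord" using nle weight_in[OF j] by simp_all
    have "f (\<delta> b) \<in> J l"
      unfolding strat_ideal_def using m by (intro subsetD[OF ideal_generated_ideal(2)]) blast
    then have "e b * f (\<delta> b) \<in> J l" by (rule J_ideal(2))
    then have "e b \<in> J l" using f_mult(2)[OF b m(1) refl] by simp
    then have "x * e b * y \<in> J l" by (intro J_ideal(2,3))
    then show "g \<in> J l" using xy by simp
  qed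
  then show ?thesis unfolding P(2) by (rule subspace_sum[OF J_ideal(1)])
qed

text \<open>
  The ideal \<open>J l\<close> is contained in \<open>K = \<Sum>\<^sub>i A\<^sup>\<flat> e\<^sub>i A\<^sup>\<sharp>\<close>, the sum over the weights \<open>\<delta> i \<not>\<le> l\<close>. That \<open>K\<close> is an
  ideal follows from the triangularity of the Borel subalgebras.
\<close>

definition K :: "'l \<Rightarrow> 'a set" where
  "K l = span {u * e i * v | u i v. u \<in> Aflat \<and> v \<in> Asharp \<and> i \<in> I \<and> (\<delta> i, l) \<notin> ord}"

lemma K_gen: "u \<in> Aflat \<Longrightarrow> v \<in> Asharp \<Longrightarrow> i \<in> I \<Longrightarrow> (\<delta> i, l) \<notin> ord \<Longrightarrow> u * e i * v \<in> K l"
  unfolding K_def by (intro span_base) blast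

lemma K_subspace: "subspace (K l)"
  unfolding K_def by (rule subspace_span)

lemma K_mult_borel:
  shows "k \<in> K l \<Longrightarrow> v \<in> Asharp \<Longrightarrow> k * v \<in> K l" "k \<in> K l \<Longrightarrow> u \<in> Aflat \<Longrightarrow> u * k \<in> K l"
proof -
  let ?S = "{u * e i * v | u i v. u \<in> Aflat \<and> v \<in> Asharp \<and> i \<in> I \<and> (\<delta> i, l) \<notin> ord}"
  show "k * v \<in> K l" if k: "k \<in> K l" and v: "v \<in> Asharp"
  proof -
    have "(\<lambda>y. y * v) ` ?S \<subseteq> K l"
    proof safe
      fix u i w assume "u \<in> Aflat" "w \<in> Asharp" "i \<in> I" "(\<delta> i, l) \<notin> ord"
      then have "u * e i * (w * v) \<in> K l" using v borel_closed(4) by (intro K_gen)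
      then show "u * e i * w * v \<in> K l" by (simp add: mult.assoc)
    qed
    then have "span ((\<lambda>y. y * v) ` ?S) \<subseteq> K l" using K_subspace by (rule span_minimal)
    then show ?thesis using span_mult_right[of k ?S v] k unfolding K_def by blast
  qed
  show "u * k \<in> K l" if k: "k \<in> K l" and u: "u \<in> Aflat"
  proof -
    have "(*) u ` ?S \<subseteq> K l"
    proof safe
      fix w i v assume "w \<in> Aflat" "v \<in> Asharp" "i \<in> I" "(\<delta> i, l) \<notin> ord"
      then have "(u * w) * e i * v \<in> K l" using u borel_closed(3) by (intro K_gen)
      then show "u * (w * e i * v) \<in> K l" by (simp add: mult.assoc)
    qed
    then have "span ((*) u ` ?S) \<subseteq> K l" using K_subspace by (rule span_minimal)
    then show ?thesis using span_mult_left[of k ?S u] k unfolding K_def by blast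
  qed
qed

lemma K_left_right:
  assumes i: "i \<in> I" and nle: "(\<delta> i, l) \<notin> ord"
  shows "z * e i \<in> K l" "e i * z \<in> K l"
proof -
  let ?S = "{u * v | u v. u \<in> Aflat \<and> v \<in> Asharp}"
  have z: "z \<in> span ?S" using tensor_iso_span[OF TD5] by simp
  have up: "(\<delta> j, l) \<notin> ord" if "(\<delta> i, \<delta> j) \<in> ord" for j using ord_trans that nle by blast
  have "(\<lambda>y. y * e i) ` ?S \<subseteq> K l"
  proof safe
    fix u v assume u: "u \<in> Aflat" and v: "v \<in> Asharp"
    obtain F where F: "finite F" "F \<subseteq> I" "(\<Sum>j\<in>F. e j) * v = v" by (rule local_unit1[of v])
    have "u * (e j * v * e i) \<in> K l" if j: "j \<in> F" for j
    proof (cases "e j * v * e i = 0")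
      case False
      have jI: "j \<in> I" using j F(2) by auto
      have "u * e j * (v * e i) \<in> K l"
        using up[OF sharp_order[OF jI i v False]] borel_closed(4)[OF v borel_closed(6)[OF i]]
        by (intro K_gen u jI)
      then show ?thesis by (simp add: mult.assoc)
    qed (simp add: subspace_0[OF K_subspace])
    then have "(\<Sum>j\<in>F. u * (e j * v * e i)) \<in> K l" by (rule subspace_sum[OF K_subspace])
    then have "u * ((\<Sum>j\<in>F. e j) * v * e i) \<in> K l" by (simp only: sum_distrib_left sum_distrib_right)
    then show "u * v * e i \<in> K l" using F(3) by (simp add: mult.assoc)
  qed
  then have "span ((\<lambda>y. y * e i) ` ?S) \<subseteq> K l" using K_subspace by (rule span_minimal)
  then show "z * e i \<in> K l" using span_mult_right[OF z] by blast
  have "(*) (e i) ` ?S \<subseteq> K l"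
  proof safe
    fix u v assume u: "u \<in> Aflat" and v: "v \<in> Asharp"
    obtain F where F: "finite F" "F \<subseteq> I" "u * (\<Sum>j\<in>F. e j) = u" by (rule local_unit1[of u])
    have "e i * u * e j * v \<in> K l" if j: "j \<in> F" for j
    proof (cases "e i * u * e j = 0")
      case False
      have jI: "j \<in> I" using j F(2) by auto
      show ?thesis
        using up[OF flat_order[OF i jI u False]] borel_closed(3)[OF borel_closed(5)[OF i] u]
        by (intro K_gen v jI)
    qed (simp add: subspace_0[OF K_subspace])
    then have "(\<Sum>j\<in>F. e i * u * e j * v) \<in> K l" by (rule subspace_sum[OF K_subspace])
    then have "e i * (u * (\<Sum>j\<in>F. e j)) * v \<in> K l"
      by (simp only: sum_distrib_left sum_distrib_right mult.assoc)
    then show "e i * (u * v) \<in> K l" using F(3) by (simp add: mult.assoc)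
  qed
  then have "span ((*) (e i) ` ?S) \<subseteq> K l" using K_subspace by (rule span_minimal)
  then show "e i * z \<in> K l" using span_mult_left[OF z] by blast
qed

lemma J_subset_K: "J l \<subseteq> K l"
  unfolding strat_ideal_def
proof (rule ideal_generated_minimal[OF _ K_subspace])
  show "{f m | m. m \<in> \<Lambda> \<and> (m, l) \<notin> ord} \<subseteq> K l"
  proof safe
    fix m assume m: "m \<in> \<Lambda>" "(m, l) \<notin> ord"
    have "e b \<in> K l" if "b \<in> B" "\<delta> b = m" for b
      using K_left_right(1)[OF BI[OF that(1)], of l "e b"] m that idem[OF BI[OF that(1)]] by simp
    then show "f m \<in> K l" unfolding fibre_idem_def by (intro subspace_sum[OF K_subspace]) auto
  qed
  fix x y assume y: "y \<in> K l"
  let ?S = "{u * e i * v | u i v. u \<in> Aflat \<and> v \<in> Asharp \<and> i \<in> I \<and> (\<delta> i, l) \<notin> ord}"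
  have "(*) x ` ?S \<subseteq> K l"
  proof safe
    fix u i v assume *: "u \<in> Aflat" "v \<in> Asharp" "i \<in> I" "(\<delta> i, l) \<notin> ord"
    have "x * u * e i * v \<in> K l" by (intro K_mult_borel(1) K_left_right(1) *)
    then show "x * (u * e i * v) \<in> K l" by (simp add: mult.assoc)
  qed
  then have "span ((*) x ` ?S) \<subseteq> K l" using K_subspace by (rule span_minimal)
  moreover have "(\<lambda>z. z * x) ` ?S \<subseteq> K l"
  proof safe
    fix u i v assume *: "u \<in> Aflat" "v \<in> Asharp" "i \<in> I" "(\<delta> i, l) \<notin> ord"
    have "u * (e i * (v * x)) \<in> K l" by (intro K_mult_borel(2) K_left_right(2) *)
    then show "u * e i * v * x \<in> K l" by (simp add: mult.assoc)
  qed
  then have "span ((\<lambda>z. z * x) ` ?S) \<subseteq> K l" using K_subspace by (rule span_minimal)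
  ultimately show "x * y \<in> K l \<and> y * x \<in> K l"
    using span_mult_left[of y ?S x] span_mult_right[of y ?S x] y unfolding K_def by blast
qed

text \<open>
  The linear map \<open>u v \<mapsto> (\<epsilon>\<^sub>l u \<epsilon>\<^sub>l) (\<epsilon>\<^sub>l v \<epsilon>\<^sub>l)\<close> is the identity on the corner and vanishes on \<open>K\<close>.
\<close>

lemma corner_meets_J:
  assumes l: "l \<in> \<Lambda>" and c: "c \<in> corner l" "c \<in> J l"
  shows "c = 0"
proof -
  define \<beta> where "\<beta> u v = (\<epsilon> l * u * \<epsilon> l) * (\<epsilon> l * v * \<epsilon> l)" for u v
  have \<epsilon>\<epsilon>: "\<epsilon> l * (\<epsilon> l * z) = \<epsilon> l * z" for z using \<epsilon>_idem[OF l] by (simp flip: mult.assoc)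
  have "balanced Acirc Aflat Asharp \<beta>"
    unfolding balanced_def
  proof (intro conjI ballI allI)
    fix x d y assume d: "d \<in> Acirc"
    have "d * (\<epsilon> l * z) = \<epsilon> l * (d * z)" for z using \<epsilon>_central[OF d l] by (simp flip: mult.assoc)
    then show "\<beta> (x * d) y = \<beta> x (d * y)" by (simp add: \<beta>_def mult.assoc \<epsilon>\<epsilon>)
  qed (simp_all add: \<beta>_def distrib_left distrib_right scale_mult)
  from tensor_iso_universal[OF TD5 this] obtain G where
    G: "\<And>x y. G (x + y) = G x + G y" "\<And>c x. G (s c x) = s c (G x)"
    "\<And>x y. x \<in> Aflat \<Longrightarrow> y \<in> Asharp \<Longrightarrow> G (x * y) = \<beta> x y" by blast
  have "subspace {x. G x = 0}"
    using G(1)[of 0 0] by (auto simp: subspace_def G(1,2))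
  moreover have "{u * e i * v | u i v. u \<in> Aflat \<and> v \<in> Asharp \<and> i \<in> I \<and> (\<delta> i, l) \<notin> ord} \<subseteq> {x. G x = 0}"
  proof safe
    fix u i v assume *: "u \<in> Aflat" "v \<in> Asharp" "i \<in> I" "(\<delta> i, l) \<notin> ord"
    have "(l, l) \<in> ord" using TD1(1) l by (auto simp: partial_order_on_def preorder_on_def refl_on_def)
    then have "e i * \<epsilon> l = 0" using * \<epsilon>_mult(2)[OF *(3) l] by auto
    then show "G (u * e i * v) = 0"
      using G(3)[of "u * e i" v] * borel_closed(3)[OF *(1) borel_closed(5)[OF *(3)]]
      by (simp add: \<beta>_def mult.assoc)
  qed
  ultimately have "K l \<subseteq> {x. G x = 0}" unfolding K_def by (rule span_minimal[rotated])
  then have "G c = 0" using c(2) J_subset_K by blast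
  moreover have "G (c * f l) = \<beta> c (f l)" using c(1) f_mem by (intro G(3)) (auto simp: corner_def)
  moreover have "\<beta> c (f l) = c"
  proof -
    have fc: "f l * c = c" "c * f l = c" using c(1) by (auto simp: corner_def)
    have "\<epsilon> l * c = c" "c * \<epsilon> l = c" using f_\<epsilon>[OF l] fc by (metis mult.assoc)+
    then show ?thesis using f_\<epsilon>[OF l] fc by (simp add: \<beta>_def)
  qed
  ultimately show ?thesis using c(1) by (simp add: corner_def)
qed

text \<open>
  Modulo \<open>J l\<close> only the terms \<open>f l u e j v f l\<close> with \<open>\<delta> j = l\<close> survive, and these lie in the corner.
\<close>

lemma corner_covers:
  assumes l: "l \<in> \<Lambda>"
  shows "\<exists>c\<in>corner l. f l * x * f l - c \<in> J l"
proof -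
  let ?T = "{x. \<exists>c\<in>corner l. f l * x * f l - c \<in> J l}"
  have T: "subspace ?T"
    unfolding subspace_def
  proof safe
    show "\<exists>c\<in>corner l. f l * 0 * f l - c \<in> J l"
      using subspace_0[OF corner_closed(1)] subspace_0[OF J_ideal(1)] by (intro bexI[of _ 0]) simp_all
  next
    fix x y c d assume "c \<in> corner l" "f l * x * f l - c \<in> J l" "d \<in> corner l" "f l * y * f l - d \<in> J l"
    then show "\<exists>c\<in>corner l. f l * (x + y) * f l - c \<in> J l"
      using subspace_add[OF corner_closed(1), of c l d] subspace_add[OF J_ideal(1)]
      by (intro bexI[of _ "c + d"]) (auto simp: distrib_left distrib_right add_diff_add)
  next
    fix a x c assume "c \<in> corner l" "f l * x * f l - c \<in> J l"
    then show "\<exists>c\<in>corner l. f l * (s a x) * f l - c \<in> J l"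
      using subspace_scale[OF corner_closed(1), of c l a] subspace_scale[OF J_ideal(1), of _ l a]
      by (intro bexI[of _ "s a c"]) (auto simp: scale_mult simp flip: scale_right_diff_distrib)
  qed
  have uv: "u * v \<in> ?T" if u: "u \<in> Aflat" and v: "v \<in> Asharp" for u v
  proof -
    obtain F where F: "finite F" "F \<subseteq> I" "u * (\<Sum>j\<in>F. e j) = u" by (rule local_unit1[of u])
    have "u * e j * v \<in> ?T" if j: "j \<in> F" for j
    proof -
      have jI: "j \<in> I" using j F(2) by auto
      show ?thesis
      proof (cases "\<delta> j = l")
        case True
        have "f l * u * e j \<in> Acirc" "e j * v * f l \<in> Acirc"
          unfolding fibre_idem_def sum_distrib_left sum_distrib_right
          by (intro subspace_sum[OF cartan_closed(1)] same_weight_mem;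
              use True BI jI u v in auto)+
        then have "(f l * u * e j) * (e j * v * f l) \<in> Acirc" by (rule cartan_closed(2))
        moreover have "(f l * u * e j) * (e j * v * f l) = f l * (u * e j * v) * f l"
        proof -
          have "(f l * u * e j) * (e j * v * f l) = f l * u * (e j * e j) * v * f l" by (simp add: mult.assoc)
          then show ?thesis by (simp add: idem[OF jI] mult.assoc)
        qed
        ultimately have "f l * (u * e j * v) * f l \<in> Acirc" by simp
        moreover have "f l * (f l * z) = f l * z" for z using f_idem[OF l] by (simp flip: mult.assoc)
        ultimately have "f l * (u * e j * v) * f l \<in> corner l"
          using f_idem[OF l] by (simp add: corner_def mult.assoc)
        then show ?thesis
          using subspace_0[OF J_ideal(1)] by (intro CollectI bexI[of _ "f l * (u * e j * v) * f l"]) simp_all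
      next
        case False
        have "f l * (u * e j * v) * f l \<in> J l"
        proof (cases "(\<delta> j, l) \<in> ord")
          case True
          have "e b * u * e j = 0" if b: "b \<in> B" "\<delta> b = l" for b
            using flat_order[OF BI[OF b(1)] jI u] ord_antisym True False b by blast
          then have "f l * u * e j = 0" by (simp add: fibre_idem_def sum_distrib_right)
          then have "f l * (u * e j * v) * f l = 0" by (simp flip: mult.assoc)
          then show ?thesis using subspace_0[OF J_ideal(1)] by simp
        next
          case False
          then show ?thesis by (intro J_ideal(2,3) e_in_J jI)
        qed
        then show ?thesis
          using subspace_0[OF corner_closed(1)] by (intro CollectI bexI[of _ 0]) simp_all
      qed
    qed
    then have "(\<Sum>j\<in>F. u * e j * v) \<in> ?T" by (rule subspace_sum[OF T])
    then have "u * (\<Sum>j\<in>F. e j) * v \<in> ?T" by (simp only: sum_distrib_left sum_distrib_right)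
    then show ?thesis using F(3) by simp
  qed
  have "span {u * v | u v. u \<in> Aflat \<and> v \<in> Asharp} \<subseteq> ?T"
    by (rule span_minimal[OF _ T]) (use uv in blast)
  then show ?thesis using tensor_iso_span[OF TD5] by auto
qed

end

section \<open>The strata\<close>

text \<open>A ring \<open>R\<close> identified by \<open>\<pi>\<close> with a subring \<open>D\<close> of \<open>'a\<close>.\<close>

locale ring_image =
  fixes R (structure) and D :: "'a::ring set" and \<pi> :: "'a \<Rightarrow> 'c"
  assumes carrier: "carrier R = \<pi> ` D"
    and mult: "x \<in> D \<Longrightarrow> y \<in> D \<Longrightarrow> \<pi> x \<otimes> \<pi> y = \<pi> (x * y)"
    and add: "x \<in> D \<Longrightarrow> y \<in> D \<Longrightarrow> \<pi> x \<oplus> \<pi> y = \<pi> (x + y)"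
    and zero: "\<zero> = \<pi> 0"
    and inj: "inj_on \<pi> D"
    and D_zero: "0 \<in> D" and D_add: "x \<in> D \<Longrightarrow> y \<in> D \<Longrightarrow> x + y \<in> D"
    and D_mult: "x \<in> D \<Longrightarrow> y \<in> D \<Longrightarrow> x * y \<in> D"
begin

lemma eq_iff: "x \<in> D \<Longrightarrow> y \<in> D \<Longrightarrow> \<pi> x = \<pi> y \<longleftrightarrow> x = y"
  using inj by (auto simp: inj_on_def)

lemma primitive_idempotent_image:
  assumes "primitive_idempotent (subalgebra_ring D) x"
  shows "primitive_idempotent R (\<pi> x)"
proof -
  have x: "x \<in> D" "x * x = x" "x \<noteq> 0" and no: "\<And>g h. \<lbrakk>g \<in> D; h \<in> D; g * g = g; h * h = h; g * h = 0;
      h * g = 0; x = g + h\<rbrakk> \<Longrightarrow> g = 0 \<or> h = 0"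
    using assms by (auto simp: primitive_idempotent_subalgebra_iff)
  have "\<not> (idempotent R p \<and> idempotent R q \<and> p \<noteq> \<zero> \<and> q \<noteq> \<zero> \<and> p \<otimes> q = \<zero> \<and> q \<otimes> p = \<zero> \<and>
      \<pi> x = p \<oplus> q)" for p q
  proof
    assume *: "idempotent R p \<and> idempotent R q \<and> p \<noteq> \<zero> \<and> q \<noteq> \<zero> \<and> p \<otimes> q = \<zero> \<and> q \<otimes> p = \<zero> \<and>
      \<pi> x = p \<oplus> q"
    then obtain g h where gh: "g \<in> D" "p = \<pi> g" "h \<in> D" "q = \<pi> h"
      by (auto simp: idempotent_def carrier)
    then have "g * g = g" "h * h = h" "g * h = 0" "h * g = 0" "x = g + h" "g \<noteq> 0" "h \<noteq> 0"
      using * x(1) by (auto simp: idempotent_def mult add zero eq_iff D_mult D_add D_zero)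
    then show False using no gh by blast
  qed
  moreover have "idempotent R (\<pi> x)" using x by (simp add: idempotent_def carrier mult)
  moreover have "\<pi> x \<noteq> \<zero>" using x by (simp add: zero eq_iff D_zero)
  ultimately show ?thesis unfolding primitive_idempotent_def by blast
qed

lemma abelian_monoid: "abelian_monoid R"
  by (rule abelian_monoidI) (auto simp: carrier add zero D_add D_zero ac_simps)

lemma finsum_image: "finite F \<Longrightarrow> g ` F \<subseteq> D \<Longrightarrow> finsum R (\<lambda>b. \<pi> (g b)) F = \<pi> (\<Sum>b\<in>F. g b)"
proof (induction F rule: finite_induct)
  case empty
  show ?case by (simp add: abelian_monoid.finsum_empty[OF abelian_monoid] zero)
next
  case (insert b F)
  have "(\<Sum>b\<in>F. g b) \<in> D"
    using insert.hyps(1) insert.prems by (induction F rule: finite_induct) (auto simp: D_zero D_add)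
  then show ?case
    using insert by (simp add: abelian_monoid.finsum_insert[OF abelian_monoid] carrier image_subset_iff add)
qed

text \<open>An isomorphism \<open>R e \<cong> R e'\<close> and its inverse are right multiplications by \<open>p\<close> and \<open>q\<close>.\<close>

lemma isomorphic_left_ideals_elements:
  assumes iso: "isomorphic_left_ideals R (\<pi> x) (\<pi> y)"
    and x: "x \<in> D" "x * x = x" and y: "y \<in> D" "y * y = y"
  shows "\<exists>p\<in>D. \<exists>q\<in>D. x * p = p \<and> p * y = p \<and> y * q = q \<and> q * x = q \<and> p * q = x \<and> q * p = y"
proof -
  define M where "M = {r \<otimes> \<pi> x | r. r \<in> carrier R}"
  define N where "N = {r \<otimes> \<pi> y | r. r \<in> carrier R}"
  have M: "M = \<pi> ` {d \<in> D. d * x = d}" and N: "N = \<pi> ` {d \<in> D. d * y = d}"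
  proof -
    have *: "{r \<otimes> \<pi> z | r. r \<in> carrier R} = \<pi> ` {d \<in> D. d * z = d}" if z: "z \<in> D" "z * z = z" for z
    proof safe
      fix r assume "r \<in> carrier R"
      then obtain d where d: "d \<in> D" "r = \<pi> d" by (auto simp: carrier)
      then have "r \<otimes> \<pi> z = \<pi> (d * z)" "d * z \<in> D" "d * z * z = d * z"
        using z by (simp_all add: mult D_mult mult.assoc)
      then show "r \<otimes> \<pi> z \<in> \<pi> ` {d \<in> D. d * z = d}" by blast
    next
      fix d assume d: "d \<in> D" "d * z = d"
      then have "\<pi> d = \<pi> d \<otimes> \<pi> z" using z by (simp add: mult)
      then show "\<exists>r. \<pi> d = r \<otimes> \<pi> z \<and> r \<in> carrier R" using d by (auto simp: carrier)
    qed
    show "M = \<pi> ` {d \<in> D. d * x = d}" "N = \<pi> ` {d \<in> D. d * y = d}"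
      unfolding M_def N_def by (rule *[OF x], rule *[OF y])
  qed
  have "\<exists>\<phi>. bij_betw \<phi> M N \<and> (\<forall>m\<in>M. \<forall>n\<in>M. \<phi> (m \<oplus> n) = \<phi> m \<oplus> \<phi> n) \<and>
      (\<forall>r\<in>carrier R. \<forall>m\<in>M. \<phi> (r \<otimes> m) = r \<otimes> \<phi> m)"
    using iso unfolding isomorphic_left_ideals_def Let_def M_def N_def .
  then obtain \<phi> where bij: "bij_betw \<phi> M N"
    and lin: "\<And>r m. r \<in> carrier R \<Longrightarrow> m \<in> M \<Longrightarrow> \<phi> (r \<otimes> m) = r \<otimes> \<phi> m"
    by auto
  have xM: "\<pi> x \<in> M" and yN: "\<pi> y \<in> N" using x y by (auto simp: M N)
  have "\<phi> (\<pi> x) \<in> N" using bij xM by (rule bij_betw_apply)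
  then obtain p where p: "p \<in> D" "p * y = p" "\<phi> (\<pi> x) = \<pi> p" by (auto simp: N)
  obtain m where "m \<in> M" "\<phi> m = \<pi> y" using bij yN unfolding bij_betw_def by (metis imageE)
  then obtain q where q: "q \<in> D" "q * x = q" "\<phi> (\<pi> q) = \<pi> y" by (auto simp: M)
  have qM: "\<pi> q \<in> M" using q by (auto simp: M)
  have car: "\<pi> d \<in> carrier R" if "d \<in> D" for d using that by (simp add: carrier)
  have "\<pi> (x * p) = \<pi> p" using lin[OF car[OF x(1)] xM] x p by (simp add: mult)
  then have xp: "x * p = p" using x p by (simp add: eq_iff D_mult)
  have "\<pi> (q * p) = \<pi> y" using lin[OF car[OF q(1)] xM] q x p by (simp add: mult)
  then have qp: "q * p = y" using q p y by (simp add: eq_iff D_mult)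
  have yqM: "\<pi> (y * q) \<in> M" using q y by (auto simp: M D_mult mult.assoc)
  have "\<phi> (\<pi> (y * q)) = \<phi> (\<pi> q)" using lin[OF car[OF y(1)] qM] q y by (simp add: mult)
  then have "\<pi> (y * q) = \<pi> q" using bij yqM qM by (auto simp: bij_betw_def inj_on_eq_iff)
  then have yq: "y * q = q" using y q by (simp add: eq_iff D_mult)
  have pqM: "\<pi> (p * q) \<in> M" using p q by (auto simp: M D_mult mult.assoc)
  have "\<phi> (\<pi> (p * q)) = \<phi> (\<pi> x)" using lin[OF car[OF p(1)] qM] q y p by (simp add: mult)
  then have "\<pi> (p * q) = \<pi> x" using bij pqM xM by (auto simp: bij_betw_def inj_on_eq_iff)
  then have "p * q = x" using p q x by (simp add: eq_iff D_mult)
  then show ?thesis using xp yq qp p q by blast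
qed

end

text \<open>Orthogonal idempotents related by \<open>p q = x\<close>, \<open>q p = y\<close> are exchanged by the unit \<open>p + q\<close>.\<close>

lemma conjugate_of_isomorphic:
  fixes x y :: "'a::ring"
  assumes C: "x \<in> C" "y \<in> C" "p \<in> C" "q \<in> C" "\<And>a b. a \<in> C \<Longrightarrow> b \<in> C \<Longrightarrow> a + b \<in> C"
    and x: "x * x = x" and y: "y * y = y" and o: "x * y = 0" "y * x = 0"
    and p: "x * p = p" "p * y = p" and q: "y * q = q" "q * x = q" and pq: "p * q = x" "q * p = y"
  shows "conjugate_idempotents (subalgebra_ring C) x y"
  unfolding conjugate_idempotents_subalgebra_iff
proof (intro exI conjI)
  have z: "p * p = 0" "q * q = 0" "x * q = 0" "q * y = 0" "y * p = 0" "p * x = 0"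
    using o p q by (metis mult.assoc mult_zero_left mult_zero_right)+
  show "x + y \<in> C" using C by simp
  show "(x + y) * (x + y) = x + y" using x y o by (simp add: distrib_left distrib_right)
  show "(p + q) * (p + q) = x + y" "(p + q) * (p + q) = x + y"
    using z pq by (simp_all add: distrib_left distrib_right)
  show "(p + q) * x * (p + q) = y" using z x p q pq by (simp add: distrib_left distrib_right mult.assoc)
  have "(x + y) * x * (x + y) = x" "(x + y) * y * (x + y) = y"
    "(x + y) * (p + q) * (x + y) = p + q"
    using x y o p q z by (simp_all add: distrib_left distrib_right mult.assoc)
  then show "{x, y, p + q, p + q} \<subseteq> {(x + y) * z * (x + y) | z. z \<in> C}"
    using C by (auto intro: sym)
qed

context triangular_decomposition_primitive
begin

text \<open>The image of \<open>x\<close> in \<open>A\<^bsub>\<le>l\<^esub>\<close>, and the algebra \<open>A\<^sub>l\<close>.\<close>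

abbreviation "bar l \<equiv> strat_bar s B e \<Lambda> ord \<delta> l"
abbreviation "stratum l \<equiv> strat_algebra s B e \<Lambda> ord \<delta> l"

lemma bar_eq: "bar l x = {y. y - x \<in> J l}"
proof -
  have "y - x \<in> J l \<Longrightarrow> \<exists>h\<in>J l. y = h + x" for y by (intro bexI[of _ "y - x"]) simp_all
  then show ?thesis
    by (auto simp: strat_bar_def a_r_coset_def' subalgebra_ring_def)
qed

lemma bar_eq_iff: "bar l x = bar l y \<longleftrightarrow> x - y \<in> J l"
proof
  assume "bar l x = bar l y"
  moreover have "x \<in> bar l x" using subspace_0[OF J_ideal(1)] by (simp add: bar_eq)
  ultimately show "x - y \<in> J l" by (simp add: bar_eq)
next
  assume xy: "x - y \<in> J l"
  have "z - x \<in> J l \<longleftrightarrow> z - y \<in> J l" for z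
    using subspace_add[OF J_ideal(1) _ xy, of "z - x"] subspace_diff[OF J_ideal(1) _ xy, of "z - y"] by auto
  then show "bar l x = bar l y" by (simp add: bar_eq)
qed

lemma stratum_ops:
  shows "bar l x \<otimes>\<^bsub>stratum l\<^esub> bar l y = bar l (x * y)" "bar l x \<oplus>\<^bsub>stratum l\<^esub> bar l y = bar l (x + y)"
    "\<zero>\<^bsub>stratum l\<^esub> = bar l 0" "\<one>\<^bsub>stratum l\<^esub> = bar l (f l)"
    "carrier (stratum l) = {bar l (f l * x * f l) | x. True}"
proof -
  let ?Q = "subalgebra_ring UNIV Quot J l"
  have coset: "J l +>\<^bsub>subalgebra_ring UNIV\<^esub> x = bar l x" for x by (simp add: strat_bar_def)
  have mem: "x \<in> bar l x" for x using subspace_0[OF J_ideal(1)] by (simp add: bar_eq)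
  have mult: "bar l x \<otimes>\<^bsub>?Q\<^esub> bar l y = bar l (x * y)" for x y
  proof -
    have "bar l (a * b) = bar l (x * y)" if "a \<in> bar l x" "b \<in> bar l y" for a b
    proof -
      have "a * b - x * y = a * (b - y) + (a - x) * y" by (simp add: algebra_simps)
      also have "\<dots> \<in> J l" using that by (intro subspace_add[OF J_ideal(1)] J_ideal(2,3)) (simp_all add: bar_eq)
      finally show ?thesis by (simp add: bar_eq_iff)
    qed
    then have "(\<Union>a\<in>bar l x. \<Union>b\<in>bar l y. bar l (a * b)) = bar l (x * y)"
      using mem by blast
    then show ?thesis by (simp add: FactRing_def rcoset_mult_def coset) (simp add: subalgebra_ring_def)
  qed
  have add: "bar l x \<oplus>\<^bsub>?Q\<^esub> bar l y = bar l (x + y)" for x y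
  proof -
    have "a + b \<in> bar l (x + y)" if "a \<in> bar l x" "b \<in> bar l y" for a b
      using subspace_add[OF J_ideal(1), of "a - x" l "b - y"] that by (simp add: bar_eq algebra_simps)
    moreover have "\<exists>a\<in>bar l x. \<exists>b\<in>bar l y. c = a + b" if "c \<in> bar l (x + y)" for c
      using that mem[of y] by (intro bexI[of _ "c - y"] bexI[of _ y]) (simp_all add: bar_eq algebra_simps)
    ultimately show ?thesis
      by (auto simp: FactRing_def set_add_def' subalgebra_ring_def)
  qed
  show "bar l x \<otimes>\<^bsub>stratum l\<^esub> bar l y = bar l (x * y)" "bar l x \<oplus>\<^bsub>stratum l\<^esub> bar l y = bar l (x + y)"
    using mult add by (simp_all add: strat_algebra_def corner_ring_def)
  show "\<zero>\<^bsub>stratum l\<^esub> = bar l 0" by (simp add: strat_algebra_def corner_ring_def FactRing_def bar_eq)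
  show "\<one>\<^bsub>stratum l\<^esub> = bar l (f l)" by (simp add: strat_algebra_def corner_ring_def)
  have "carrier ?Q = range (bar l)"
    by (auto simp: FactRing_def A_RCOSETS_def' coset) (auto simp: subalgebra_ring_def)
  then have "carrier (stratum l) =
      {bar l (f l) \<otimes>\<^bsub>?Q\<^esub> Z \<otimes>\<^bsub>?Q\<^esub> bar l (f l) | Z. Z \<in> range (bar l)}"
    by (simp add: strat_algebra_def corner_ring_def)
  also have "\<dots> = {bar l (f l) \<otimes>\<^bsub>?Q\<^esub> bar l x \<otimes>\<^bsub>?Q\<^esub> bar l (f l) | x. True}" by blast
  finally show "carrier (stratum l) = {bar l (f l * x * f l) | x. True}" by (simp add: mult)
qed

text \<open>The algebra \<open>A\<^sub>l\<close> is isomorphic to the corner \<open>f\<^sub>l A\<^sup>\<circ> f\<^sub>l\<close>.\<close>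

lemma stratum_ring_image:
  assumes l: "l \<in> \<Lambda>"
  shows "ring_image (stratum l) (corner l) (bar l)"
proof
  have "bar l (f l * x * f l) \<in> bar l ` corner l" for x
    using corner_covers[OF l, of x] by (auto simp: image_iff bar_eq_iff)
  moreover have "c = f l * c * f l" if "c \<in> corner l" for c using that by (simp add: corner_def)
  ultimately show "carrier (stratum l) = bar l ` corner l"
    unfolding stratum_ops(5) by (auto intro: exI) (metis image_eqI)
  show "inj_on (bar l) (corner l)"
  proof (rule inj_onI)
    fix x y assume *: "x \<in> corner l" "y \<in> corner l" "bar l x = bar l y"
    then have "x - y = 0"
      by (intro corner_meets_J[OF l]) (auto simp: bar_eq_iff intro: subspace_diff[OF corner_closed(1)])
    then show "x = y" by simp
  qed
qed (auto simp: stratum_ops intro: subspace_0[OF corner_closed(1)] subspace_add[OF corner_closed(1)]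
    corner_closed(2))

text \<open>
  An isomorphism \<open>A\<^sub>l e b \<cong> A\<^sub>l e c\<close> would make the idempotents \<open>e b\<close> and \<open>e c\<close> conjugate in \<open>A\<^sup>\<circ>\<close>.
\<close>

proposition stratum_basic:
  assumes l: "l \<in> \<Lambda>"
  shows "basic_ring (stratum l)"
    and "primitive_decomposition (stratum l) {b \<in> B. \<delta> b = l} (\<lambda>b. bar l (e b))"
proof -
  interpret ring_image "stratum l" "corner l" "bar l" by (rule stratum_ring_image[OF l])
  let ?B = "{b \<in> B. \<delta> b = l}"
  have eD: "e b \<in> corner l" if "b \<in> ?B" for b using that corner_e[OF _ l] by simp
  have fin: "finite ?B" by (rule finite_B_weight[OF l])
  have pr: "primitive_idempotent (stratum l) (bar l (e b))" if b: "b \<in> ?B" for b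
  proof (rule primitive_idempotent_image)
    show "primitive_idempotent (subalgebra_ring (corner l)) (e b)"
      using prim[of b] b eD[OF b] unfolding primitive_idempotent_subalgebra_iff
      by (auto simp: corner_def)
  qed
  have orth: "bar l (e b) \<otimes>\<^bsub>stratum l\<^esub> bar l (e c) = \<zero>\<^bsub>stratum l\<^esub>" if "b \<in> ?B" "c \<in> ?B" "b \<noteq> c" for b c
    using that e_orth[of b c] by (simp add: stratum_ops)
  have one: "\<one>\<^bsub>stratum l\<^esub> = finsum (stratum l) (\<lambda>b. bar l (e b)) ?B"
    using finsum_image[OF fin, of e] eD by (simp add: image_subset_iff stratum_ops(4) fibre_idem_def)
  show "primitive_decomposition (stratum l) ?B (\<lambda>b. bar l (e b))"
    unfolding primitive_decomposition_def using fin pr orth one by blast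
  have inj': "inj_on (\<lambda>b. bar l (e b)) ?B"
  proof (rule inj_onI)
    fix b c assume b: "b \<in> ?B" and c: "c \<in> ?B" and "bar l (e b) = bar l (e c)"
    then have eq: "e b = e c" using eq_iff eD by blast
    show "b = c"
    proof (rule ccontr)
      assume "b \<noteq> c"
      then have "e b * e b = 0" using e_orth[of b c] b c eq by simp
      then show False using idem[of b] BI[of b] e_nonzero[of b] b by simp
    qed
  qed
  let ?E = "(\<lambda>b. bar l (e b)) ` ?B"
  have car: "bar l (e b) \<in> carrier (stratum l)" if "b \<in> ?B" for b using eD[OF that] by (simp add: carrier)
  have sum: "finsum (stratum l) (\<lambda>x. x) ?E = finsum (stratum l) (\<lambda>b. bar l (e b)) ?B"
    by (rule abelian_monoid.finsum_reindex[OF abelian_monoid _ inj']) (use car in auto)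
  have dec: "primitive_decomposition (stratum l) ?E (\<lambda>x. x)"
    unfolding primitive_decomposition_def
  proof (intro conjI ballI impI)
    show "finite ?E" using fin by (rule finite_imageI)
    show "primitive_idempotent (stratum l) x" if "x \<in> ?E" for x using that pr by blast
    show "x \<otimes>\<^bsub>stratum l\<^esub> y = \<zero>\<^bsub>stratum l\<^esub>" if xy: "x \<in> ?E" "y \<in> ?E" "x \<noteq> y" for x y
    proof -
      obtain b c where "b \<in> ?B" "c \<in> ?B" "x = bar l (e b)" "y = bar l (e c)" using xy(1,2) by blast
      then show ?thesis using orth[of b c] xy(3) by blast
    qed
    show "\<one>\<^bsub>stratum l\<^esub> = finsum (stratum l) (\<lambda>x. x) ?E" unfolding sum by (rule one)
  qed
  have "\<not> isomorphic_left_ideals (stratum l) (bar l (e b)) (bar l (e c))"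
    if b: "b \<in> ?B" and c: "c \<in> ?B" and bc: "b \<noteq> c" for b c
  proof
    assume "isomorphic_left_ideals (stratum l) (bar l (e b)) (bar l (e c))"
    then obtain p q where pq: "p \<in> corner l" "q \<in> corner l"
      "e b * p = p" "p * e c = p" "e c * q = q" "q * e b = q" "p * q = e b" "q * p = e c"
      using isomorphic_left_ideals_elements[of "e b" "e c"] eD b c idem BI by blast
    have "conjugate_idempotents (subalgebra_ring Acirc) (e b) (e c)"
    proof (rule conjugate_of_isomorphic[OF _ _ _ _ _ _ _ _ _ pq(3-8)])
      show "x + y \<in> Acirc" if "x \<in> Acirc" "y \<in> Acirc" for x y
        using subspace_add[OF cartan_closed(1) that] .
    qed (use pq b c bc BI idem cartan_closed(3) e_orth in \<open>auto simp: corner_def\<close>)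
    then show False using B(2) b c bc unfolding full_set_of_primitive_idempotents_def by blast
  qed
  then show "basic_ring (stratum l)" unfolding basic_ring_def using dec by blast
qed

end

section \<open>Refining the idempotents\<close>

text \<open>
  Every \<open>e' j\<close> lies in the corner of \<open>e (q j)\<close>, so that the conditions on \<open>e' i A e' j\<close> follow from those on
  \<open>e (q i) A e (q j)\<close>.
\<close>

lemma triangular_decomposition_refine:
  fixes e :: "'i \<Rightarrow> 'a::ring" and e' :: "'j \<Rightarrow> 'a"
  assumes td: "triangular_decomposition kind s I e \<Lambda> ord \<delta> Aflat Asharp"
    and dec: "idem_decomp (Aflat \<inter> Asharp) I' e'"
    and q: "q \<in> I' \<rightarrow> I" "\<And>i. i \<in> I \<Longrightarrow> finite {j \<in> I'. q j = i}"
      "\<And>i. i \<in> I \<Longrightarrow> e i = (\<Sum>j | j \<in> I' \<and> q j = i. e' j)"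
  shows "triangular_decomposition kind s I' e' \<Lambda> ord (\<delta> \<circ> q) Aflat Asharp"
proof -
  interpret triangular_decomposition kind s I e \<Lambda> ord \<delta> Aflat Asharp by (rule td)
  interpret E: orthogonal_idempotents I' e' by (rule idem_decomp_orthogonal_idempotents[OF dec])
  have mem: "e' j \<in> Acirc" if "j \<in> I'" for j using dec that by (auto simp: idem_decomp_def)
  have qI: "q j \<in> I" if "j \<in> I'" for j using q(1) that by auto
  have eq: "e (q j) * e' j = e' j" "e' j * e (q j) = e' j" if j: "j \<in> I'" for j
    using E.mult_sum_left[of "{k \<in> I'. q k = q j}" j] E.mult_sum_right[of "{k \<in> I'. q k = q j}" j]
      q(2,3)[OF qI[OF j]] j by auto
  have corner: "e' i * x * e' j = e' i * (e (q i) * x * e (q j)) * e' j" if "i \<in> I'" "j \<in> I'" for i j x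
  proof -
    have "e' i * (e (q i) * x * e (q j)) * e' j = (e' i * e (q i)) * x * (e (q j) * e' j)"
      by (simp add: mult.assoc)
    then show ?thesis using eq that by simp
  qed
  show ?thesis
  proof
    show "idem_decomp UNIV I' e'"
    proof (rule E.idem_decompI)
      fix x
      obtain F where F: "finite F" "F \<subseteq> I" "(\<Sum>i\<in>F. e i) * x = x" "x * (\<Sum>i\<in>F. e i) = x"
        by (rule local_unit1[of x])
      let ?F = "\<Union>i\<in>F. {j \<in> I'. q j = i}"
      have "(\<Sum>i\<in>F. e i) = (\<Sum>i\<in>F. \<Sum>j | j \<in> I' \<and> q j = i. e' j)"
        using F(2) q(3) by (intro sum.cong) auto
      also have "\<dots> = (\<Sum>j\<in>?F. e' j)"
        using F(1,2) q(2) by (intro sum.UNION_disjoint[symmetric]) auto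
      finally have "(\<Sum>j\<in>?F. e' j) = (\<Sum>i\<in>F. e i)" by simp
      moreover have "finite ?F" using F(1,2) q(2) by auto
      ultimately show "\<exists>F. finite F \<and> F \<subseteq> I' \<and> (\<Sum>i\<in>F. e' i) * x = x \<and> x * (\<Sum>i\<in>F. e' i) = x"
        using F(3,4) by (intro exI[of _ ?F]) auto
    qed
    have absorb: "e' i * x = e (q i) * (e' i * x)" "x * e' i = x * e' i * e (q i)" if "i \<in> I'" for i x
      using eq[OF that] by (simp_all add: mult.assoc flip: mult.assoc[of "e (q i)"])
    have "fin_dim s (peirce (e' i) UNIV (e' j))" if ij: "i \<in> I'" "j \<in> I'" for i j
    proof (rule fin_dim_mono[OF fin_dim_peirce[OF qI[OF ij(1)] qI[OF ij(2)]]])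
      have "e' i * x * e' j = e (q i) * (e' i * x * e' j) * e (q j)" for x
      proof -
        have "e (q i) * (e' i * x * e' j) * e (q j) = (e (q i) * e' i) * x * (e' j * e (q j))"
          by (simp add: mult.assoc)
        then show ?thesis using eq ij by simp
      qed
      then show "peirce (e' i) UNIV (e' j) \<subseteq> peirce (e (q i)) UNIV (e (q j))"
        unfolding peirce_def by blast
    qed
    moreover have "fin_dim s (lmul (e' i) UNIV)" if "i \<in> I'" "fin_dim s (lmul (e (q i)) UNIV)" for i
      by (rule fin_dim_mono[OF that(2)]) (use absorb(1)[OF that(1)] in \<open>unfold lmul_def, blast\<close>)
    moreover have "fin_dim s (rmul UNIV (e' i))" if "i \<in> I'" "fin_dim s (rmul UNIV (e (q i)))" for i
      by (rule fin_dim_mono[OF that(2)]) (use absorb(2)[OF that(1)] in \<open>unfold rmul_def, blast\<close>)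
    ultimately show "dim_condition kind s I' e'"
      using dim qI by (cases kind) auto
    show "finite_fibres I' \<Lambda> (\<delta> \<circ> q)"
      unfolding finite_fibres_def
    proof (intro conjI ballI)
      show "\<delta> \<circ> q \<in> I' \<rightarrow> \<Lambda>" using qI weight_in by auto
      fix l assume l: "l \<in> \<Lambda>"
      have "{j \<in> I'. (\<delta> \<circ> q) j = l} \<subseteq> (\<Union>i\<in>{i \<in> I. \<delta> i = l}. {j \<in> I'. q j = i})" using qI by auto
      moreover have "finite (\<Union>i\<in>{i \<in> I. \<delta> i = l}. {j \<in> I'. q j = i})"
        using finite_weight[OF l] q(2) by auto
      ultimately show "finite {j \<in> I'. (\<delta> \<circ> q) j = l}" by (rule finite_subset)
    qed
    show "lu_subalgebra s I' e' Aflat" "lu_subalgebra s I' e' Asharp"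
      using TD3 mem by (auto simp: lu_subalgebra_def)
  next
    fix i j assume ij: "i \<in> I'" "j \<in> I'" "((\<delta> \<circ> q) j, (\<delta> \<circ> q) i) \<notin> ord"
    have "e' j * x * e' i = 0" if "x \<in> Aflat" for x
    proof -
      have "e (q j) * x * e (q i) = 0"
        by (rule ccontr) (use flat_order[OF qI[OF ij(2)] qI[OF ij(1)] that] ij(3) in simp)
      then show ?thesis by (simp only: corner[OF ij(2,1), of x] mult_zero_left mult_zero_right)
    qed
    moreover have "e' i * x * e' j = 0" if "x \<in> Asharp" for x
    proof -
      have "e (q i) * x * e (q j) = 0"
        by (rule ccontr) (use sharp_order[OF qI[OF ij(1)] qI[OF ij(2)] that] ij(3) in simp)
      then show ?thesis by (simp only: corner[OF ij(1,2), of x] mult_zero_left mult_zero_right)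
    qed
    ultimately show "peirce (e' j) Aflat (e' i) = {0} \<and> peirce (e' i) Asharp (e' j) = {0}"
      using subspace_0[OF borel_closed(1)] subspace_0[OF borel_closed(2)]
      by (auto simp: peirce_def intro!: exI[of _ 0])
  next
    fix i j assume ij: "i \<in> I'" "j \<in> I'" "(\<delta> \<circ> q) i = (\<delta> \<circ> q) j"
    have "e' i * x * e' j = e' i * (e (q i) * x * e (q j)) * e' j" for x by (rule corner[OF ij(1,2)])
    moreover have "e (q i) * x * e (q j) \<in> Acirc" if "x \<in> Aflat \<or> x \<in> Asharp" for x
      using same_weight_mem[OF qI[OF ij(1)] qI[OF ij(2)]] ij(3) that by auto
    ultimately show "peirce (e' i) Aflat (e' j) = peirce (e' i) Asharp (e' j)"
      unfolding peirce_def by blast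
  qed (fact TD1 TD4 TD5)+
qed

theorem admissible_data_stratified:
  fixes I \<Lambda> :: "'i set"
  assumes "admissible_data kind s I e \<Lambda> ord \<delta> Aflat Asharp B Y X H" and disj: "\<Lambda> \<inter> I = {}"
  shows "based_stratified_algebra kind s I e B \<Lambda> ord \<delta> Y H X"
proof -
  interpret admissible_data kind s I e \<Lambda> ord \<delta> Aflat Asharp B Y X H by (rule assms(1))
  show ?thesis
  proof
    show "finite_fibres B \<Lambda> \<delta>"
      using weight_in BI finite_B_weight by (auto simp: finite_fibres_def)
    show "Y i a \<subseteq> peirce (e i) UNIV (e a)" if "i \<in> I" "a \<in> B" for i a
      by (intro subsetI peirceI UNIV_I) (use Y_mem[OF that] in auto)
    show "H a b \<subseteq> peirce (e a) UNIV (e b)" if "a \<in> B" "b \<in> B" for a b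
      by (intro subsetI peirceI UNIV_I) (use H_mem[OF that] in auto)
    show "X b j \<subseteq> peirce (e b) UNIV (e j)" if "b \<in> B" "j \<in> I" for b j
      by (intro subsetI peirceI UNIV_I) (use X_mem[OF that] in auto)
    show "let T = (\<Union>a\<in>B. \<Union>b\<in>B. (\<Union>i\<in>I. Y i a) \<times> H a b \<times> (\<Union>j\<in>I. X b j)); p = (\<lambda>(y, h, x). y * h * x)
        in inj_on p T \<and> is_basis s UNIV (p ` T)"
      using triple_product_inj triple_product_independent triple_product_span
      unfolding Let_def is_basis_def triples_def by blast
    show "H a b = {}" if "a \<in> B" "b \<in> B" "a \<noteq> b" "\<delta> a \<noteq> \<delta> b" for a b
    proof -
      have "h = 0" if h: "h \<in> H a b" for h
        using H_mem[OF \<open>a \<in> B\<close> \<open>b \<in> B\<close> h] cartan_block[OF BI BI, of a b h] that \<open>a \<in> B\<close> \<open>b \<in> B\<close> \<open>\<delta> a \<noteq> \<delta> b\<close>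
        by simp
      then show ?thesis using H_nonzero[OF that(1,2)] by blast
    qed
    show "Y b a = {} \<and> X a b = {}"
      if "a \<in> B" "b \<in> B" "a \<noteq> b" "\<not> ((\<delta> b, \<delta> a) \<in> ord \<and> \<delta> b \<noteq> \<delta> a)" for a b
      using Y_order[OF that(1-3)] X_order[OF that(1-3)] that(4) by blast
    show "Y a a = {e a} \<and> X a a = {e a}" if "a \<in> B" for a by (rule YX_diag[OF that])
    show "basic_ring (strat_algebra s B e \<Lambda> ord \<delta> l) \<and>
        primitive_decomposition (strat_algebra s B e \<Lambda> ord \<delta> l) {b \<in> B. \<delta> b = l}
          (\<lambda>b. strat_bar s B e \<Lambda> ord \<delta> l (e b))" if "l \<in> \<Lambda>" for l
      using stratum_basic[OF that] by blast
  qed (fact dim B(1) TD1 disj)+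
qed

theorem theorem5p35:
  fixes kind :: fin_kind
    and s :: "'k::alg_closed_field \<Rightarrow> 'a::ring \<Rightarrow> 'a"
    and I :: "'i set" and e :: "'i \<Rightarrow> 'a"
    and \<Lambda> :: "'l set" and ord :: "('l \<times> 'l) set" and \<delta> :: "'i \<Rightarrow> 'l"
    and Aflat Asharp Acirc :: "'a set"
    and Ihat B :: "'l set" and ehat :: "'l \<Rightarrow> 'a" and q :: "'l \<Rightarrow> 'i"
  assumes td: "triangular_decomposition kind s I e \<Lambda> ord \<delta> Aflat Asharp"
    and Acirc: "Acirc = Aflat \<inter> Asharp"
    and expansion: "idem_expansion Acirc I e Ihat ehat"
    and i: "Ihat \<inter> \<Lambda> = {}"
    and ii: "B \<subseteq> Ihat" "full_set_of_primitive_idempotents (subalgebra_ring Acirc) B ehat"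
    and iii: "q \<in> Ihat \<rightarrow> I"
             "\<And>i. i \<in> I \<Longrightarrow> finite {j \<in> Ihat. q j = i}"
             "\<And>i. i \<in> I \<Longrightarrow> e i = (\<Sum>j | j \<in> Ihat \<and> q j = i. ehat j)"
  shows "triangular_decomposition kind s Ihat ehat \<Lambda> ord (\<delta> \<circ> q) Aflat Asharp \<and>
    (\<forall>i\<in>Ihat. right_B_free Acirc ehat B (lmul (ehat i) Aflat)) \<and>
    (\<forall>j\<in>Ihat. left_B_free Acirc ehat B (rmul Asharp (ehat j))) \<and>
    (\<exists>Y X. admissible_generators Aflat Asharp Ihat ehat B Y X) \<and>
    (\<forall>Y X H. admissible_generators Aflat Asharp Ihat ehat B Y X \<longrightarrow>
      (\<forall>a\<in>B. \<forall>b\<in>B. is_basis s (peirce (ehat a) Acirc (ehat b)) (H a b)) \<longrightarrow>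
      based_stratified_algebra kind s Ihat ehat B \<Lambda> ord (\<delta> \<circ> q) Y H X)"
proof -
  have dec: "idem_decomp (Aflat \<inter> Asharp) Ihat ehat"
    using expansion by (simp add: idem_expansion_def Acirc)
  have td': "triangular_decomposition kind s Ihat ehat \<Lambda> ord (\<delta> \<circ> q) Aflat Asharp"
    by (rule triangular_decomposition_refine[OF td dec iii])
  have loc: "triangular_decomposition_primitive kind s Ihat ehat \<Lambda> ord (\<delta> \<circ> q) Aflat Asharp B"
    using td' ii
    by (simp add: triangular_decomposition_primitive_def triangular_decomposition_primitive_axioms_def Acirc)
  interpret triangular_decomposition_primitive kind s Ihat ehat \<Lambda> ord "\<delta> \<circ> q" Aflat Asharp B
    by (rule loc)
  have "based_stratified_algebra kind s Ihat ehat B \<Lambda> ord (\<delta> \<circ> q) Y H X"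
    if "admissible_generators Aflat Asharp Ihat ehat B Y X"
      "\<forall>a\<in>B. \<forall>b\<in>B. is_basis s (peirce (ehat a) Acirc (ehat b)) (H a b)" for Y X H
  proof -
    interpret admissible_data kind s Ihat ehat \<Lambda> ord "\<delta> \<circ> q" Aflat Asharp B Y X H
      by unfold_locales (use that Acirc in auto)
    show ?thesis using admissible_data_stratified[OF admissible_data_axioms] i by blast
  qed
  moreover have "right_B_free Acirc ehat B (lmul (ehat i) Aflat)"
    "left_B_free Acirc ehat B (rmul Asharp (ehat i))" if "i \<in> Ihat" for i
    using R.column_B_free[OF that] L.column_B_free[OF that]
    by (simp_all add: Acirc lmul_eq_image rmul_eq_image R.column_def L.column_def)
  ultimately show ?thesis using td' admissible_generators_exist by blast
qed

end
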